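(* Let $S=\mathbb C[x,y,z]$, $\mathfrak m=(x,y,z)$, $R=S_{\mathfrak m}$, and for $n\ge 3$ let $J_n=(x(y^n-z^n),\,y(z^n-x^n),\,z(x^n-y^n))\subset S$ be the Fermat ideal and $I_n=J_nR$. Then: (1) for all $n\ge 3$, the analytic spread of $I_n$ is $3$; (2) for all $k\ge 1$, $R/I_n^{(k)}$ is Cohen-Macaulay; (3) putting $\mathfrak a=I_n$: (a) the symbolic Rees algebra $\mathcal R_s(\mathfrak a)$ is Noetherian; (b) $\mathfrak a$ is a set-theoretic complete intersection.
   Context: For an ideal $\mathfrak a$ of a Noetherian ring $R$, the $k$-th symbolic power is $\mathfrak a^{(k)}=\bigcap_{\mathfrak p\in \operatorname{Ass}(R/\mathfrak a)}(\mathfrak a^kR_{\mathfrak p}\cap R)$, and the symbolic Rees algebra is $\mathcal R_s(\mathfrak a)=\bigoplus_{k\ge 0}\mathfrak a^{(k)}t^k\subseteq R[t]$. An ideal $\mathfrak a$ of height $h$ in a local ring $(R,\mathfrak m_R)$ is called a set-theoretic complete intersection if there exist $f_1,\ldots,f_h\in\mathfrak m_R$ with $\sqrt{\mathfrak a}=\sqrt{(f_1,\ldots,f_h)}$. *)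

theory Defs
  imports
    "HOL-Algebra.Algebra"
    "HOL-Algebra.Algebraic_Closure_Type"
    "HOL-Library.Extended_Nat"
    Complex_Main
begin

section \<open>Krull dimension, height, radical\<close>

definition krull_dim :: "('a, 'm) ring_scheme \<Rightarrow> enat" where
  "krull_dim R = Sup {enat n | n. \<exists>P. (\<forall>i\<le>n. primeideal (P i) R) \<and> (\<forall>i<n. P i \<subset> P (Suc i))}"

definition prime_height :: "('a, 'm) ring_scheme \<Rightarrow> 'a set \<Rightarrow> enat" where
  "prime_height R Q =
     Sup {enat n | n. \<exists>P. (\<forall>i\<le>n. primeideal (P i) R) \<and> (\<forall>i<n. P i \<subset> P (Suc i)) \<and> P n = Q}"

definition ideal_height :: "('a, 'm) ring_scheme \<Rightarrow> 'a set \<Rightarrow> enat" where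
  "ideal_height R I = Inf {prime_height R Q | Q. primeideal Q R \<and> I \<subseteq> Q}"

definition radical :: "('a, 'm) ring_scheme \<Rightarrow> 'a set \<Rightarrow> 'a set" where
  "radical R I = {r \<in> carrier R. \<exists>k::nat. r [^]\<^bsub>R\<^esub> k \<in> I}"


section \<open>Local rings, depth, Cohen-Macaulay rings\<close>

definition local_ring :: "('a, 'm) ring_scheme \<Rightarrow> bool" where
  "local_ring R \<longleftrightarrow> cring R \<and> (\<exists>!M. maximalideal M R)"

definition max_ideal :: "('a, 'm) ring_scheme \<Rightarrow> 'a set" where
  "max_ideal R = (THE M. maximalideal M R)"

definition nonzerodivisor :: "('a, 'm) ring_scheme \<Rightarrow> 'a \<Rightarrow> bool" where
  "nonzerodivisor R a \<longleftrightarrow>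
     a \<in> carrier R \<and> (\<forall>b\<in>carrier R. a \<otimes>\<^bsub>R\<^esub> b = \<zero>\<^bsub>R\<^esub> \<longrightarrow> b = \<zero>\<^bsub>R\<^esub>)"

definition regular_sequence :: "('a, 'm) ring_scheme \<Rightarrow> 'a list \<Rightarrow> bool" where
  "regular_sequence R xs \<longleftrightarrow>
     set xs \<subseteq> carrier R \<and>
     (\<forall>i<length xs. let I = Idl\<^bsub>R\<^esub> (set (take i xs))
                    in nonzerodivisor (R Quot I) (I +>\<^bsub>R\<^esub> (xs ! i))) \<and>
     Idl\<^bsub>R\<^esub> (set xs) \<noteq> carrier R"

definition depth :: "('a, 'm) ring_scheme \<Rightarrow> enat" where
  "depth R = Sup {enat (length xs) | xs. regular_sequence R xs \<and> set xs \<subseteq> max_ideal R}"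

definition Cohen_Macaulay :: "('a, 'm) ring_scheme \<Rightarrow> bool" where
  "Cohen_Macaulay R \<longleftrightarrow> noetherian_ring R \<and> local_ring R \<and> depth R = krull_dim R"


section \<open>Localization\<close>

text \<open>The fraction \<open>r/s\<close> is the class of all \<open>(r', s')\<close> with \<open>t (r s' - r' s) = 0\<close>
  for some \<open>t\<close> in the multiplicative set \<open>M\<close>. Sums and products of fractions are computed on
  representatives; all choices give the same class, so the unions below are unions of equal sets.\<close>

definition fraction :: "('a, 'm) ring_scheme \<Rightarrow> 'a set \<Rightarrow> 'a \<Rightarrow> 'a \<Rightarrow> ('a \<times> 'a) set" where
  "fraction R M r s = {(r', s'). r' \<in> carrier R \<and> s' \<in> M \<and>
     (\<exists>t\<in>M. t \<otimes>\<^bsub>R\<^esub> (r \<otimes>\<^bsub>R\<^esub> s') = t \<otimes>\<^bsub>R\<^esub> (r' \<otimes>\<^bsub>R\<^esub> s))}"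

definition localization :: "('a, 'm) ring_scheme \<Rightarrow> 'a set \<Rightarrow> ('a \<times> 'a) set ring" where
  "localization R M = \<lparr>
     carrier = {fraction R M r s | r s. r \<in> carrier R \<and> s \<in> M},
     monoid.mult = (\<lambda>A B. \<Union>(r, s)\<in>A. \<Union>(r', s')\<in>B. fraction R M (r \<otimes>\<^bsub>R\<^esub> r') (s \<otimes>\<^bsub>R\<^esub> s')),
     one = fraction R M \<one>\<^bsub>R\<^esub> \<one>\<^bsub>R\<^esub>,
     ring.zero = fraction R M \<zero>\<^bsub>R\<^esub> \<one>\<^bsub>R\<^esub>,
     add = (\<lambda>A B. \<Union>(r, s)\<in>A. \<Union>(r', s')\<in>B.
              fraction R M ((r \<otimes>\<^bsub>R\<^esub> s') \<oplus>\<^bsub>R\<^esub> (r' \<otimes>\<^bsub>R\<^esub> s)) (s \<otimes>\<^bsub>R\<^esub> s'))\<rparr>"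

definition loc_map :: "('a, 'm) ring_scheme \<Rightarrow> 'a set \<Rightarrow> 'a \<Rightarrow> ('a \<times> 'a) set" where
  "loc_map R M r = fraction R M r \<one>\<^bsub>R\<^esub>"

definition loc_at :: "('a, 'm) ring_scheme \<Rightarrow> 'a set \<Rightarrow> ('a \<times> 'a) set ring" where
  "loc_at R P = localization R (carrier R - P)"

definition extend_loc :: "('a, 'm) ring_scheme \<Rightarrow> 'a set \<Rightarrow> 'a set \<Rightarrow> ('a \<times> 'a) set set" where
  "extend_loc R P I = Idl\<^bsub>loc_at R P\<^esub> (loc_map R (carrier R - P) ` I)"

definition contract_loc ::
  "('a, 'm) ring_scheme \<Rightarrow> 'a set \<Rightarrow> ('a \<times> 'a) set set \<Rightarrow> 'a set" where
  "contract_loc R P K = {r \<in> carrier R. loc_map R (carrier R - P) r \<in> K}"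


section \<open>Symbolic powers, Rees algebras, analytic spread\<close>

abbreviation ideal_power :: "('a, 'm) ring_scheme \<Rightarrow> 'a set \<Rightarrow> nat \<Rightarrow> 'a set" where
  "ideal_power R I k \<equiv> I [^]\<^bsub>ideals_set R\<^esub> k"

text \<open>\<open>Ass(R/I)\<close>: the prime ideals that are annihilators of elements of the \<open>R\<close>-module \<open>R/I\<close>.\<close>

definition Ass_quot :: "('a, 'm) ring_scheme \<Rightarrow> 'a set \<Rightarrow> 'a set set" where
  "Ass_quot R I = {P. primeideal P R \<and>
     (\<exists>U\<in>carrier (R Quot I).
        P = {r \<in> carrier R. (I +>\<^bsub>R\<^esub> r) \<otimes>\<^bsub>R Quot I\<^esub> U = \<zero>\<^bsub>R Quot I\<^esub>})}"

text \<open>Intersecting with \<open>carrier R\<close> only matters when \<open>Ass(R/I)\<close> is empty.\<close>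

definition symbolic_power :: "('a, 'm) ring_scheme \<Rightarrow> 'a set \<Rightarrow> nat \<Rightarrow> 'a set" where
  "symbolic_power R I k = carrier R \<inter>
     (\<Inter>P\<in>Ass_quot R I. contract_loc R P (extend_loc R P (ideal_power R I k)))"

text \<open>The subring \<open>\<Oplus>\<^sub>k F\<^sub>k t\<^sup>k\<close> of \<open>R[t]\<close> for a multiplicative filtration \<open>F\<close> by ideals.\<close>

definition rees_of_filtration ::
  "('a, 'm) ring_scheme \<Rightarrow> (nat \<Rightarrow> 'a set) \<Rightarrow> ('a, nat \<Rightarrow> 'a) up_ring" where
  "rees_of_filtration R F =
     (UP R)\<lparr>carrier := {f \<in> carrier (UP R). \<forall>k. up_ring.coeff (UP R) f k \<in> F k}\<rparr>"

definition rees_algebra :: "('a, 'm) ring_scheme \<Rightarrow> 'a set \<Rightarrow> ('a, nat \<Rightarrow> 'a) up_ring" where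
  "rees_algebra R I = rees_of_filtration R (ideal_power R I)"

definition symbolic_rees_algebra ::
  "('a, 'm) ring_scheme \<Rightarrow> 'a set \<Rightarrow> ('a, nat \<Rightarrow> 'a) up_ring" where
  "symbolic_rees_algebra R I = rees_of_filtration R (symbolic_power R I)"

text \<open>For a local ring with maximal ideal \<open>m\<close>, the fiber cone \<open>\<Oplus>\<^sub>k I\<^sup>k/mI\<^sup>k\<close> is the quotient of the
  Rees algebra by the ideal generated by \<open>m\<close>, sitting in degree \<open>0\<close>.\<close>

definition fiber_cone :: "('a, 'm) ring_scheme \<Rightarrow> 'a set \<Rightarrow> (nat \<Rightarrow> 'a) set ring" where
  "fiber_cone R I = rees_algebra R I Quot
     (Idl\<^bsub>rees_algebra R I\<^esub> ((\<lambda>r. up_ring.monom (UP R) r 0) ` max_ideal R))"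

definition analytic_spread :: "('a, 'm) ring_scheme \<Rightarrow> 'a set \<Rightarrow> enat" where
  "analytic_spread R I = krull_dim (fiber_cone R I)"

definition set_theoretic_complete_intersection :: "('a, 'm) ring_scheme \<Rightarrow> 'a set \<Rightarrow> bool" where
  "set_theoretic_complete_intersection R I \<longleftrightarrow>
     local_ring R \<and> ideal I R \<and>
     (\<exists>fs. enat (length fs) = ideal_height R I \<and> set fs \<subseteq> max_ideal R \<and>
           radical R I = radical R (Idl\<^bsub>R\<^esub> (set fs)))"


section \<open>Fermat ideals\<close>

text \<open>\<open>\<complex>[x,y,z]\<close> is realized as \<open>\<complex>[x][y][z]\<close>.\<close>

definition varx :: "complex poly poly poly" where "varx = [:[:[:0, 1:]:]:]"
definition vary :: "complex poly poly poly" where "vary = [:[:0, 1:]:]"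
definition varz :: "complex poly poly poly" where "varz = [:0, 1:]"

definition S_ring :: "complex poly poly poly ring" where
  "S_ring = ring_of_type_algebra"

definition S_max :: "complex poly poly poly set" where
  "S_max = Idl\<^bsub>S_ring\<^esub> {varx, vary, varz}"

definition fermat_ideal :: "nat \<Rightarrow> complex poly poly poly set" where
  "fermat_ideal n = Idl\<^bsub>S_ring\<^esub>
     {varx * (vary ^ n - varz ^ n), vary * (varz ^ n - varx ^ n), varz * (varx ^ n - vary ^ n)}"

definition R_ring :: "(complex poly poly poly \<times> complex poly poly poly) set ring" where
  "R_ring = loc_at S_ring S_max"

definition local_fermat_ideal ::
  "nat \<Rightarrow> (complex poly poly poly \<times> complex poly poly poly) set set" where
  "local_fermat_ideal n = extend_loc S_ring S_max (fermat_ideal n)"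

end

theory Submission
  imports Defs
begin

text \<open>Put \<open>u = x\<^sup>n - y\<^sup>n\<close>, \<open>v = y\<^sup>n - z\<^sup>n\<close> and \<open>w = z\<^sup>n - x\<^sup>n\<close>. The Fermat ideal \<open>J = (x v, y w, z u)\<close> is the ideal of
  \<open>n\<^sup>2 + 3\<close> lines through the origin, namely the three coordinate axes and the lines spanned by \<open>(1, \<zeta>, \<eta>)\<close>
  with \<open>\<zeta>\<^sup>n = \<eta>\<^sup>n = 1\<close>.

  The heart of the proof is \<open>mem_MI_iff\<close>: the polynomials with prescribed vanishing orders, one order along
  all the \<open>n\<^sup>2\<close> lines and one along each axis, form the ideal generated by the products
  \<open>x\<^sup>a y\<^sup>b z\<^sup>c u\<^sup>d v\<^sup>e w\<^sup>f\<close> that have these orders. It is shown by induction on the degree (\<open>homog_mem_MI\<close>): either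
  the degree is so small that \<open>u\<close> must divide the form, or the form agrees on the plane \<open>z = 0\<close> with a
  combination of such products, and the difference is divisible by \<open>z\<close>. For equal orders \<open>k\<close> the ideal is
  the \<open>k\<close>-th symbolic power (\<open>symbolic_iff\<close>, \<open>fr_mem_symbolic\<close>). For \<open>k = 1\<close> this gives that \<open>J\<close> is
  radical (\<open>Jp_1_iff\<close>), so that the associated primes of \<open>I\<close> are those of the lines.

  The four conditions on the exponents \<open>(a, \<dots>, f, k)\<close> are linear inequalities. By Dickson's lemma their
  solutions form a finitely generated monoid, so the symbolic Rees algebra is finitely generated over
  \<open>R\<close> and is Noetherian by the Hilbert basis theorem (\<open>noetherian_symbolic_rees\<close>).

  The quotient of \<open>R\<close> by a symbolic power is Cohen-Macaulay since it has dimension one and an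
  element outside the primes of the lines is regular on it (\<open>Cohen_Macaulay_symbolic\<close>).

  The polynomial ring has dimension at most three because any four polynomials are algebraically
  dependent (\<open>no_chain_S\<close>). This bounds the height of \<open>I\<close> by \<open>2\<close> and the dimension of the fiber
  cone by \<open>3\<close>, since the latter is a quotient of the polynomial ring (\<open>\<Psi>_surj\<close>). Conversely, taking lowest
  homogeneous components maps the fiber cone to a polynomial ring in which a chain of four primes is
  visible on \<open>f1\<close>, \<open>f2 + f3\<close> and \<open>f2\<close> (\<open>chain_fiber\<close>), where \<open>f1, f2, f3\<close> are the generators of \<open>J\<close>.

  Finally \<open>I\<close> is the radical of two elements, \<open>u v w\<close> and \<open>x\<^sup>n v\<^sup>2 + y\<^sup>n w\<^sup>2 + z\<^sup>n u\<^sup>2\<close> (\<open>F1_F2_power\<close>).\<close>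

section \<open>Powers of an ideal with two generators\<close>

text \<open>The \<open>k\<close>-th power of the ideal \<open>(a, b)\<close>. Splitting off one generator at a time fits the inductions
  on \<open>k\<close> below.\<close>

primrec pw :: "'a::comm_ring_1 \<Rightarrow> 'a \<Rightarrow> nat \<Rightarrow> 'a set" where
  "pw a b 0 = UNIV"
| "pw a b (Suc k) = {a * p + b * q | p q. p \<in> pw a b k \<and> q \<in> pw a b k}"

lemma pw_SucI: "p \<in> pw a b k \<Longrightarrow> q \<in> pw a b k \<Longrightarrow> a * p + b * q \<in> pw a b (Suc k)"
  by auto

lemma pw_ideal: "0 \<in> pw a b k \<and> (\<forall>f\<in>pw a b k. \<forall>g\<in>pw a b k. f + g \<in> pw a b k) \<and>
  (\<forall>f\<in>pw a b k. \<forall>r. r * f \<in> pw a b k)"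
proof (induction k)
  case (Suc k)
  have "0 \<in> pw a b (Suc k)"
    using Suc pw_SucI[of 0 a b k 0] by simp
  moreover have "f + g \<in> pw a b (Suc k)" if fg: "f \<in> pw a b (Suc k)" "g \<in> pw a b (Suc k)" for f g
  proof -
    obtain p q p' q' where *: "f = a * p + b * q" "g = a * p' + b * q'"
      "p \<in> pw a b k" "q \<in> pw a b k" "p' \<in> pw a b k" "q' \<in> pw a b k"
      using fg by auto
    have "f + g = a * (p + p') + b * (q + q')"
      by (simp add: * algebra_simps)
    then show ?thesis using * Suc pw_SucI by metis
  qed
  moreover have "r * f \<in> pw a b (Suc k)" if f: "f \<in> pw a b (Suc k)" for f r
  proof -
    obtain p q where *: "f = a * p + b * q" "p \<in> pw a b k" "q \<in> pw a b k"
      using f by auto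
    have "r * f = a * (r * p) + b * (r * q)"
      by (simp add: * algebra_simps)
    then show ?thesis using * Suc pw_SucI by metis
  qed
  ultimately show ?case by blast
qed simp

lemma pw_zero [simp]: "0 \<in> pw a b k"
  and pw_add: "f \<in> pw a b k \<Longrightarrow> g \<in> pw a b k \<Longrightarrow> f + g \<in> pw a b k"
  and pw_lmult: "f \<in> pw a b k \<Longrightarrow> r * f \<in> pw a b k"
  using pw_ideal by blast+

lemma pw_minus: "f \<in> pw a b k \<Longrightarrow> g \<in> pw a b k \<Longrightarrow> f - g \<in> pw a b k"
  using pw_add[of f a b k "-1 * g"] pw_lmult[of g a b k "-1"] by simp

lemma pw_rmult: "f \<in> pw a b k \<Longrightarrow> f * r \<in> pw a b k"
  using pw_lmult[of f a b k r] by (simp add: mult.commute)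

lemma pw_Suc_subset: "pw a b (Suc k) \<subseteq> pw a b k"
  by (auto intro!: pw_add pw_lmult)

lemma pw_antimono: "j \<le> k \<Longrightarrow> f \<in> pw a b k \<Longrightarrow> f \<in> pw a b j"
  using pw_Suc_subset lift_Suc_antimono_le[of "pw a b" j k] by blast

lemma pw_mult: "f \<in> pw a b j \<Longrightarrow> g \<in> pw a b k \<Longrightarrow> f * g \<in> pw a b (j + k)"
proof (induction j arbitrary: f)
  case 0
  then show ?case by (simp add: pw_lmult)
next
  case (Suc j)
  then obtain p q where *: "f = a * p + b * q" "p \<in> pw a b j" "q \<in> pw a b j"
    by auto
  have "f * g = a * (p * g) + b * (q * g)"
    by (simp add: * algebra_simps)
  then show ?case using Suc * pw_SucI[of "p * g" a b "j + k" "q * g"] by simp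
qed

lemma pw_power: "f \<in> pw a b j \<Longrightarrow> f ^ k \<in> pw a b (j * k)"
  by (induction k) (simp_all add: pw_mult)

lemma pw_gen1: "a \<in> pw a b 1" and pw_gen2: "b \<in> pw a b 1"
proof -
  have "a * 1 + b * 0 \<in> pw a b 1" "a * 0 + b * 1 \<in> pw a b 1"
    unfolding One_nat_def pw.simps by blast+
  then show "a \<in> pw a b 1" "b \<in> pw a b 1" by simp_all
qed

lemma pw_mono_gens:
  assumes "a \<in> pw c d j" "b \<in> pw c d j" "f \<in> pw a b k"
  shows "f \<in> pw c d (j * k)"
  using assms(3)
proof (induction k arbitrary: f)
  case (Suc k)
  then obtain p q where *: "f = a * p + b * q" "p \<in> pw a b k" "q \<in> pw a b k"
    by auto
  then show ?case
    using pw_add[OF pw_mult[OF assms(1) Suc.IH[OF *(2)]] pw_mult[OF assms(2) Suc.IH[OF *(3)]]]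
    by simp
qed simp

lemma pw_commute: "pw a b k = pw b a k"
  using pw_mono_gens[of a b a 1 b _ k] pw_mono_gens[of b a b 1 a _ k] pw_gen1 pw_gen2
  by (metis mult_1 subset_antisym subsetI)

lemma pw_split:
  assumes "f \<in> pw a b (Suc k)"
  obtains c p where "f = c * b ^ Suc k + a * p" "p \<in> pw a b k"
  using assms
proof (induction k arbitrary: f thesis)
  case 0
  then obtain p q where "f = a * p + b * q" by auto
  then show ?case using 0(1)[of q p] by (simp add: algebra_simps)
next
  case (Suc k)
  then obtain p q where *: "f = a * p + b * q" "p \<in> pw a b (Suc k)" "q \<in> pw a b (Suc k)"
    by auto
  obtain c r where r: "q = c * b ^ Suc k + a * r" "r \<in> pw a b k"
    using Suc.IH[OF _ *(3)] by metis
  have "b * r \<in> pw a b (Suc k)"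
    using pw_mult[OF pw_gen2[of b a] r(2)] by (simp del: pw.simps)
  then have "p + b * r \<in> pw a b (Suc k)" using * pw_add by blast
  moreover have "f = c * b ^ Suc (Suc k) + a * (p + b * r)"
    by (simp add: * r algebra_simps)
  ultimately show ?case using Suc.prems(1) by blast
qed

lemma pw_second_power: "b ^ k \<in> pw a b k"
  using pw_power[OF pw_gen2[of b a], of k] by simp

text \<open>For a regular pair \<open>a, b\<close> the order of vanishing along \<open>(a, b)\<close> drops by at most one
  when a factor \<open>a\<close> is cancelled: modulo \<open>a\<close>, only the pure power of \<open>b\<close> is left.\<close>

lemma pw_cancel_gen:
  fixes a b :: "'a::idom"
  assumes "a \<noteq> 0" and reg: "\<And>g. a dvd b * g \<Longrightarrow> a dvd g" and ah: "a * h \<in> pw a b (Suc k)"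
  shows "h \<in> pw a b k"
proof -
  have regk: "a dvd b ^ j * g \<Longrightarrow> a dvd g" for j g
    by (induction j) (auto simp: mult.assoc dest: reg)
  obtain c p where cp: "a * h = c * b ^ Suc k + a * p" "p \<in> pw a b k"
    using pw_split[OF ah] by metis
  have "a dvd b ^ Suc k * c"
    using cp(1) by (metis add_diff_cancel_right' dvd_diff dvd_triv_left mult.commute)
  then obtain c' where "c = a * c'" using regk by (metis dvdE)
  then have "a * h = a * (c' * b ^ Suc k + p)" by (simp add: cp algebra_simps)
  then have "h = c' * b ^ Suc k + p" using assms(1) by simp
  moreover have "c' * b ^ Suc k \<in> pw a b k"
    by (intro pw_lmult pw_antimono[OF _ pw_second_power]) simp
  ultimately show ?thesis using cp(2) pw_add by blast
qed

text \<open>The graded ring of \<open>(a, b)\<close> is a polynomial ring over the quotient by \<open>(a, b)\<close>, so a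
  denominator that can be cancelled modulo \<open>(a, b)\<close> can be cancelled modulo every power. The
  lemma allows a different denominator at each of several components of the zero set.\<close>

lemma pw_cancel_family:
  fixes a b :: "'a::idom"
  assumes "a \<noteq> 0" and reg: "\<And>g. a dvd b * g \<Longrightarrow> a dvd g"
    and base: "\<And>g. (\<And>M. M \<in> \<S> \<Longrightarrow> \<exists>s\<in>M. s * g \<in> pw a b 1) \<Longrightarrow> g \<in> pw a b 1"
    and "\<And>M. M \<in> \<S> \<Longrightarrow> \<exists>s\<in>M. s * g \<in> pw a b k"
  shows "g \<in> pw a b k"
  using assms(4)
proof (induction k arbitrary: g)
  case (Suc k)
  have regk: "a dvd b ^ j * g \<Longrightarrow> a dvd g" for j g
    by (induction j) (auto simp: mult.assoc dest: reg)
  have gk: "g \<in> pw a b k"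
    using Suc.IH Suc.prems subsetD[OF pw_Suc_subset] by blast
  show ?case
  proof (cases k)
    case 0
    then show ?thesis using base Suc.prems by simp
  next
    case (Suc j)
    obtain c p where cp: "g = c * b ^ k + a * p" "p \<in> pw a b j"
      using pw_split gk Suc by metis
    have "c \<in> pw a b 1"
    proof (rule base)
      fix M assume "M \<in> \<S>"
      then obtain s where s: "s \<in> M" "s * g \<in> pw a b (Suc k)" using Suc.prems by blast
      obtain c' p' where c': "s * g = c' * b ^ Suc k + a * p'"
        using pw_split[OF s(2)] by metis
      have "b ^ k * (s * c - c' * b) = a * (p' - s * p)"
        using c' cp(1) by (simp add: algebra_simps)
      then have "a dvd s * c - c' * b" using regk by (metis dvd_triv_left)
      then obtain e where "s * c = a * e + b * c'" by (metis dvdE diff_eq_eq mult.commute)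
      then have "s * c \<in> pw a b 1" by auto
      then show "\<exists>s\<in>M. s * c \<in> pw a b 1" using s by blast
    qed
    then have cb: "c * b ^ k \<in> pw a b (Suc k)"
      using pw_mult[OF _ pw_second_power, of c a b 1 k] by simp
    have "p \<in> pw a b k"
    proof (rule Suc.IH)
      fix M assume "M \<in> \<S>"
      then obtain s where s: "s \<in> M" "s * g \<in> pw a b (Suc k)" using Suc.prems by blast
      have "s * g - s * (c * b ^ k) \<in> pw a b (Suc k)"
        using s cb pw_minus pw_lmult by blast
      also have "s * g - s * (c * b ^ k) = a * (s * p)"
        by (simp add: cp algebra_simps)
      finally show "\<exists>s\<in>M. s * p \<in> pw a b k"
        using pw_cancel_gen[OF assms(1) reg] s(1) by blast
    qed
    then have "a * p \<in> pw a b (Suc k)"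
      using pw_mult[OF pw_gen1] by fastforce
    then show ?thesis using cb cp(1) pw_add by blast
  qed
qed simp

lemma pw_cancel:
  fixes a b :: "'a::idom"
  assumes "a \<noteq> 0" "\<And>g. a dvd b * g \<Longrightarrow> a dvd g"
    and "\<And>g. s * g \<in> pw a b 1 \<Longrightarrow> g \<in> pw a b 1" and "s * g \<in> pw a b k"
  shows "g \<in> pw a b k"
proof (rule pw_cancel_family[where \<S> = "{{s}}", OF assms(1,2)])
  show "h \<in> pw a b 1" if "\<And>M. M \<in> {{s}} \<Longrightarrow> \<exists>s\<in>M. s * h \<in> pw a b 1" for h
    by (rule assms(3)) (use that[of "{s}"] in blast)
  show "\<exists>s'\<in>M. s' * g \<in> pw a b k" if "M \<in> {{s}}" for M
    using that assms(4) by blast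
qed

section \<open>Polynomials in three variables\<close>

definition is_hom :: "('a::comm_ring_1 \<Rightarrow> 'b::comm_ring_1) \<Rightarrow> bool" where
  "is_hom h \<longleftrightarrow> h 1 = 1 \<and> (\<forall>a b. h (a + b) = h a + h b) \<and> (\<forall>a b. h (a * b) = h a * h b)"

lemma is_hom_one: "is_hom h \<Longrightarrow> h 1 = 1"
  and is_hom_add: "is_hom h \<Longrightarrow> h (a + b) = h a + h b"
  and is_hom_mult: "is_hom h \<Longrightarrow> h (a * b) = h a * h b"
  by (simp_all add: is_hom_def)

lemma is_hom_zero: "is_hom h \<Longrightarrow> h 0 = 0"
  using is_hom_add[of h 0 0] by simp

lemma is_hom_uminus: "is_hom h \<Longrightarrow> h (- a) = - h a"
  using is_hom_add[of h a "- a"] is_hom_zero[of h] by (simp add: eq_neg_iff_add_eq_0 add.commute)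

lemma is_hom_diff: "is_hom h \<Longrightarrow> h (a - b) = h a - h b"
  using is_hom_add[of h a "- b"] is_hom_uminus[of h b] by simp

lemma is_hom_power: "is_hom h \<Longrightarrow> h (a ^ k) = h a ^ k"
  by (induction k) (simp_all add: is_hom_one is_hom_mult)

lemma is_hom_sum: "is_hom h \<Longrightarrow> h (sum f A) = (\<Sum>x\<in>A. h (f x))"
  by (induction A rule: infinite_finite_induct) (simp_all add: is_hom_zero is_hom_add)

lemmas is_hom_simps = is_hom_zero is_hom_one is_hom_add is_hom_mult is_hom_uminus is_hom_diff
  is_hom_power is_hom_sum

lemma is_hom_comp: "is_hom g \<Longrightarrow> is_hom h \<Longrightarrow> is_hom (\<lambda>x. g (h x))"
  by (simp add: is_hom_def)

lemma is_hom_const: "is_hom (\<lambda>c. [:c:])"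
  by (simp add: is_hom_def one_pCons)

lemma is_hom_poly: "is_hom (\<lambda>p. poly p c)"
  by (simp add: is_hom_def)

lemma is_hom_id: "is_hom (\<lambda>x. x)"
  by (simp add: is_hom_def)

lemma is_hom_map_poly:
  assumes h: "is_hom h"
  shows "is_hom (map_poly h)"
proof -
  have 0: "h 0 = 0" by (rule is_hom_zero[OF h])
  show ?thesis
    unfolding is_hom_def
  proof (intro conjI allI)
    show "map_poly h 1 = 1" by (simp add: map_poly_1' is_hom_one[OF h])
    show "map_poly h (p + q) = map_poly h p + map_poly h q" for p q
      by (rule poly_eqI) (simp add: coeff_map_poly[of h, OF 0] is_hom_simps[OF h])
    show "map_poly h (p * q) = map_poly h p * map_poly h q" for p q
      by (rule poly_eqI) (simp add: coeff_map_poly[of h, OF 0] coeff_mult is_hom_simps[OF h])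
  qed
qed

lemma pw_hom: "is_hom h \<Longrightarrow> f \<in> pw a b k \<Longrightarrow> h f \<in> pw (h a) (h b) k"
proof (induction k arbitrary: f)
  case (Suc k)
  then obtain p q where *: "f = a * p + b * q" "p \<in> pw a b k" "q \<in> pw a b k"
    by auto
  then show ?case using Suc pw_SucI[of "h p" "h a" "h b" k "h q"]
    by (simp add: is_hom_simps[OF Suc.prems(1)] del: pw.simps)
qed simp

lemma pw_zero_left: "f \<in> pw 0 b k \<Longrightarrow> b ^ k dvd f"
proof (induction k arbitrary: f)
  case (Suc k)
  then show ?case by (auto simp: mult_dvd_mono)
qed simp

text \<open>Evaluation at \<open>x = a\<close>, \<open>y = b\<close>, \<open>z = c\<close> along a homomorphism \<open>\<kappa>\<close> on the coefficients. All
  homomorphisms on the polynomial ring below (restriction to lines and planes, gradings, the map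
  onto the fiber cone) are of this form, so that they can be compared on the variables.\<close>

definition ev :: "(complex \<Rightarrow> 'a::comm_ring_1) \<Rightarrow> 'a \<Rightarrow> 'a \<Rightarrow> 'a \<Rightarrow> complex poly poly poly \<Rightarrow> 'a" where
  "ev \<kappa> a b c f =
     poly (map_poly (\<lambda>g. poly (map_poly (\<lambda>h. poly (map_poly \<kappa> h) a) g) b) f) c"

lemma is_hom_ev: "is_hom \<kappa> \<Longrightarrow> is_hom (ev \<kappa> a b c)"
  unfolding ev_def
  by (intro is_hom_comp[OF is_hom_poly] is_hom_map_poly)

definition cst :: "complex \<Rightarrow> complex poly poly poly" where "cst c = [:[:[:c:]:]:]"

lemma is_hom_cst: "is_hom cst"
  unfolding cst_def by (simp add: is_hom_def one_pCons)

lemma ev_gens: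
  assumes "is_hom \<kappa>"
  shows "ev \<kappa> a b c varx = a" "ev \<kappa> a b c vary = b" "ev \<kappa> a b c varz = c"
    "ev \<kappa> a b c (cst d) = \<kappa> d"
proof -
  have 1: "is_hom (\<lambda>h. poly (map_poly \<kappa> h) a)"
    by (intro is_hom_comp[OF is_hom_poly] is_hom_map_poly assms)
  have 2: "is_hom (\<lambda>g. poly (map_poly (\<lambda>h. poly (map_poly \<kappa> h) a) g) b)"
    by (intro is_hom_comp[OF is_hom_poly] is_hom_map_poly 1)
  note z = is_hom_zero[OF assms] is_hom_one[OF assms] is_hom_zero[OF 1] is_hom_one[OF 1]
     is_hom_zero[OF 2] is_hom_one[OF 2]
  show "ev \<kappa> a b c varx = a" "ev \<kappa> a b c vary = b" "ev \<kappa> a b c varz = c"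
    "ev \<kappa> a b c (cst d) = \<kappa> d"
    by (simp_all add: ev_def varx_def vary_def varz_def cst_def map_poly_pCons z)
qed

lemma poly_gen_induct:
  fixes f :: "'a::comm_ring_1 poly"
  assumes "\<And>c. P [:c:]" "\<And>f g. P f \<Longrightarrow> P g \<Longrightarrow> P (f + g)" "\<And>f. P f \<Longrightarrow> P ([:0, 1:] * f)"
  shows "P f"
proof (induction f)
  case 0
  then show ?case using assms(1)[of 0] by simp
next
  case (pCons a p)
  have "pCons a p = [:a:] + [:0, 1:] * p" by simp
  then show ?case using assms pCons by metis
qed

lemma S_induct [case_names cst add x y z]:
  assumes c: "\<And>c. P (cst c)" and a: "\<And>f g. P f \<Longrightarrow> P g \<Longrightarrow> P (f + g)"
    and x: "\<And>f. P f \<Longrightarrow> P (varx * f)" and y: "\<And>f. P f \<Longrightarrow> P (vary * f)"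
    and z: "\<And>f. P f \<Longrightarrow> P (varz * f)"
  shows "P f"
proof (rule poly_gen_induct[where P = P])
  fix g show "P [:g:]"
  proof (rule poly_gen_induct[where P = "\<lambda>g. P [:g:]"])
    fix h show "P [:[:h:]:]"
    proof (rule poly_gen_induct[where P = "\<lambda>h. P [:[:h:]:]"])
      show "P [:[:[:c:]:]:]" for c using c[of c] by (simp add: cst_def)
      show "P [:[:f:]:] \<Longrightarrow> P [:[:g:]:] \<Longrightarrow> P [:[:f + g:]:]" for f g
        using a[of "[:[:f:]:]" "[:[:g:]:]"] by simp
      show "P [:[:f:]:] \<Longrightarrow> P [:[:[:0, 1:] * f:]:]" for f
        using x[of "[:[:f:]:]"] by (simp add: varx_def)
    qed
    show "P [:f:] \<Longrightarrow> P [:g:] \<Longrightarrow> P [:f + g:]" for f g using a[of "[:f:]" "[:g:]"] by simp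
    show "P [:f:] \<Longrightarrow> P [:[:0, 1:] * f:]" for f using y[of "[:f:]"] by (simp add: vary_def)
  qed
  show "P g \<Longrightarrow> P ([:0, 1:] * g)" for g using z[of g] by (simp add: varz_def)
qed (rule a)

lemma hom_eqI:
  assumes g: "is_hom g" and h: "is_hom h" and "\<And>c. g (cst c) = h (cst c)"
    "g varx = h varx" "g vary = h vary" "g varz = h varz"
  shows "g f = h f"
  by (induction f rule: S_induct) (simp_all add: assms is_hom_simps[OF g] is_hom_simps[OF h])

lemma ev_comp:
  assumes h: "is_hom h" and k: "is_hom \<kappa>"
  shows "h (ev \<kappa> a b c f) = ev (\<lambda>d. h (\<kappa> d)) (h a) (h b) (h c) f"
proof -
  note hk = is_hom_comp[OF h k]
  show ?thesis
    by (rule hom_eqI[OF is_hom_comp[OF h is_hom_ev[OF k]] is_hom_ev[OF hk]])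
       (simp_all add: ev_gens[OF k] ev_gens[OF hk])
qed

lemma ev_self [simp]: "ev cst varx vary varz f = f"
  by (rule hom_eqI[OF is_hom_ev[OF is_hom_cst] is_hom_id]) (simp_all add: ev_gens[OF is_hom_cst])

text \<open>Taylor expansion to first order: substitution changes a polynomial only by a combination
  of the changes of the variables.\<close>

lemma ev_cong_ideal:
  fixes K :: "complex poly poly poly set"
  assumes K: "0 \<in> K" "\<And>f g. f \<in> K \<Longrightarrow> g \<in> K \<Longrightarrow> f + g \<in> K" "\<And>r f. f \<in> K \<Longrightarrow> r * f \<in> K"
    and "varx - a \<in> K" "vary - b \<in> K" "varz - c \<in> K"
  shows "f - ev cst a b c f \<in> K"
proof (induction f rule: S_induct)
  case (cst c)
  then show ?case by (simp add: ev_gens[OF is_hom_cst] K)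
next
  case (add f g)
  have "f + g - ev cst a b c (f + g) = (f - ev cst a b c f) + (g - ev cst a b c g)"
    by (simp add: is_hom_simps[OF is_hom_ev[OF is_hom_cst]])
  then show ?case using add K(2) by metis
next
  case (x f)
  have "varx * f - ev cst a b c (varx * f)
    = varx * (f - ev cst a b c f) + ev cst a b c f * (varx - a)"
    by (simp add: is_hom_simps[OF is_hom_ev[OF is_hom_cst]] ev_gens[OF is_hom_cst] algebra_simps)
  then show ?case using x K assms(4) by metis
next
  case (y f)
  have "vary * f - ev cst a b c (vary * f)
    = vary * (f - ev cst a b c f) + ev cst a b c f * (vary - b)"
    by (simp add: is_hom_simps[OF is_hom_ev[OF is_hom_cst]] ev_gens[OF is_hom_cst] algebra_simps)
  then show ?case using y K assms(5) by metis
next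
  case (z f)
  have "varz * f - ev cst a b c (varz * f)
    = varz * (f - ev cst a b c f) + ev cst a b c f * (varz - c)"
    by (simp add: is_hom_simps[OF is_hom_ev[OF is_hom_cst]] ev_gens[OF is_hom_cst] algebra_simps)
  then show ?case using z K assms(6) by metis
qed

section \<open>Coefficients and the grading\<close>

definition cf :: "complex poly poly poly \<Rightarrow> nat \<Rightarrow> nat \<Rightarrow> nat \<Rightarrow> complex" where
  "cf f i j l = poly.coeff (poly.coeff (poly.coeff f l) j) i"

lemma cf_zero [simp]: "cf 0 i j l = 0"
  and cf_add [simp]: "cf (f + g) i j l = cf f i j l + cf g i j l"
  and cf_diff [simp]: "cf (f - g) i j l = cf f i j l - cf g i j l"
  by (simp_all add: cf_def)

lemma cf_varx: "cf (varx * f) i j l = (if i = 0 then 0 else cf f (i - 1) j l)"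
  and cf_vary: "cf (vary * f) i j l = (if j = 0 then 0 else cf f i (j - 1) l)"
  and cf_varz: "cf (varz * f) i j l = (if l = 0 then 0 else cf f i j (l - 1))"
  by (auto simp: cf_def varx_def vary_def varz_def coeff_pCons split: nat.splits)

lemma cf_cst: "cf (cst c) i j l = (if i = 0 \<and> j = 0 \<and> l = 0 then c else 0)"
  by (auto simp: cf_def cst_def coeff_pCons split: nat.splits)

lemma cf_varx_power: "cf (varx ^ n * f) i j l = (if i < n then 0 else cf f (i - n) j l)"
  by (induction n arbitrary: i) (auto simp: cf_varx mult.assoc)

lemma cf_vary_power: "cf (vary ^ n * f) i j l = (if j < n then 0 else cf f i (j - n) l)"
  by (induction n arbitrary: j) (auto simp: cf_vary mult.assoc)

lemma cf_varz_power: "cf (varz ^ n * f) i j l = (if l < n then 0 else cf f i j (l - n))"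
  by (induction n arbitrary: l) (auto simp: cf_varz mult.assoc)

lemma poly_mem_of_monoms:
  fixes f :: "'a::comm_ring_1 poly"
  assumes "0 \<in> K" "\<And>f g. f \<in> K \<Longrightarrow> g \<in> K \<Longrightarrow> f + g \<in> K"
    and "\<And>i. poly.coeff f i \<noteq> 0 \<Longrightarrow> \<phi> ([:poly.coeff f i:] * [:0, 1:] ^ i) \<in> K"
    and \<phi>: "\<phi> 0 = 0" "\<And>p q. \<phi> (p + q) = \<phi> p + \<phi> q"
  shows "\<phi> f \<in> K"
proof -
  have "\<phi> (\<Sum>i\<in>A. Polynomial.monom (poly.coeff f i) i) \<in> K" if "finite A" for A
    using that
  proof induction
    case (insert i A)
    have "\<phi> (Polynomial.monom (poly.coeff f i) i) \<in> K"
      using assms(1) assms(3)[of i] \<phi>(1) by (cases "poly.coeff f i = 0") (simp_all add: monom_altdef)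
    then show ?case using insert assms(2) by (simp add: \<phi>)
  qed (simp add: assms)
  from this[of "{..Polynomial.degree f}"] show ?thesis
    by (simp add: poly_as_sum_of_monoms)
qed

lemma mem_of_monomials:
  assumes K: "0 \<in> K" "\<And>f g. f \<in> K \<Longrightarrow> g \<in> K \<Longrightarrow> f + g \<in> K"
    and mon: "\<And>i j l. cf f i j l \<noteq> 0 \<Longrightarrow> cst (cf f i j l) * varx ^ i * vary ^ j * varz ^ l \<in> K"
  shows "f \<in> K"
proof (rule poly_mem_of_monoms[OF K, where \<phi> = "\<lambda>f. f"])
  fix l
  show "[:poly.coeff f l:] * [:0, 1:] ^ l \<in> K"
  proof (rule poly_mem_of_monoms[OF K, where \<phi> = "\<lambda>g. [:g:] * [:0, 1:] ^ l"])
    fix j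
    show "[:[:poly.coeff (poly.coeff f l) j:] * [:0, 1:] ^ j:] * [:0, 1:] ^ l \<in> K"
    proof (rule poly_mem_of_monoms[OF K, where \<phi> = "\<lambda>h. [:[:h:] * [:0, 1:] ^ j:] * [:0, 1:] ^ l"])
      fix i assume "poly.coeff (poly.coeff (poly.coeff f l) j) i \<noteq> 0"
      then have "cst (cf f i j l) * varx ^ i * vary ^ j * varz ^ l \<in> K"
        by (intro mon) (simp add: cf_def)
      also have "cst (cf f i j l) * varx ^ i * vary ^ j * varz ^ l =
        [:[:[:poly.coeff (poly.coeff (poly.coeff f l) j) i:] * [:0, 1:] ^ i:] * [:0, 1:] ^ j:] * [:0, 1:] ^ l"
        by (simp only: cst_def cf_def varx_def vary_def varz_def is_hom_power[OF is_hom_const, symmetric]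
           is_hom_mult[OF is_hom_const] mult.assoc)
      finally show "[:[:[:poly.coeff (poly.coeff (poly.coeff f l) j) i:] * [:0, 1:] ^ i:] * [:0, 1:] ^ j:] * [:0, 1:] ^ l \<in> K" .
    next
      show "[:[:p + q:] * [:0, 1:] ^ j:] * [:0, 1:] ^ l
        = [:[:p:] * [:0, 1:] ^ j:] * [:0, 1:] ^ l + [:[:q:] * [:0, 1:] ^ j:] * [:0, 1:] ^ l" for p q :: "complex poly"
        by (simp only: is_hom_simps[OF is_hom_const] distrib_right)
    qed simp_all
  next
    show "[:p + q:] * [:0, 1:] ^ l = [:p:] * [:0, 1:] ^ l + [:q:] * [:0, 1:] ^ l" for p q :: "complex poly poly"
      by (simp only: is_hom_simps[OF is_hom_const] distrib_right)
  qed simp_all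
qed simp_all

text \<open>The substitution of \<open>\<lambda>x, \<lambda>y, \<lambda>z\<close> for \<open>x, y, z\<close>, with values in the polynomials in \<open>\<lambda>\<close>. Its
  coefficients are the homogeneous components, and multiplicativity of the grading is the
  homomorphism property.\<close>

definition grading :: "complex poly poly poly \<Rightarrow> complex poly poly poly poly" where
  "grading = ev (\<lambda>c. [:cst c:]) [:0, varx:] [:0, vary:] [:0, varz:]"

definition hcomp :: "nat \<Rightarrow> complex poly poly poly \<Rightarrow> complex poly poly poly" where
  "hcomp d f = poly.coeff (grading f) d"

lemma is_hom_const_cst: "is_hom (\<lambda>c. [:cst c:])"
  by (rule is_hom_comp[OF is_hom_const is_hom_cst])

lemma is_hom_grading: "is_hom grading"
  unfolding grading_def by (rule is_hom_ev[OF is_hom_const_cst])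

lemmas grading_simps = is_hom_simps[OF is_hom_grading]

lemma grading_gens:
  "grading varx = Polynomial.monom varx 1" "grading vary = Polynomial.monom vary 1"
  "grading varz = Polynomial.monom varz 1" "grading (cst c) = [:cst c:]"
  by (simp_all add: grading_def ev_gens[OF is_hom_const_cst] monom_altdef)

definition homog :: "nat \<Rightarrow> complex poly poly poly \<Rightarrow> bool" where
  "homog d f \<longleftrightarrow> grading f = Polynomial.monom f d"

lemma homog_gens: "homog 1 varx" "homog 1 vary" "homog 1 varz" "homog 0 (cst c)" "homog 0 1" "homog d 0"
  by (simp_all add: homog_def grading_gens grading_simps monom_0)

lemma homog_mult: "homog d f \<Longrightarrow> homog e g \<Longrightarrow> homog (d + e) (f * g)"
  by (simp add: homog_def grading_simps mult_monom)

lemma homog_power: "homog d f \<Longrightarrow> homog (d * k) (f ^ k)"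
  by (induction k) (use homog_gens homog_mult in auto)

lemma homog_add: "homog d f \<Longrightarrow> homog d g \<Longrightarrow> homog d (f + g)"
  and homog_diff: "homog d f \<Longrightarrow> homog d g \<Longrightarrow> homog d (f - g)"
  by (simp_all add: homog_def grading_simps add_monom diff_monom)

lemma hcomp_add: "hcomp d (f + g) = hcomp d f + hcomp d g"
  and hcomp_zero: "hcomp d 0 = 0"
  by (simp_all add: hcomp_def grading_simps)

lemma hcomp_homog_mult: "homog e a \<Longrightarrow> hcomp d (a * f) = (if d < e then 0 else a * hcomp (d - e) f)"
  by (simp add: hcomp_def grading_simps homog_def coeff_monom_mult)

lemma hcomp_homog: "homog e f \<Longrightarrow> hcomp d f = (if d = e then f else 0)"
  by (simp add: hcomp_def homog_def)

lemma homog_comp: "homog d (hcomp d f)"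
proof (induction f arbitrary: d rule: S_induct)
  case (cst c)
  then show ?case by (cases "d = 0") (simp_all add: hcomp_homog[OF homog_gens(4)] homog_gens)
next
  case (add f g)
  then show ?case by (simp add: hcomp_add homog_add)
next
  case (x f)
  show ?case
    using homog_mult[OF homog_gens(1) x[of "d - 1"]]
    by (cases d) (simp_all add: hcomp_homog_mult[OF homog_gens(1)] homog_gens)
next
  case (y f)
  show ?case
    using homog_mult[OF homog_gens(2) y[of "d - 1"]]
    by (cases d) (simp_all add: hcomp_homog_mult[OF homog_gens(2)] homog_gens)
next
  case (z f)
  show ?case
    using homog_mult[OF homog_gens(3) z[of "d - 1"]]
    by (cases d) (simp_all add: hcomp_homog_mult[OF homog_gens(3)] homog_gens)
qed

lemma homog_iff: "homog d f \<longleftrightarrow> hcomp d f = f"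
  using hcomp_homog[of d f d] homog_comp[of d f] by auto

lemma sum_comp: "f = (\<Sum>d\<le>Polynomial.degree (grading f). hcomp d f)"
proof -
  have "poly (grading f) 1 = f"
    by (rule hom_eqI[OF is_hom_comp[OF is_hom_poly is_hom_grading] is_hom_id])
       (simp_all add: grading_gens poly_monom)
  then show ?thesis by (simp add: poly_altdef hcomp_def)
qed

lemma cf_comp: "cf (hcomp d f) i j l = (if i + j + l = d then cf f i j l else 0)"
proof (induction f arbitrary: d i j l rule: S_induct)
  case (cst c)
  then show ?case by (auto simp: hcomp_homog[OF homog_gens(4)] cf_cst)
next
  case (add f g)
  then show ?case by (simp add: hcomp_add)
next
  case (x f)
  then show ?case by (auto simp: hcomp_homog_mult[OF homog_gens(1)] cf_varx)
next
  case (y f)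
  then show ?case by (auto simp: hcomp_homog_mult[OF homog_gens(2)] cf_vary)
next
  case (z f)
  then show ?case by (auto simp: hcomp_homog_mult[OF homog_gens(3)] cf_varz)
qed

lemma homog_cf: "homog d f \<Longrightarrow> cf f i j l \<noteq> 0 \<Longrightarrow> i + j + l = d"
  by (metis cf_comp homog_iff)

lemma homog_cancel: "homog e a \<Longrightarrow> a \<noteq> 0 \<Longrightarrow> homog d (a * f) \<Longrightarrow> a * f \<noteq> 0 \<Longrightarrow> e \<le> d \<and> homog (d - e) f"
  by (auto simp: homog_iff[of _ "a * f"] hcomp_homog_mult homog_iff[of _ f] split: if_splits)

lemma pw_comp:
  assumes "homog i a" "homog j b" "f \<in> pw a b k"
  shows "hcomp d f \<in> pw a b k"
  using assms(3)
proof (induction k arbitrary: f d)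
  case (Suc k)
  then obtain p q where f: "f = a * p + b * q" "p \<in> pw a b k" "q \<in> pw a b k"
    by auto
  have "hcomp d f = a * (if d < i then 0 else hcomp (d - i) p) + b * (if d < j then 0 else hcomp (d - j) q)"
    by (simp add: f hcomp_add hcomp_homog_mult[OF assms(1)] hcomp_homog_mult[OF assms(2)])
  moreover have "(if d < i then 0 else hcomp (d - i) p) \<in> pw a b k"
    "(if d < j then 0 else hcomp (d - j) q) \<in> pw a b k"
    using Suc.IH f by auto
  ultimately show ?case by (simp only: pw_SucI)
qed simp

section \<open>Coordinate ideals\<close>

lemma vars_nonzero [simp]: "varx \<noteq> 0" "vary \<noteq> 0" "varz \<noteq> 0"
  by (simp_all add: varx_def vary_def varz_def)

lemmas ev_cst_simps = is_hom_simps[OF is_hom_ev[OF is_hom_cst]] ev_gens[OF is_hom_cst]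

lemma dvd_varx_iff: "varx dvd f \<longleftrightarrow> ev cst 0 vary varz f = 0"
  and dvd_vary_iff: "vary dvd f \<longleftrightarrow> ev cst varx 0 varz f = 0"
  and dvd_varz_iff: "varz dvd f \<longleftrightarrow> ev cst varx vary 0 f = 0"
proof -
  have "f - ev cst 0 vary varz f \<in> {g. varx dvd g}" by (rule ev_cong_ideal) auto
  then show "varx dvd f \<longleftrightarrow> ev cst 0 vary varz f = 0"
    by (auto simp: ev_cst_simps)
  have "f - ev cst varx 0 varz f \<in> {g. vary dvd g}" by (rule ev_cong_ideal) auto
  then show "vary dvd f \<longleftrightarrow> ev cst varx 0 varz f = 0"
    by (auto simp: ev_cst_simps)
  have "f - ev cst varx vary 0 f \<in> {g. varz dvd g}" by (rule ev_cong_ideal) auto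
  then show "varz dvd f \<longleftrightarrow> ev cst varx vary 0 f = 0"
    by (auto simp: ev_cst_simps)
qed

lemma reg_xy: "varx dvd vary * g \<Longrightarrow> varx dvd g"
  and reg_zx: "varz dvd varx * g \<Longrightarrow> varz dvd g"
  and reg_zy: "varz dvd vary * g \<Longrightarrow> varz dvd g"
  and reg_yz: "vary dvd varz * g \<Longrightarrow> vary dvd g"
  and reg_xz: "varx dvd varz * g \<Longrightarrow> varx dvd g"
  by (simp_all add: dvd_varx_iff dvd_vary_iff dvd_varz_iff ev_cst_simps)

lemma pw_1_iff: "f \<in> pw a b 1 \<longleftrightarrow> (\<exists>p q. f = a * p + b * q)"
  by simp

lemma pw_xy_1_iff: "f \<in> pw varx vary 1 \<longleftrightarrow> ev cst 0 0 varz f = 0"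
  and pw_yz_1_iff: "f \<in> pw vary varz 1 \<longleftrightarrow> ev cst varx 0 0 f = 0"
  and pw_xz_1_iff: "f \<in> pw varx varz 1 \<longleftrightarrow> ev cst 0 vary 0 f = 0"
proof -
  note i = pw_add pw_lmult pw_gen1 pw_gen2 pw_zero
  have *: "f - ev cst 0 0 varz f \<in> pw varx vary 1"
    by (rule ev_cong_ideal) (simp_all add: i del: One_nat_def)
  show "f \<in> pw varx vary 1 \<longleftrightarrow> ev cst 0 0 varz f = 0"
  proof
    show "f \<in> pw varx vary 1 \<Longrightarrow> ev cst 0 0 varz f = 0"
      unfolding pw_1_iff by (auto simp: ev_cst_simps)
  qed (use * in \<open>simp del: One_nat_def\<close>)
  have *: "f - ev cst varx 0 0 f \<in> pw vary varz 1"
    by (rule ev_cong_ideal) (simp_all add: i del: One_nat_def)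
  show "f \<in> pw vary varz 1 \<longleftrightarrow> ev cst varx 0 0 f = 0"
  proof
    show "f \<in> pw vary varz 1 \<Longrightarrow> ev cst varx 0 0 f = 0"
      unfolding pw_1_iff by (auto simp: ev_cst_simps)
  qed (use * in \<open>simp del: One_nat_def\<close>)
  have *: "f - ev cst 0 vary 0 f \<in> pw varx varz 1"
    by (rule ev_cong_ideal) (simp_all add: i del: One_nat_def)
  show "f \<in> pw varx varz 1 \<longleftrightarrow> ev cst 0 vary 0 f = 0"
  proof
    show "f \<in> pw varx varz 1 \<Longrightarrow> ev cst 0 vary 0 f = 0"
      unfolding pw_1_iff by (auto simp: ev_cst_simps)
  qed (use * in \<open>simp del: One_nat_def\<close>)
qed

lemma pw_xy_cancel: "ev cst 0 0 varz s \<noteq> 0 \<Longrightarrow> s * g \<in> pw varx vary k \<Longrightarrow> g \<in> pw varx vary k"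
  by (rule pw_cancel[where s = s, OF vars_nonzero(1) reg_xy])
     (simp_all add: pw_xy_1_iff ev_cst_simps del: One_nat_def)

lemma pw_yz_cancel: "ev cst varx 0 0 s \<noteq> 0 \<Longrightarrow> s * g \<in> pw vary varz k \<Longrightarrow> g \<in> pw vary varz k"
  by (rule pw_cancel[where s = s, OF vars_nonzero(2) reg_yz])
     (simp_all add: pw_yz_1_iff ev_cst_simps del: One_nat_def)

lemma pw_xz_cancel: "ev cst 0 vary 0 s \<noteq> 0 \<Longrightarrow> s * g \<in> pw varx varz k \<Longrightarrow> g \<in> pw varx varz k"
  by (rule pw_cancel[where s = s, OF vars_nonzero(1) reg_xz])
     (simp_all add: pw_xz_1_iff ev_cst_simps del: One_nat_def)

lemma pw_xy_cf: "f \<in> pw varx vary k \<Longrightarrow> cf f i j l \<noteq> 0 \<Longrightarrow> k \<le> i + j"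
proof (induction k arbitrary: f i j)
  case (Suc k)
  then obtain p q where f: "f = varx * p + vary * q" "p \<in> pw varx vary k" "q \<in> pw varx vary k"
    by auto
  have "(i \<noteq> 0 \<and> cf p (i - 1) j l \<noteq> 0) \<or> (j \<noteq> 0 \<and> cf q i (j - 1) l \<noteq> 0)"
    using Suc.prems(2) by (auto simp: f cf_varx cf_vary split: if_splits)
  then show ?case using Suc.IH[OF f(2), of "i - 1" j] Suc.IH[OF f(3), of i "j - 1"] by auto
qed simp

lemma pw_yz_cf: "f \<in> pw vary varz k \<Longrightarrow> cf f i j l \<noteq> 0 \<Longrightarrow> k \<le> j + l"
proof (induction k arbitrary: f j l)
  case (Suc k)
  then obtain p q where f: "f = vary * p + varz * q" "p \<in> pw vary varz k" "q \<in> pw vary varz k"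
    by auto
  have "(j \<noteq> 0 \<and> cf p i (j - 1) l \<noteq> 0) \<or> (l \<noteq> 0 \<and> cf q i j (l - 1) \<noteq> 0)"
    using Suc.prems(2) by (auto simp: f cf_varz cf_vary split: if_splits)
  then show ?case using Suc.IH[OF f(2), of "j - 1" l] Suc.IH[OF f(3), of j "l - 1"] by auto
qed simp

lemma pw_xz_cf: "f \<in> pw varx varz k \<Longrightarrow> cf f i j l \<noteq> 0 \<Longrightarrow> k \<le> i + l"
proof (induction k arbitrary: f i l)
  case (Suc k)
  then obtain p q where f: "f = varx * p + varz * q" "p \<in> pw varx varz k" "q \<in> pw varx varz k"
    by auto
  have "(i \<noteq> 0 \<and> cf p (i - 1) j l \<noteq> 0) \<or> (l \<noteq> 0 \<and> cf q i j (l - 1) \<noteq> 0)"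
    using Suc.prems(2) by (auto simp: f cf_varx cf_varz split: if_splits)
  then show ?case using Suc.IH[OF f(2), of "i - 1" l] Suc.IH[OF f(3), of i "l - 1"] by auto
qed simp

lemma pw_xy_of_cf:
  assumes "\<And>i j l. cf f i j l \<noteq> 0 \<Longrightarrow> k \<le> i + j"
  shows "f \<in> pw varx vary k"
proof (rule mem_of_monomials)
  fix i j l assume "cf f i j l \<noteq> 0"
  then have "k \<le> 1 * i + 1 * j" using assms by simp
  moreover have "varx ^ i * vary ^ j \<in> pw varx vary (1 * i + 1 * j)"
    by (intro pw_mult pw_power pw_gen1 pw_gen2)
  ultimately have "varx ^ i * vary ^ j \<in> pw varx vary k" by (metis pw_antimono)
  then show "cst (cf f i j l) * varx ^ i * vary ^ j * varz ^ l \<in> pw varx vary k"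
    by (metis mult.assoc pw_lmult pw_rmult)
qed (simp_all add: pw_add)

section \<open>Reduction modulo binomials and roots of unity\<close>

lemma coeffs_above_zero_degree: "(\<And>k. n \<le> k \<Longrightarrow> poly.coeff p k = 0) \<Longrightarrow> 0 < n \<Longrightarrow> Polynomial.degree p < n"
  by (metis Polynomial.leading_coeff_0_iff degree_0 not_le)

text \<open>The binomial \<open>z\<^sup>n - c\<close> is monic, so division with remainder works over any coefficient ring.\<close>

lemma binomial_division:
  fixes p :: "'a::comm_ring_1 poly"
  assumes n: "0 < n"
  shows "\<exists>q r. p = (Polynomial.monom 1 n - [:c:]) * q + r \<and> (\<forall>k\<ge>n. poly.coeff r k = 0)"
proof (induction p rule: poly_gen_induct)
  case (1 a)
  have "[:a:] = (Polynomial.monom 1 n - [:c:]) * 0 + [:a:] \<and> (\<forall>k\<ge>n. poly.coeff [:a:] k = 0)"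
    using n by (auto simp: coeff_pCons split: nat.splits)
  then show ?case by blast
next
  case (2 f g)
  then obtain q r q' r' where f: "f = (Polynomial.monom 1 n - [:c:]) * q + r"
    and g: "g = (Polynomial.monom 1 n - [:c:]) * q' + r'"
    and r: "\<forall>k\<ge>n. poly.coeff r k = 0" "\<forall>k\<ge>n. poly.coeff r' k = 0" by blast
  have "f + g = (Polynomial.monom 1 n - [:c:]) * (q + q') + (r + r')"
    by (simp only: f g) (simp only: algebra_simps)
  moreover have "\<forall>k\<ge>n. poly.coeff (r + r') k = 0" using r by simp
  ultimately show ?case by blast
next
  case (3 f)
  then obtain q r where f: "f = (Polynomial.monom 1 n - [:c:]) * q + r" and r: "\<forall>k\<ge>n. poly.coeff r k = 0"
    by blast
  define a where "a = poly.coeff r (n - 1)"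
  define r' where "r' = [:0, 1:] * r - [:a:] * (Polynomial.monom 1 n - [:c:])"
  have "[:0, 1:] * f = (Polynomial.monom 1 n - [:c:]) * ([:0, 1:] * q + [:a:]) + r'"
    by (simp only: f r'_def) (simp only: algebra_simps)
  moreover have "poly.coeff r' k = 0" if "n \<le> k" for k
    using that r n by (cases k) (auto simp: r'_def a_def coeff_pCons split: nat.splits)
  ultimately show ?case by blast
qed

lemma few_roots:
  fixes p :: "'a::idom poly"
  assumes "0 < n" "\<And>k. n \<le> k \<Longrightarrow> poly.coeff p k = 0" "n \<le> card R" "\<And>r. r \<in> R \<Longrightarrow> poly p r = 0"
  shows "p = 0"
proof (rule ccontr)
  assume p: "p \<noteq> 0"
  have "card R \<le> card {x. poly p x = 0}"
    using assms(4) poly_roots_finite[OF p] by (intro card_mono) auto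
  also have "\<dots> \<le> Polynomial.degree p" by (rule card_poly_roots_bound[OF p])
  also have "\<dots> < n" by (rule coeffs_above_zero_degree[OF assms(2,1)])
  finally show False using assms(3) by simp
qed

text \<open>The divisor divides the leading coefficient of the product and hence that of \<open>g\<close>; the leading
  term of \<open>g\<close> can be removed, and the degree drops.\<close>

lemma dvd_mult_unit_lead:
  fixes p g :: "'a::idom poly"
  assumes e: "poly.coeff p (Polynomial.degree p) * e = 1" and "[:a:] dvd p * g"
  shows "[:a:] dvd g"
  using assms(2)
proof (induction "Polynomial.degree g" arbitrary: g rule: less_induct)
  case less
  define c where "c = Polynomial.lead_coeff g"
  define m where "m = Polynomial.monom c (Polynomial.degree g)"
  have "a dvd poly.coeff (p * g) (Polynomial.degree p + Polynomial.degree g)"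
    using less(2) const_poly_dvd_iff by blast
  then have "a dvd poly.coeff p (Polynomial.degree p) * c"
    by (simp add: coeff_mult_degree_sum c_def)
  then have "a dvd (poly.coeff p (Polynomial.degree p) * c) * e" by (rule dvd_mult2)
  also have "(poly.coeff p (Polynomial.degree p) * c) * e = c"
    using e by (metis mult.assoc mult.commute mult_1)
  finally have ac: "a dvd c" .
  then have am: "[:a:] dvd m"
    by (simp add: m_def const_poly_dvd_iff)
  show ?case
  proof (cases "Polynomial.degree g = 0")
    case True
    then have "g = m" by (metis c_def degree_0_id m_def monom_0)
    then show ?thesis using am by simp
  next
    case False
    have "Polynomial.degree (g - m) < Polynomial.degree g"
    proof (rule coeffs_above_zero_degree)
      show "poly.coeff (g - m) k = 0" if "Polynomial.degree g \<le> k" for k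
        using that by (cases "k = Polynomial.degree g") (auto simp: m_def c_def coeff_eq_0)
    qed (use False in simp)
    moreover have "[:a:] dvd p * (g - m)"
      using less(2) am by (simp add: right_diff_distrib dvd_diff)
    ultimately have "[:a:] dvd g - m" by (rule less(1))
    then show ?thesis using am by (metis diff_add_cancel dvd_add)
  qed
qed

definition lin :: "complex \<Rightarrow> complex \<Rightarrow> complex \<Rightarrow> complex poly poly poly \<Rightarrow> complex poly" where
  "lin a b c = ev (\<lambda>d. [:d:]) [:0, a:] [:0, b:] [:0, c:]"

lemma is_hom_lin: "is_hom (lin a b c)"
  unfolding lin_def by (rule is_hom_ev[OF is_hom_const])

lemmas lin_simps = is_hom_simps[OF is_hom_lin]

lemma lin_gens: "lin a b c varx = [:0, a:]" "lin a b c vary = [:0, b:]" "lin a b c varz = [:0, c:]"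
  "lin a b c (cst d) = [:d:]"
  unfolding lin_def by (simp_all only: ev_gens[OF is_hom_const])

text \<open>Restriction to the plane \<open>y = \<zeta> x\<close>.\<close>

definition plane :: "complex \<Rightarrow> complex poly poly poly \<Rightarrow> complex poly poly" where
  "plane \<zeta> = map_poly (\<lambda>g. poly g [:0, \<zeta>:])"

lemma is_hom_plane: "is_hom (plane \<zeta>)"
  unfolding plane_def by (intro is_hom_map_poly is_hom_poly)

lemmas plane_simps = is_hom_simps[OF is_hom_plane]

lemma plane_gens: "plane \<zeta> varx = [:[:0, 1:]:]" "plane \<zeta> vary = [:[:0, \<zeta>:]:]" "plane \<zeta> varz = [:0, 1:]"
  "plane \<zeta> (cst c) = [:[:c:]:]"
  by (simp_all add: plane_def varx_def vary_def varz_def cst_def map_poly_pCons)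

lemma coeff_plane: "poly.coeff (plane \<zeta> f) l = poly (poly.coeff f l) [:0, \<zeta>:]"
  unfolding plane_def by (rule coeff_map_poly) simp

lemma lin_plane: "lin 1 \<zeta> \<eta> f = poly (plane \<zeta> f) [:0, \<eta>:]"
  by (rule hom_eqI[OF is_hom_lin is_hom_comp[OF is_hom_poly is_hom_plane]])
     (simp_all add: lin_gens plane_gens)

section \<open>The pencil of Fermat binomials\<close>

locale fermat =
  fixes n :: nat
  assumes n_pos: "0 < n"
begin

definition "u = varx ^ n - vary ^ n"
definition "v = vary ^ n - varz ^ n"
definition "w = varz ^ n - varx ^ n"

lemma w_eq: "w = - u - v"
  by (simp add: u_def v_def w_def)

definition roots :: "complex set" where "roots = {\<zeta>. \<zeta> ^ n = 1}"

lemma card_roots: "card roots = n"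
  unfolding roots_def by (rule card_roots_unity_eq[OF n_pos])

lemma root_line: "\<zeta> \<in> roots \<Longrightarrow> [:0, \<zeta>:] ^ n = [:0, 1:] ^ n"
proof -
  have "[:0, z:] ^ n = Polynomial.monom (z ^ n) n" for z :: complex
    using monom_power[of z 1 n] by (simp add: monom_altdef[of z "Suc 0"])
  then show "\<zeta> \<in> roots \<Longrightarrow> [:0, \<zeta>:] ^ n = [:0, 1:] ^ n" by (simp add: roots_def)
qed

lemma card_root_lines: "card ((\<lambda>\<zeta>. [:0, \<zeta>:]) ` roots) = n"
  by (subst card_image) (auto simp: inj_on_def card_roots)

lemma u_poly: "u = - [:Polynomial.monom 1 n - [:[:0, 1:] ^ n:]:]"
  and v_poly: "v = [:[:0, 1:] ^ n:] - Polynomial.monom 1 n"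
  by (simp_all add: u_def v_def varx_def vary_def varz_def is_hom_power[OF is_hom_const, symmetric] monom_altdef)

lemma u_nonzero: "u \<noteq> 0"
proof
  assume "u = 0"
  then have "cf (varx ^ n * 1 - vary ^ n * 1) n 0 0 = 0" by (simp add: u_def)
  then show False
    unfolding cf_diff cf_varx_power cf_vary_power
    using n_pos cf_cst[of 1] by (simp add: is_hom_one[OF is_hom_cst])
qed

lemma homog_uvw: "homog n u" "homog n v" "homog n w"
  using homog_power[OF homog_gens(1), of n] homog_power[OF homog_gens(2), of n]
    homog_power[OF homog_gens(3), of n]
  by (simp_all add: u_def v_def w_def homog_diff)

lemma coeff_v: "poly.coeff v k = (if k = 0 then [:0, 1:] ^ n else 0) - (if k = n then 1 else 0)"
  by (cases k) (simp_all add: v_poly)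

lemma degree_v: "Polynomial.degree v = n"
  using n_pos by (intro antisym degree_le le_degree) (auto simp: coeff_v)

lemma reg_uv: "u dvd v * g \<Longrightarrow> u dvd g"
  unfolding u_poly minus_dvd_iff
  by (rule dvd_mult_unit_lead[where p = v and e = "- 1"]) (use n_pos in \<open>simp_all add: degree_v coeff_v\<close>)

text \<open>The plane curve \<open>u = 0\<close> consists of the \<open>n\<close> distinct lines \<open>y = \<zeta> x\<close>. The remainder of a
  coefficient of \<open>f\<close> modulo \<open>y\<^sup>n - x\<^sup>n\<close> has \<open>n\<close> roots but degree less than \<open>n\<close>.\<close>

lemma u_dvd:
  assumes "\<And>\<zeta>. \<zeta> \<in> roots \<Longrightarrow> plane \<zeta> f = 0"
  shows "u dvd f"
  unfolding u_poly minus_dvd_iff const_poly_dvd_iff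
proof
  fix l
  obtain q r where qr: "poly.coeff f l = (Polynomial.monom 1 n - [:[:0, 1:] ^ n:]) * q + r"
    and r: "\<forall>k\<ge>n. poly.coeff r k = 0"
    using binomial_division[OF n_pos] by blast
  have "r = 0"
  proof (rule few_roots[OF n_pos _ eq_refl[OF card_root_lines[symmetric]]])
    show "poly r z = 0" if z: "z \<in> (\<lambda>\<zeta>. [:0, \<zeta>:]) ` roots" for z
    proof -
      obtain \<zeta> where \<zeta>: "\<zeta> \<in> roots" "z = [:0, \<zeta>:]" using z by blast
      have "z ^ n = [:0, 1:] ^ n" using \<zeta> root_line by simp
      moreover have "poly (poly.coeff f l) z = 0"
        using assms[OF \<zeta>(1)] coeff_plane[of \<zeta> f l] by (simp add: \<zeta>)
      ultimately show ?thesis by (simp add: qr poly_monom)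
    qed
  qed (use r in auto)
  then show "(Polynomial.monom 1 n - [:[:0, 1:] ^ n:]) dvd poly.coeff f l" using qr by simp
qed

lemma lin_uv:
  assumes "\<zeta> \<in> roots" "\<eta> \<in> roots"
  shows "lin 1 \<zeta> \<eta> u = 0" "lin 1 \<zeta> \<eta> v = 0"
  using assms by (simp_all add: u_def v_def lin_simps lin_gens root_line)

lemma plane_u: "\<zeta> \<in> roots \<Longrightarrow> plane \<zeta> u = 0"
  by (simp add: u_def plane_simps plane_gens is_hom_power[OF is_hom_const, symmetric] root_line)

text \<open>Modulo \<open>v\<close> and then \<open>u\<close> every polynomial becomes one of degree less than \<open>n\<close> in \<open>z\<close> and in \<open>y\<close>, and
  such a polynomial is determined by its values at \<open>n\<close> times \<open>n\<close> roots. So the ideal \<open>(u, v)\<close> is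
  radical.\<close>

lemma pw_uv_1I:
  assumes f: "\<And>\<zeta> \<eta>. \<zeta> \<in> roots \<Longrightarrow> \<eta> \<in> roots \<Longrightarrow> lin 1 \<zeta> \<eta> f = 0"
  shows "f \<in> pw u v 1"
proof -
  obtain q r where qr: "f = (Polynomial.monom 1 n - [:[:0, 1:] ^ n:]) * q + r"
    and r: "\<forall>k\<ge>n. poly.coeff r k = 0"
    using binomial_division[OF n_pos] by blast
  have fr: "f = r - v * q" by (simp add: qr v_poly algebra_simps)
  have "u dvd r"
  proof (rule u_dvd)
    fix \<zeta> assume \<zeta>: "\<zeta> \<in> roots"
    show "plane \<zeta> r = 0"
    proof (rule few_roots[OF n_pos _ eq_refl[OF card_root_lines[symmetric]]])
      show "poly (plane \<zeta> r) z = 0" if z: "z \<in> (\<lambda>\<zeta>. [:0, \<zeta>:]) ` roots" for z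
      proof -
        obtain \<eta> where \<eta>: "\<eta> \<in> roots" "z = [:0, \<eta>:]" using z by blast
        have "lin 1 \<zeta> \<eta> r = 0"
          using f[OF \<zeta> \<eta>(1)] fr lin_uv(2)[OF \<zeta> \<eta>(1)] by (simp add: lin_simps)
        then show ?thesis by (simp add: \<eta> lin_plane)
      qed
    qed (use r in \<open>simp add: coeff_plane\<close>)
  qed
  then obtain p where "r = u * p" by blast
  then have "f = u * p + v * (- q)" by (simp add: fr)
  then show ?thesis unfolding pw_1_iff by blast
qed

lemma pw_uv_1_iff: "f \<in> pw u v 1 \<longleftrightarrow> (\<forall>\<zeta>\<in>roots. \<forall>\<eta>\<in>roots. lin 1 \<zeta> \<eta> f = 0)"
  using pw_uv_1I[of f] by (auto simp: lin_simps lin_uv)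

lemma pw_uv_cancel_family:
  assumes "\<And>\<zeta> \<eta>. \<zeta> \<in> roots \<Longrightarrow> \<eta> \<in> roots \<Longrightarrow> \<exists>s. lin 1 \<zeta> \<eta> s \<noteq> 0 \<and> s * g \<in> pw u v k"
  shows "g \<in> pw u v k"
proof (rule pw_cancel_family[where \<S> = "{{s. lin 1 \<zeta> \<eta> s \<noteq> 0} | \<zeta> \<eta>. \<zeta> \<in> roots \<and> \<eta> \<in> roots}",
    OF u_nonzero reg_uv])
  fix g assume g: "\<And>M. M \<in> {{s. lin 1 \<zeta> \<eta> s \<noteq> 0} | \<zeta> \<eta>. \<zeta> \<in> roots \<and> \<eta> \<in> roots} \<Longrightarrow> \<exists>s\<in>M. s * g \<in> pw u v 1"
  show "g \<in> pw u v 1"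
    unfolding pw_uv_1_iff
  proof (intro ballI)
    fix \<zeta> \<eta> assume h: "\<zeta> \<in> roots" "\<eta> \<in> roots"
    then obtain s where "lin 1 \<zeta> \<eta> s \<noteq> 0" "s * g \<in> pw u v 1"
      using g[of "{s. lin 1 \<zeta> \<eta> s \<noteq> 0}"] by blast
    then show "lin 1 \<zeta> \<eta> g = 0" using h unfolding pw_uv_1_iff by (auto simp: lin_simps)
  qed
next
  fix M assume "M \<in> {{s. lin 1 \<zeta> \<eta> s \<noteq> 0} | \<zeta> \<eta>. \<zeta> \<in> roots \<and> \<eta> \<in> roots}"
  then show "\<exists>s\<in>M. s * g \<in> pw u v k" using assms by auto
qed

text \<open>On the plane \<open>z = 0\<close> the pencil is spanned by \<open>x\<^sup>n\<close> and \<open>y\<^sup>n\<close>, which generate a monomial ideal.\<close>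

lemma pw_uv_cf: "f \<in> pw u v k \<Longrightarrow> cf f i j 0 \<noteq> 0 \<Longrightarrow> k \<le> i div n + j div n"
proof (induction k arbitrary: f i j)
  case (Suc k)
  then obtain p q where f: "f = u * p + v * q" "p \<in> pw u v k" "q \<in> pw u v k"
    by auto
  have "cf f i j 0 = (if i < n then 0 else cf p (i - n) j 0)
     + (if j < n then 0 else cf (q - p) i (j - n) 0)"
    using n_pos by (simp add: f u_def v_def left_diff_distrib cf_varx_power cf_vary_power cf_varz_power)
  then have "(n \<le> i \<and> cf p (i - n) j 0 \<noteq> 0) \<or> (n \<le> j \<and> cf (q - p) i (j - n) 0 \<noteq> 0)"
    using Suc.prems(2) by (auto split: if_splits)
  moreover have "n \<le> i \<Longrightarrow> i div n = Suc ((i - n) div n)" for i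
    using n_pos by (simp add: le_div_geq)
  ultimately show ?case
    using Suc.IH[OF f(2), of "i - n" j] Suc.IH[OF pw_minus[OF f(3,2)], of i "j - n"] by auto
qed simp

section \<open>Ideals generated by products of variables and binomials\<close>

definition mon :: "nat \<Rightarrow> nat \<Rightarrow> nat \<Rightarrow> nat \<Rightarrow> nat \<Rightarrow> nat \<Rightarrow> complex poly poly poly" where
  "mon a b c d e f = varx ^ a * vary ^ b * varz ^ c * (u ^ d * v ^ e * w ^ f)"

text \<open>Along the lines spanned by \<open>(1, \<zeta>, \<eta>)\<close> with \<open>\<zeta>\<^sup>n = \<eta>\<^sup>n = 1\<close> the product
  \<open>x\<^sup>a y\<^sup>b z\<^sup>c u\<^sup>d v\<^sup>e w\<^sup>f\<close> vanishes to the order \<open>d + e + f\<close>; along the axes \<open>x = y = 0\<close>, \<open>y = z = 0\<close> and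
  \<open>x = z = 0\<close> it vanishes to the orders \<open>a + b + n d\<close>, \<open>b + c + n e\<close> and \<open>a + c + n f\<close>.\<close>

inductive_set MI :: "nat \<Rightarrow> nat \<Rightarrow> nat \<Rightarrow> nat \<Rightarrow> complex poly poly poly set"
  for m \<alpha> \<beta> \<gamma> where
  gen: "m \<le> d + e + f \<Longrightarrow> \<alpha> \<le> a + b + n * d \<Longrightarrow> \<beta> \<le> b + c + n * e \<Longrightarrow> \<gamma> \<le> a + c + n * f \<Longrightarrow>
    r * mon a b c d e f \<in> MI m \<alpha> \<beta> \<gamma>"
| add: "p \<in> MI m \<alpha> \<beta> \<gamma> \<Longrightarrow> q \<in> MI m \<alpha> \<beta> \<gamma> \<Longrightarrow> p + q \<in> MI m \<alpha> \<beta> \<gamma>"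

lemma MI_zero: "0 \<in> MI m \<alpha> \<beta> \<gamma>"
proof -
  have "0 * mon \<alpha> \<beta> \<gamma> m 0 0 \<in> MI m \<alpha> \<beta> \<gamma>" by (rule MI.gen) simp_all
  then show ?thesis by simp
qed

lemma mon_mult_z: "varz * mon a b c d e f = mon a b (Suc c) d e f"
  and mon_mult_u: "u * mon a b c d e f = mon a b c (Suc d) e f"
  by (simp_all add: mon_def ac_simps)

lemma MI_mult_z: "f \<in> MI m \<alpha> (\<beta> - 1) (\<gamma> - 1) \<Longrightarrow> varz * f \<in> MI m \<alpha> \<beta> \<gamma>"
proof (induction rule: MI.induct)
  case (gen d e f a b c r)
  have "r * mon a b (Suc c) d e f \<in> MI m \<alpha> \<beta> \<gamma>" by (rule MI.gen) (use gen in auto)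
  then show ?case by (simp add: mon_mult_z[symmetric] ac_simps)
qed (simp add: MI.add distrib_left)

lemma MI_mult_u: "f \<in> MI (m - 1) (\<alpha> - n) \<beta> \<gamma> \<Longrightarrow> u * f \<in> MI m \<alpha> \<beta> \<gamma>"
proof (induction rule: MI.induct)
  case (gen d e f a b c r)
  have "r * mon a b c (Suc d) e f \<in> MI m \<alpha> \<beta> \<gamma>" by (rule MI.gen) (use gen in auto)
  then show ?case by (simp add: mon_mult_u[symmetric] ac_simps)
qed (simp add: MI.add distrib_left)

lemma uvw_pw: "u \<in> pw u v 1" "v \<in> pw u v 1" "w \<in> pw u v 1"
  and u_pw: "u \<in> pw varx vary n" and v_pw: "v \<in> pw vary varz n" and w_pw: "w \<in> pw varx varz n"
proof -
  show "u \<in> pw u v 1" "v \<in> pw u v 1" by (rule pw_gen1, rule pw_gen2)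
  have "- 1 * (u + v) \<in> pw u v 1" by (intro pw_lmult pw_add pw_gen1 pw_gen2)
  then show "w \<in> pw u v 1" by (simp add: w_eq)
  have "a ^ n \<in> pw a b n" "b ^ n \<in> pw a b n" for a b :: "complex poly poly poly"
    using pw_power[OF pw_gen1[of a b], of n] pw_power[OF pw_gen2[of b a], of n] by simp_all
  then show "u \<in> pw varx vary n" "v \<in> pw vary varz n" "w \<in> pw varx varz n"
    by (simp_all add: u_def v_def w_def pw_minus)
qed

lemma MI_pw:
  assumes "g \<in> MI m \<alpha> \<beta> \<gamma>"
  shows "g \<in> pw u v m" "g \<in> pw varx vary \<alpha>" "g \<in> pw vary varz \<beta>" "g \<in> pw varx varz \<gamma>"
proof -
  have mon: "mon a b c d e f \<in> pw u v (1 * d + 1 * e + 1 * f)"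
    "mon a b c d e f \<in> pw varx vary (1 * a + 1 * b + n * d)"
    "mon a b c d e f \<in> pw vary varz (1 * b + 1 * c + n * e)"
    "mon a b c d e f \<in> pw varx varz (1 * a + 1 * c + n * f)" for a b c d e f
  proof -
    show "mon a b c d e f \<in> pw u v (1 * d + 1 * e + 1 * f)"
      unfolding mon_def by (intro pw_lmult pw_mult pw_power uvw_pw)
    have "varx ^ a * vary ^ b * u ^ d \<in> pw varx vary (1 * a + 1 * b + n * d)"
      by (intro pw_mult pw_power u_pw pw_gen1 pw_gen2)
    from pw_lmult[OF this, of "varz ^ c * v ^ e * w ^ f"]
    show "mon a b c d e f \<in> pw varx vary (1 * a + 1 * b + n * d)" by (simp add: mon_def ac_simps)
    have "vary ^ b * varz ^ c * v ^ e \<in> pw vary varz (1 * b + 1 * c + n * e)"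
      by (intro pw_mult pw_power v_pw pw_gen1 pw_gen2)
    from pw_lmult[OF this, of "varx ^ a * u ^ d * w ^ f"]
    show "mon a b c d e f \<in> pw vary varz (1 * b + 1 * c + n * e)" by (simp add: mon_def ac_simps)
    have "varx ^ a * varz ^ c * w ^ f \<in> pw varx varz (1 * a + 1 * c + n * f)"
      by (intro pw_mult pw_power w_pw pw_gen1 pw_gen2)
    from pw_lmult[OF this, of "vary ^ b * u ^ d * v ^ e"]
    show "mon a b c d e f \<in> pw varx varz (1 * a + 1 * c + n * f)" by (simp add: mon_def ac_simps)
  qed
  have "g \<in> pw u v m \<and> g \<in> pw varx vary \<alpha> \<and> g \<in> pw vary varz \<beta> \<and> g \<in> pw varx varz \<gamma>"
    using assms
  proof induction
    case (gen d e f a b c r)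
    then show ?case
      by (intro conjI pw_lmult) (rule pw_antimono[OF _ mon(1)] pw_antimono[OF _ mon(2)]
        pw_antimono[OF _ mon(3)] pw_antimono[OF _ mon(4)], simp)+
  qed (simp add: pw_add)
  then show "g \<in> pw u v m" "g \<in> pw varx vary \<alpha>" "g \<in> pw vary varz \<beta>" "g \<in> pw varx varz \<gamma>"
    by blast+
qed

lemma homog_mon: "homog (a + b + c + n * (d + e + f)) (mon a b c d e f)"
proof -
  have "homog ((1 * a + 1 * b + 1 * c) + (n * d + n * e + n * f)) (mon a b c d e f)"
    unfolding mon_def by (intro homog_mult homog_power homog_gens homog_uvw)
  then show ?thesis by (simp add: algebra_simps)
qed

text \<open>Induction on the degree. Let \<open>f\<close> be a form of degree \<open>d\<close> with the prescribed vanishing orders.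
  The restriction of \<open>f\<close> to one of the \<open>n\<close> lines \<open>y = \<zeta> x\<close> has \<open>n\<close> zeros of order \<open>m\<close> and a zero of
  order \<open>\<alpha>\<close>, so if \<open>d < \<alpha> + n m\<close> then all these lines split off and \<open>u\<close> divides \<open>f\<close>. Otherwise there is
  enough room to find products of variables and binomials with the prescribed orders
  that agree with \<open>f\<close> on \<open>z = 0\<close>; their difference to \<open>f\<close> is divisible by \<open>z\<close>.\<close>

lemma homog_mem_MI:
  assumes "homog d f" "f \<in> pw u v m" "f \<in> pw varx vary \<alpha>" "f \<in> pw vary varz \<beta>" "f \<in> pw varx varz \<gamma>"
  shows "f \<in> MI m \<alpha> \<beta> \<gamma>"
  using assms
proof (induction d arbitrary: f m \<alpha> \<beta> \<gamma> rule: less_induct)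
  case (less d)
  note h = less.prems
  show ?case
  proof (cases "f = 0")
    case True
    then show ?thesis by (simp add: MI_zero)
  next
    case False
    have deg: "\<alpha> \<le> d \<and> Polynomial.degree f \<le> d - \<alpha>"
    proof -
      define l where "l = Polynomial.degree f"
      have "poly.coeff f l \<noteq> 0" using False l_def by simp
      then obtain j where "poly.coeff (poly.coeff f l) j \<noteq> 0" by (metis poly_eqI coeff_0)
      then obtain i where "cf f i j l \<noteq> 0" unfolding cf_def by (metis poly_eqI coeff_0)
      then have "i + j + l = d" "\<alpha> \<le> i + j" using homog_cf[OF h(1)] pw_xy_cf[OF h(3)] by blast+
      then show ?thesis using l_def by auto
    qed
    show ?thesis
    proof (cases "d < \<alpha> + n * m")
      case True
      have "u dvd f"
      proof (rule u_dvd)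
        fix \<zeta> assume \<zeta>: "\<zeta> \<in> roots"
        have vp: "plane \<zeta> v = [:[:0, 1:] ^ n:] - Polynomial.monom 1 n"
          using \<zeta> by (simp add: v_def plane_simps plane_gens is_hom_power[OF is_hom_const, symmetric]
            root_line monom_altdef)
        have cv: "poly.coeff (plane \<zeta> v) k = (if k = 0 then [:0, 1:] ^ n else 0) - (if k = n then 1 else 0)" for k
          unfolding vp by (cases k) simp_all
        have dv: "Polynomial.degree (plane \<zeta> v) = n"
          using n_pos by (intro antisym degree_le le_degree) (auto simp: cv)
        have v0: "plane \<zeta> v \<noteq> 0" using dv n_pos by auto
        have "plane \<zeta> f \<in> pw 0 (plane \<zeta> v) m"
          using pw_hom[OF is_hom_plane h(2), of \<zeta>] plane_u[OF \<zeta>] by simp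
        then have dvd: "plane \<zeta> v ^ m dvd plane \<zeta> f" by (rule pw_zero_left)
        show "plane \<zeta> f = 0"
        proof (rule ccontr)
          assume nz: "plane \<zeta> f \<noteq> 0"
          have "m * n \<le> Polynomial.degree (plane \<zeta> f)"
            using dvd_imp_degree_le[OF dvd nz] by (simp add: degree_power_eq[OF v0] dv)
          also have "\<dots> \<le> Polynomial.degree f"
            unfolding plane_def by (rule map_poly_degree_leq)
          finally show False using deg True mult.commute[of m n] by linarith
        qed
      qed
      then obtain g where fg: "f = u * g" by blast
      have dg: "n \<le> d" "homog (d - n) g"
        using homog_cancel[OF homog_uvw(1) u_nonzero] h(1) False fg by auto
      have "g \<in> MI (m - 1) (\<alpha> - n) \<beta> \<gamma>"
      proof (rule less.IH)
        show "d - n < d" using dg(1) n_pos by simp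
        show "homog (d - n) g" by (rule dg(2))
        show "g \<in> pw u v (m - 1)"
          using h(2) fg by (cases m) (auto intro!: pw_cancel_gen[OF u_nonzero reg_uv] simp del: pw.simps(2))
        show "g \<in> pw varx vary (\<alpha> - n)"
        proof (rule pw_xy_of_cf)
          fix i j l assume c: "cf g i j l \<noteq> 0"
          have "Polynomial.degree f = Polynomial.degree g"
            using False fg unfolding u_poly by (auto simp: degree_mult_eq simp del: minus_pCons mult_minus_left)
          moreover have "l \<le> Polynomial.degree g"
            by (rule le_degree) (use c in \<open>auto simp: cf_def\<close>)
          moreover have "i + j + l = d - n" by (rule homog_cf[OF dg(2) c])
          ultimately show "\<alpha> - n \<le> i + j" using deg by linarith
        qed
        have "ev cst varx 0 0 u \<noteq> 0" "ev cst 0 vary 0 u \<noteq> 0"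
          using n_pos by (simp_all add: u_def ev_cst_simps power_0_left)
        then show "g \<in> pw vary varz \<beta>" "g \<in> pw varx varz \<gamma>"
          using pw_yz_cancel pw_xz_cancel h(4,5) unfolding fg by blast+
      qed
      then show ?thesis unfolding fg by (rule MI_mult_u)
    next
      case large: False
      define \<G> where "\<G> = {G \<in> MI m \<alpha> \<beta> \<gamma>. homog d G}"
      define K where "K = {g. \<exists>G\<in>\<G>. varz dvd g - G}"
      have "[:poly.coeff f 0:] \<in> K"
      proof (rule mem_of_monomials)
        show "0 \<in> K" using MI_zero homog_gens unfolding K_def \<G>_def by force
        fix g h assume "g \<in> K" "h \<in> K"
        then obtain G H where GH: "G \<in> \<G>" "H \<in> \<G>" "varz dvd g - G" "varz dvd h - H"
          unfolding K_def by blast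
        have "varz dvd (g - G) + (h - H)" using GH by (intro dvd_add)
        moreover have "(g - G) + (h - H) = (g + h) - (G + H)" by simp
        moreover have "G + H \<in> \<G>" using GH unfolding \<G>_def by (simp add: MI.add homog_add)
        ultimately show "g + h \<in> K" unfolding K_def by auto
      next
        fix i j l assume nz: "cf [:poly.coeff f 0:] i j l \<noteq> 0"
        then have l: "l = 0" by (cases l) (simp_all add: cf_def)
        have c: "cf [:poly.coeff f 0:] i j l = cf f i j 0" by (simp add: l cf_def)
        then have nzf: "cf f i j 0 \<noteq> 0" using nz by simp
        have ij: "i + j = d" "\<beta> \<le> j" "\<gamma> \<le> i" "m \<le> i div n + j div n"
          using homog_cf[OF h(1) nzf] pw_yz_cf[OF h(4) nzf] pw_xz_cf[OF h(5) nzf] pw_uv_cf[OF h(2) nzf]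
          by auto
        \<comment> \<open>Trade \<open>p\<close> factors \<open>x\<^sup>n\<close> for \<open>w\<close> and \<open>q\<close> factors \<open>y\<^sup>n\<close> for \<open>v\<close>, with \<open>p + q = m\<close>. This keeps the orders
          along \<open>x = z = 0\<close> and \<open>y = z = 0\<close> and lowers the order along \<open>x = y = 0\<close> from \<open>d\<close> to \<open>d - n m\<close>.\<close>
        define p where "p = min m (i div n)"
        define q where "q = m - p"
        have pq: "p + q = m" "p \<le> i div n" "q \<le> j div n" using ij(4) by (auto simp: p_def q_def)
        have np: "n * p \<le> i" "n * q \<le> j"
          using pq(2,3) n_pos by (simp_all add: less_eq_div_iff_mult_less_eq mult.commute)
        have sum: "n * p + n * q = n * m" using pq(1) by (metis distrib_left)
        define T where "T = cst (cf f i j 0 * (- 1) ^ p) * mon (i - n * p) (j - n * q) 0 0 q p"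
        have "T \<in> MI m \<alpha> \<beta> \<gamma>"
          unfolding T_def by (rule MI.gen) (use pq ij np sum large in auto)
        moreover have "homog d T"
        proof -
          have "homog (0 + ((i - n * p) + (j - n * q) + 0 + n * (0 + q + p))) T"
            unfolding T_def by (intro homog_mult homog_gens homog_mon)
          moreover have "0 + ((i - n * p) + (j - n * q) + 0 + n * (0 + q + p)) = d"
            using ij(1) np by (simp add: distrib_left)
          ultimately show ?thesis by simp
        qed
        moreover have "varz dvd cst (cf f i j 0) * varx ^ i * vary ^ j - T"
        proof -
          have "(0 - varx ^ n) ^ p = (- 1) ^ p * (varx ^ n) ^ p"
            by (simp only: diff_0 power_minus[of "varx ^ n"])
          then have "ev cst varx vary 0 T
            = cst (cf f i j 0) * (cst (- 1) ^ p * (- 1) ^ p) * (varx ^ (i - n * p) * varx ^ (n * p))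
              * (vary ^ (j - n * q) * vary ^ (n * q))"
            using n_pos by (simp add: T_def mon_def ev_cst_simps u_def v_def w_def power_0_left
              power_mult is_hom_simps[OF is_hom_cst])
          also have "cst (- 1) ^ p * (- 1) ^ p = 1"
            by (simp add: is_hom_simps[OF is_hom_cst] power_mult_distrib[symmetric])
          finally show ?thesis
            using np by (simp add: dvd_varz_iff ev_cst_simps power_add[symmetric])
        qed
        ultimately show "cst (cf [:poly.coeff f 0:] i j l) * varx ^ i * vary ^ j * varz ^ l \<in> K"
          unfolding K_def \<G>_def using c l by auto
      qed
      then obtain G where G: "G \<in> MI m \<alpha> \<beta> \<gamma>" "homog d G" "varz dvd [:poly.coeff f 0:] - G"
        unfolding K_def \<G>_def by blast
      have "varz dvd f - [:poly.coeff f 0:]"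
      proof (cases f)
        case (pCons a q)
        then have "f - [:poly.coeff f 0:] = varz * q" by (simp add: varz_def)
        then show ?thesis by simp
      qed
      from dvd_add[OF this G(3)] have "varz dvd f - G" by simp
      then obtain g where fg: "f - G = varz * g" by blast
      show ?thesis
      proof (cases "varz * g = 0")
        case True
        then show ?thesis using G fg by simp
      next
        case nz: False
        have dg: "1 \<le> d" "homog (d - 1) g"
          using homog_cancel[OF homog_gens(3) vars_nonzero(3)] homog_diff[OF h(1) G(2)] nz unfolding fg by blast+
        note G' = MI_pw[OF G(1)]
        have "g \<in> MI m \<alpha> (\<beta> - 1) (\<gamma> - 1)"
        proof (rule less.IH[OF _ dg(2)])
          show "d - 1 < d" using dg(1) by simp
          show "g \<in> pw u v m"
          proof (rule pw_uv_cancel_family)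
            fix \<zeta> \<eta> assume "\<eta> \<in> roots"
            then have "lin 1 \<zeta> \<eta> varz \<noteq> 0" using n_pos by (auto simp: lin_gens roots_def power_0_left)
            then show "\<exists>s. lin 1 \<zeta> \<eta> s \<noteq> 0 \<and> s * g \<in> pw u v m"
              using pw_minus[OF h(2) G'(1)] fg by auto
          qed
          have "varz * g \<in> pw varx vary \<alpha>" using pw_minus[OF h(3) G'(2)] fg by simp
          then show "g \<in> pw varx vary \<alpha>" by (rule pw_xy_cancel[rotated]) (simp add: ev_cst_simps)
          have "varz * g \<in> pw varz vary \<beta>" using pw_minus[OF h(4) G'(3)] fg by (simp add: pw_commute)
          then have "g \<in> pw varz vary (\<beta> - 1)"
            by (cases \<beta>) (auto intro!: pw_cancel_gen[OF vars_nonzero(3) reg_zy] simp del: pw.simps(2))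
          then show "g \<in> pw vary varz (\<beta> - 1)" by (simp add: pw_commute)
          have "varz * g \<in> pw varz varx \<gamma>" using pw_minus[OF h(5) G'(4)] fg by (simp add: pw_commute)
          then have "g \<in> pw varz varx (\<gamma> - 1)"
            by (cases \<gamma>) (auto intro!: pw_cancel_gen[OF vars_nonzero(3) reg_zx] simp del: pw.simps(2))
          then show "g \<in> pw varx varz (\<gamma> - 1)" by (simp add: pw_commute)
        qed
        then have "varz * g \<in> MI m \<alpha> \<beta> \<gamma>" by (rule MI_mult_z)
        then show ?thesis using MI.add[OF G(1)] fg by (metis add_diff_cancel_left' diff_add_cancel add.commute)
      qed
    qed
  qed
qed

text \<open>In the variables \<open>x\<^sup>n, y\<^sup>n, z\<^sup>n\<close> this is a statement about the plane with four points in general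
  position, namely \<open>(1 : 1 : 1)\<close> and the coordinate points: curves with prescribed multiplicities there
  are generated by unions of the six lines through two of the points.\<close>

theorem mem_MI_iff:
  "f \<in> MI m \<alpha> \<beta> \<gamma> \<longleftrightarrow>
    f \<in> pw u v m \<and> f \<in> pw varx vary \<alpha> \<and> f \<in> pw vary varz \<beta> \<and> f \<in> pw varx varz \<gamma>" (is "?L \<longleftrightarrow> ?R")
proof
  assume f: ?R
  have "hcomp d f \<in> MI m \<alpha> \<beta> \<gamma>" for d
    using f by (intro homog_mem_MI[OF homog_comp] pw_comp[OF homog_uvw(1,2)] pw_comp[OF homog_gens(1,2)]
      pw_comp[OF homog_gens(2,3)] pw_comp[OF homog_gens(1,3)]) auto
  then have "(\<Sum>d\<le>k. hcomp d f) \<in> MI m \<alpha> \<beta> \<gamma>" for k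
    by (induction k) (simp_all add: MI.add)
  then show ?L by (subst sum_comp)
qed (use MI_pw in blast)

end

section \<open>The Fermat ideal and its lines\<close>

lemma power_add_mem:
  fixes K :: "'a::comm_ring_1 set"
  assumes K: "0 \<in> K" "\<And>f g. f \<in> K \<Longrightarrow> g \<in> K \<Longrightarrow> f + g \<in> K" "\<And>r f. f \<in> K \<Longrightarrow> r * f \<in> K"
    and "a ^ j \<in> K" "b ^ k \<in> K"
  shows "(a + b) ^ (j + k) \<in> K"
proof -
  have sum: "(\<Sum>i\<in>A. h i) \<in> K" if "\<And>i. i \<in> A \<Longrightarrow> h i \<in> K" "finite A" for h :: "nat \<Rightarrow> 'a" and A
    using that(2,1) by (induction rule: finite_induct) (auto intro: K)
  have "of_nat ((j + k) choose i) * a ^ i * b ^ (j + k - i) \<in> K" if "i \<le> j + k" for i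
  proof (cases "j \<le> i")
    case True
    then have "of_nat ((j + k) choose i) * a ^ i * b ^ (j + k - i) =
      (of_nat ((j + k) choose i) * b ^ (j + k - i) * a ^ (i - j)) * a ^ j"
      by (simp add: mult.assoc power_add[symmetric])
    then show ?thesis using K(3) assms(4) by simp
  next
    case False
    then have "b ^ (j + k - i) = b ^ (j - i) * b ^ k"
      by (simp add: power_add[symmetric])
    then have "of_nat ((j + k) choose i) * a ^ i * b ^ (j + k - i) =
      (of_nat ((j + k) choose i) * a ^ i * b ^ (j - i)) * b ^ k" by (simp add: ac_simps)
    then show ?thesis using K(3) assms(5) by simp
  qed
  then show ?thesis unfolding binomial_ring by (intro sum) auto
qed

definition at0 :: "complex poly poly poly \<Rightarrow> complex" where "at0 = ev (\<lambda>c. c) 0 0 0"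

lemma is_hom_at0: "is_hom at0"
  unfolding at0_def by (rule is_hom_ev[OF is_hom_id])

lemmas at0_simps = is_hom_simps[OF is_hom_at0]

lemma at0_gens: "at0 varx = 0" "at0 vary = 0" "at0 varz = 0" "at0 (cst c) = c"
  unfolding at0_def by (simp_all only: ev_gens[OF is_hom_id])

lemma poly_lin_0: "poly (lin a b c f) 0 = at0 f"
  by (rule hom_eqI[OF is_hom_comp[OF is_hom_poly is_hom_lin] is_hom_at0])
     (simp_all add: lin_gens at0_gens)

lemma at0_hcomp: "hcomp 0 f = cst (at0 f)"
proof (induction f rule: S_induct)
  case (cst c)
  then show ?case by (simp add: hcomp_homog[OF homog_gens(4)] at0_gens)
next
  case (add f g)
  then show ?case by (simp add: hcomp_add at0_simps is_hom_simps[OF is_hom_cst])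
next
  case (x f)
  then show ?case by (simp add: hcomp_homog_mult[OF homog_gens(1)] at0_simps at0_gens is_hom_simps[OF is_hom_cst])
next
  case (y f)
  then show ?case by (simp add: hcomp_homog_mult[OF homog_gens(2)] at0_simps at0_gens is_hom_simps[OF is_hom_cst])
next
  case (z f)
  then show ?case by (simp add: hcomp_homog_mult[OF homog_gens(3)] at0_simps at0_gens is_hom_simps[OF is_hom_cst])
qed

text \<open>A section of the restriction to a line on which \<open>l\<close> is the coordinate.\<close>

definition emb :: "complex poly poly poly \<Rightarrow> complex poly \<Rightarrow> complex poly poly poly" where
  "emb l p = poly (map_poly cst p) l"

lemma is_hom_emb: "is_hom (emb l)"
  unfolding emb_def by (intro is_hom_comp[OF is_hom_poly] is_hom_map_poly is_hom_cst)

lemmas emb_simps = is_hom_simps[OF is_hom_emb]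

lemma emb_gens: "emb l [:c:] = cst c" "emb l [:0, c:] = cst c * l"
  by (simp_all add: emb_def map_poly_pCons is_hom_zero[OF is_hom_cst] mult.commute)

lemma hom_emb:
  assumes "is_hom h" "\<And>c. h (cst c) = [:c:]" "h l = [:0, 1:]"
  shows "h (emb l p) = p"
proof (induction p rule: poly_gen_induct)
  case (3 f)
  then show ?case
    using emb_gens(2)[of l 1]
    by (simp only: emb_simps is_hom_simps[OF assms(1)] is_hom_one[OF is_hom_cst] assms mult_1)
qed (simp_all add: emb_simps is_hom_simps[OF assms(1)] emb_gens assms(2))

lemma lin_emb: "lin a b c l = [:0, 1:] \<Longrightarrow> lin a b c (emb l p) = p"
  by (rule hom_emb[OF is_hom_lin]) (simp_all add: lin_gens)

lemma at0_emb:
  assumes "at0 l = 0"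
  shows "at0 (emb l p) = poly p 0"
proof (induction p rule: poly_gen_induct)
  case (3 f)
  have "at0 (emb l ([:0, 1:] * f)) = at0 (emb l [:0, 1:]) * at0 (emb l f)"
    by (simp only: emb_simps at0_simps)
  also have "at0 (emb l [:0, 1:]) = 0"
    using assms by (simp only: emb_gens at0_simps mult_zero_right)
  finally show ?case by simp
qed (simp_all add: emb_simps at0_simps emb_gens at0_gens)

text \<open>The local ring of a line at the origin is a discrete valuation ring: any nonzero \<open>a\<close> is a
  unit times a power of the coordinate, so it divides a power of any \<open>b\<close> that vanishes at the origin.\<close>

lemma line_valuation:
  assumes l: "lin q1 q2 q3 l = [:0, 1:]" and a: "lin q1 q2 q3 a \<noteq> 0" and b: "at0 b = 0"
  shows "\<exists>e s c. at0 s \<noteq> 0 \<and> lin q1 q2 q3 (s * b ^ e - c * a) = 0"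
proof -
  define e where "e = order 0 (lin q1 q2 q3 a)"
  obtain g where g: "lin q1 q2 q3 a = [:0, 1:] ^ e * g" "\<not> [:0, 1:] dvd g"
    using order_decomp[OF a, of 0] unfolding e_def by auto
  have "[:0, 1:] dvd lin q1 q2 q3 b"
    using b poly_eq_0_iff_dvd[of "lin q1 q2 q3 b" 0] by (simp add: poly_lin_0)
  then obtain h where h: "lin q1 q2 q3 b = [:0, 1:] * h" by blast
  have "at0 l = 0" using poly_lin_0[of q1 q2 q3 l] l by simp
  then have "at0 (emb l g) \<noteq> 0"
    using g(2) poly_eq_0_iff_dvd[of g 0] by (simp add: at0_emb)
  moreover have "lin q1 q2 q3 (emb l g * b ^ e - emb l (h ^ e) * a) = 0"
    by (simp only: lin_simps lin_emb[OF l] g h power_mult_distrib) (simp add: ac_simps)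
  ultimately show ?thesis by blast
qed

context fermat
begin

definition "f1 = varx * v"
definition "f2 = vary * w"
definition "f3 = varz * u"

text \<open>The powers of the Fermat ideal \<open>(f1, f2, f3)\<close>.\<close>

primrec Jp :: "nat \<Rightarrow> complex poly poly poly set" where
  "Jp 0 = UNIV"
| "Jp (Suc k) = {f1 * p + f2 * q + f3 * r | p q r. p \<in> Jp k \<and> q \<in> Jp k \<and> r \<in> Jp k}"

lemma Jp_SucI: "p \<in> Jp k \<Longrightarrow> q \<in> Jp k \<Longrightarrow> r \<in> Jp k \<Longrightarrow> f1 * p + f2 * q + f3 * r \<in> Jp (Suc k)"
  by auto

lemma Jp_ideal: "0 \<in> Jp k \<and> (\<forall>f\<in>Jp k. \<forall>g\<in>Jp k. f + g \<in> Jp k) \<and> (\<forall>f\<in>Jp k. \<forall>r. r * f \<in> Jp k)"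
proof (induction k)
  case (Suc k)
  have "0 \<in> Jp (Suc k)"
    using Suc Jp_SucI[of 0 k 0 0] by simp
  moreover have "f + g \<in> Jp (Suc k)" if fg: "f \<in> Jp (Suc k)" "g \<in> Jp (Suc k)" for f g
  proof -
    obtain p q r p' q' r' where *: "f = f1 * p + f2 * q + f3 * r" "g = f1 * p' + f2 * q' + f3 * r'"
      "p \<in> Jp k" "q \<in> Jp k" "p' \<in> Jp k" "q' \<in> Jp k" "r \<in> Jp k" "r' \<in> Jp k"
      using fg by auto
    have "f + g = f1 * (p + p') + f2 * (q + q') + f3 * (r + r')"
      by (simp add: * algebra_simps)
    also have "\<dots> \<in> Jp (Suc k)" by (rule Jp_SucI) (use * Suc in blast)+
    finally show ?thesis .
  qed
  moreover have "s * f \<in> Jp (Suc k)" if f: "f \<in> Jp (Suc k)" for f s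
  proof -
    obtain p q r where *: "f = f1 * p + f2 * q + f3 * r" "p \<in> Jp k" "q \<in> Jp k" "r \<in> Jp k"
      using f by auto
    have "s * f = f1 * (s * p) + f2 * (s * q) + f3 * (s * r)"
      by (simp add: * algebra_simps)
    also have "\<dots> \<in> Jp (Suc k)" by (rule Jp_SucI) (use * Suc in blast)+
    finally show ?thesis .
  qed
  ultimately show ?case by blast
qed simp

lemma Jp_zero [simp]: "0 \<in> Jp k"
  and Jp_add: "f \<in> Jp k \<Longrightarrow> g \<in> Jp k \<Longrightarrow> f + g \<in> Jp k"
  and Jp_lmult: "f \<in> Jp k \<Longrightarrow> r * f \<in> Jp k"
  using Jp_ideal by blast+

lemma Jp_mult: "f \<in> Jp j \<Longrightarrow> g \<in> Jp k \<Longrightarrow> f * g \<in> Jp (j + k)"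
proof (induction j arbitrary: f)
  case 0
  then show ?case by (simp add: Jp_lmult)
next
  case (Suc j)
  then obtain p q r where *: "f = f1 * p + f2 * q + f3 * r" "p \<in> Jp j" "q \<in> Jp j" "r \<in> Jp j"
    by auto
  have "f * g = f1 * (p * g) + f2 * (q * g) + f3 * (r * g)"
    by (simp add: * algebra_simps)
  also have "\<dots> \<in> Jp (Suc (j + k))"
    by (intro Jp_SucI Suc.IH Suc.prems *)
  finally show ?case by simp
qed

lemma f_Jp: "f1 \<in> Jp 1" "f2 \<in> Jp 1" "f3 \<in> Jp 1"
  using Jp_SucI[of 1 0 0 0] Jp_SucI[of 0 0 1 0] Jp_SucI[of 0 0 0 1] by (simp_all del: Jp.simps(2)) 

lemma Jp_pw:
  assumes "f1 \<in> pw a b 1" "f2 \<in> pw a b 1" "f3 \<in> pw a b 1" "f \<in> Jp k"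
  shows "f \<in> pw a b k"
  using assms(4)
proof (induction k arbitrary: f)
  case (Suc k)
  then obtain p q r where *: "f = f1 * p + f2 * q + f3 * r" "p \<in> Jp k" "q \<in> Jp k" "r \<in> Jp k"
    by auto
  have "f \<in> pw a b (1 + k)"
    unfolding *(1) by (intro pw_add pw_mult assms(1-3) Suc.IH *)
  then show ?case by simp
qed simp

lemma pw_Jp:
  assumes "s * a \<in> Jp 1" "s * b \<in> Jp 1" "f \<in> pw a b k"
  shows "s ^ k * f \<in> Jp k"
  using assms(3)
proof (induction k arbitrary: f)
  case (Suc k)
  then obtain p q where *: "f = a * p + b * q" "p \<in> pw a b k" "q \<in> pw a b k"
    by auto
  have "s ^ Suc k * f = (s * a) * (s ^ k * p) + (s * b) * (s ^ k * q)"
    by (simp add: * algebra_simps)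
  also have "\<dots> \<in> Jp (1 + k)" by (intro Jp_add Jp_mult assms(1,2) Suc.IH *)
  finally show ?case by simp
qed simp

lemma var_n_pw: "0 < n \<Longrightarrow> a ^ n \<in> pw a b 1" "0 < n \<Longrightarrow> a ^ n \<in> pw b a 1"
  using pw_antimono[OF _ pw_power[OF pw_gen1[of a b], of n], of 1]
    pw_antimono[OF _ pw_power[OF pw_gen2[of a b], of n], of 1] by simp_all

lemma Jp_pws:
  assumes "f \<in> Jp k"
  shows "f \<in> pw u v k" "f \<in> pw varx vary k" "f \<in> pw vary varz k" "f \<in> pw varx varz k"
proof -
  show "f \<in> pw u v k"
    by (rule Jp_pw[OF _ _ _ assms]) (unfold f1_def f2_def f3_def, auto intro!: pw_lmult uvw_pw simp del: One_nat_def)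
  show "f \<in> pw varx vary k"
  proof (rule Jp_pw[OF _ _ _ assms])
    show "f1 \<in> pw varx vary 1" unfolding f1_def by (rule pw_rmult[OF pw_gen1])
    show "f2 \<in> pw varx vary 1" unfolding f2_def by (rule pw_rmult[OF pw_gen2])
    show "f3 \<in> pw varx vary 1" unfolding f3_def u_def by (intro pw_lmult pw_minus var_n_pw n_pos)
  qed
  show "f \<in> pw vary varz k"
  proof (rule Jp_pw[OF _ _ _ assms])
    show "f2 \<in> pw vary varz 1" unfolding f2_def by (rule pw_rmult[OF pw_gen1])
    show "f3 \<in> pw vary varz 1" unfolding f3_def by (rule pw_rmult[OF pw_gen2])
    show "f1 \<in> pw vary varz 1" unfolding f1_def v_def by (intro pw_lmult pw_minus var_n_pw n_pos)
  qed
  show "f \<in> pw varx varz k"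
  proof (rule Jp_pw[OF _ _ _ assms])
    show "f1 \<in> pw varx varz 1" unfolding f1_def by (rule pw_rmult[OF pw_gen1])
    show "f3 \<in> pw varx varz 1" unfolding f3_def by (rule pw_rmult[OF pw_gen2])
    show "f2 \<in> pw varx varz 1" unfolding f2_def w_def by (intro pw_lmult pw_minus var_n_pw n_pos)
  qed
qed

lemma Jp_dvd: "g \<in> Jp k \<Longrightarrow> g dvd f \<Longrightarrow> f \<in> Jp k"
  using Jp_lmult by (metis dvdE mult.commute)

lemma Jp_1_products:
  "varx * vary * u \<in> Jp 1" "vary * varz * v \<in> Jp 1" "varx * varz * w \<in> Jp 1" "u * v * w \<in> Jp 1"
proof -
  have "(- vary) * f1 + (- varx) * f2 \<in> Jp 1" "(- varz) * f2 + (- vary) * f3 \<in> Jp 1"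
    "(- varz) * f1 + (- varx) * f3 \<in> Jp 1"
    by (intro Jp_add Jp_lmult f_Jp)+
  moreover have "(- vary) * f1 + (- varx) * f2 = varx * vary * u"
    "(- varz) * f2 + (- vary) * f3 = vary * varz * v" "(- varz) * f1 + (- varx) * f3 = varx * varz * w"
    by (simp_all add: f1_def f2_def f3_def w_eq algebra_simps)
  ultimately show "varx * vary * u \<in> Jp 1" "vary * varz * v \<in> Jp 1" "varx * varz * w \<in> Jp 1"
    by simp_all
  obtain k where k: "varx ^ n = varx * varx ^ k" "vary ^ n = vary * vary ^ k"
    using n_pos gr0_conv_Suc power_Suc by metis
  have "(varx ^ k * w) * f1 + (- (vary ^ k * v)) * f2 \<in> Jp 1" by (intro Jp_add Jp_lmult f_Jp)
  moreover have "(varx ^ k * w) * f1 + (- (vary ^ k * v)) * f2 = u * v * w"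
  proof -
    have "(varx ^ k * w) * f1 + (- (vary ^ k * v)) * f2 = (varx * varx ^ k - vary * vary ^ k) * v * w"
      by (simp add: f1_def f2_def algebra_simps)
    then show ?thesis by (simp only: u_def k)
  qed
  ultimately show "u * v * w \<in> Jp 1" by simp
qed

text \<open>Four orders of vanishing at least \<open>1\<close> force the product to be divisible by a generator of \<open>J\<close> or
  by one of the four elements of \<open>J\<close> that are not multiples of a single generator.\<close>

lemma MI_1_Jp:
  assumes "f \<in> MI 1 1 1 1"
  shows "f \<in> Jp 1"
  using assms
proof induction
  case (gen d e f a b c r)
  have pos: "0 < n * k \<longleftrightarrow> 0 < k" for k using n_pos by simp
  have c: "0 < d \<or> 0 < e \<or> 0 < f" "0 < a \<or> 0 < b \<or> 0 < d" "0 < b \<or> 0 < c \<or> 0 < e" "0 < a \<or> 0 < c \<or> 0 < f"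
    using gen pos[of d] pos[of e] pos[of f] by linarith+
  have s: "mon a b c d e f = (varx ^ a * v ^ e) * (vary ^ b * w ^ f * varz ^ c * u ^ d)"
    "mon a b c d e f = (vary ^ b * w ^ f) * (varx ^ a * v ^ e * varz ^ c * u ^ d)"
    "mon a b c d e f = (varz ^ c * u ^ d) * (varx ^ a * v ^ e * vary ^ b * w ^ f)"
    "mon a b c d e f = (varx ^ a * vary ^ b * u ^ d) * (v ^ e * varz ^ c * w ^ f)"
    "mon a b c d e f = (vary ^ b * varz ^ c * v ^ e) * (u ^ d * varx ^ a * w ^ f)"
    "mon a b c d e f = (varx ^ a * varz ^ c * w ^ f) * (u ^ d * vary ^ b * v ^ e)"
    "mon a b c d e f = (u ^ d * v ^ e * w ^ f) * (varx ^ a * vary ^ b * varz ^ c)"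
    by (simp_all only: mon_def ac_simps)
  have dv: "g dvd g ^ k" if "0 < k" for g :: "complex poly poly poly" and k
    using that by simp
  have "0 < a \<and> 0 < e \<or> 0 < b \<and> 0 < f \<or> 0 < c \<and> 0 < d \<or> 0 < a \<and> 0 < b \<and> 0 < d \<or>
    0 < b \<and> 0 < c \<and> 0 < e \<or> 0 < a \<and> 0 < c \<and> 0 < f \<or> 0 < d \<and> 0 < e \<and> 0 < f"
    using c by blast
  then have "mon a b c d e f \<in> Jp 1"
  proof (elim disjE conjE)
    assume "0 < a" "0 < e"
    then show ?thesis unfolding s(1)
      by (intro Jp_dvd[OF f_Jp(1)[unfolded f1_def]] dvd_mult2 mult_dvd_mono dv)
  next
    assume "0 < b" "0 < f"
    then show ?thesis unfolding s(2)
      by (intro Jp_dvd[OF f_Jp(2)[unfolded f2_def]] dvd_mult2 mult_dvd_mono dv)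
  next
    assume "0 < c" "0 < d"
    then show ?thesis unfolding s(3)
      by (intro Jp_dvd[OF f_Jp(3)[unfolded f3_def]] dvd_mult2 mult_dvd_mono dv)
  next
    assume "0 < a" "0 < b" "0 < d"
    then show ?thesis unfolding s(4)
      by (intro Jp_dvd[OF Jp_1_products(1)] dvd_mult2 mult_dvd_mono dv)
  next
    assume "0 < b" "0 < c" "0 < e"
    then show ?thesis unfolding s(5)
      by (intro Jp_dvd[OF Jp_1_products(2)] dvd_mult2 mult_dvd_mono dv)
  next
    assume "0 < a" "0 < c" "0 < f"
    then show ?thesis unfolding s(6)
      by (intro Jp_dvd[OF Jp_1_products(3)] dvd_mult2 mult_dvd_mono dv)
  next
    assume "0 < d" "0 < e" "0 < f"
    then show ?thesis unfolding s(7)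
      by (intro Jp_dvd[OF Jp_1_products(4)] dvd_mult2 mult_dvd_mono dv)
  qed
  then show ?case by (rule Jp_lmult)
qed (rule Jp_add)

text \<open>Direction vectors of the lines on which the Fermat ideal vanishes.\<close>

definition pts :: "(complex \<times> complex \<times> complex) set" where
  "pts = {(0, 0, 1), (1, 0, 0), (0, 1, 0)} \<union> {(1, \<zeta>, \<eta>) | \<zeta> \<eta>. \<zeta> \<in> roots \<and> \<eta> \<in> roots}"

definition line :: "complex \<times> complex \<times> complex \<Rightarrow> complex poly poly poly \<Rightarrow> complex poly" where
  "line q = (case q of (a, b, c) \<Rightarrow> lin a b c)"

lemma is_hom_line: "is_hom (line q)"
  by (cases q) (simp add: line_def is_hom_lin)

lemmas line_simps = is_hom_simps[OF is_hom_line]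

lemma finite_pts: "finite pts"
proof -
  have "finite roots" using card_roots n_pos card_ge_0_finite by metis
  then have "finite ((\<lambda>(\<zeta>, \<eta>). (1::complex, \<zeta>, \<eta>)) ` (roots \<times> roots))" by simp
  moreover have "{(1::complex, \<zeta>, \<eta>) | \<zeta> \<eta>. \<zeta> \<in> roots \<and> \<eta> \<in> roots} = (\<lambda>(\<zeta>, \<eta>). (1, \<zeta>, \<eta>)) ` (roots \<times> roots)"
    by auto
  ultimately show ?thesis by (simp add: pts_def)
qed

lemma pts_coord: "q \<in> pts \<Longrightarrow> \<exists>l. line q l = [:0, 1:]"
  unfolding pts_def line_def by (auto simp: lin_gens intro: exI[of _ varx] exI[of _ vary] exI[of _ varz])

lemma root_nonzero: "\<zeta> \<in> roots \<Longrightarrow> \<zeta> \<noteq> 0"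
  using n_pos by (auto simp: roots_def power_0_left)

lemma ev_axis:
  "lin 0 0 1 s \<noteq> 0 \<longleftrightarrow> ev cst 0 0 varz s \<noteq> 0"
  "lin 1 0 0 s \<noteq> 0 \<longleftrightarrow> ev cst varx 0 0 s \<noteq> 0"
  "lin 0 1 0 s \<noteq> 0 \<longleftrightarrow> ev cst 0 vary 0 s \<noteq> 0"
proof -
  note e = hom_eqI[OF is_hom_ev[OF is_hom_cst] is_hom_comp[OF is_hom_emb is_hom_lin]]
    hom_eqI[OF is_hom_lin is_hom_comp[OF is_hom_lin is_hom_ev[OF is_hom_cst]]]
  note s = ev_gens[OF is_hom_cst] lin_gens emb_gens emb_simps is_hom_simps[OF is_hom_cst] lin_simps
  have "ev cst 0 0 varz s = emb varz (lin 0 0 1 s)" "lin 0 0 1 s = lin 0 0 1 (ev cst 0 0 varz s)"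
    "ev cst varx 0 0 s = emb varx (lin 1 0 0 s)" "lin 1 0 0 s = lin 1 0 0 (ev cst varx 0 0 s)"
    "ev cst 0 vary 0 s = emb vary (lin 0 1 0 s)" "lin 0 1 0 s = lin 0 1 0 (ev cst 0 vary 0 s)"
    by (rule e; simp add: s)+
  then show "lin 0 0 1 s \<noteq> 0 \<longleftrightarrow> ev cst 0 0 varz s \<noteq> 0"
    "lin 1 0 0 s \<noteq> 0 \<longleftrightarrow> ev cst varx 0 0 s \<noteq> 0"
    "lin 0 1 0 s \<noteq> 0 \<longleftrightarrow> ev cst 0 vary 0 s \<noteq> 0"
    by (metis is_hom_zero is_hom_emb is_hom_lin)+
qed

text \<open>At each line the ideal of the line and \<open>J\<close> agree up to a denominator that does not vanish there:
  \<open>v w\<close>, \<open>u w\<close> and \<open>u v\<close> at the axes and \<open>x y z\<close> at the other lines. Powers of these denominators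
  serve for the powers of the ideals.\<close>

theorem symbolic_iff:
  "(\<forall>q\<in>pts. \<exists>s. line q s \<noteq> 0 \<and> s * f \<in> Jp k) \<longleftrightarrow> f \<in> MI k k k k" (is "?L \<longleftrightarrow> ?R")
proof
  assume L: ?L
  show ?R unfolding mem_MI_iff
  proof (intro conjI)
    show "f \<in> pw u v k"
    proof (rule pw_uv_cancel_family)
      fix \<zeta> \<eta> assume "\<zeta> \<in> roots" "\<eta> \<in> roots"
      then have "(1, \<zeta>, \<eta>) \<in> pts" by (simp add: pts_def)
      then show "\<exists>s. lin 1 \<zeta> \<eta> s \<noteq> 0 \<and> s * f \<in> pw u v k"
        using L Jp_pws(1) by (fastforce simp: line_def)
    qed
    have "\<exists>s. line (0, 0, 1) s \<noteq> 0 \<and> s * f \<in> Jp k" using L by (simp add: pts_def)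
    then show "f \<in> pw varx vary k" unfolding line_def prod.case ev_axis using Jp_pws(2) pw_xy_cancel by blast
    have "\<exists>s. line (1, 0, 0) s \<noteq> 0 \<and> s * f \<in> Jp k" using L by (simp add: pts_def)
    then show "f \<in> pw vary varz k" unfolding line_def prod.case ev_axis using Jp_pws(3) pw_yz_cancel by blast
    have "\<exists>s. line (0, 1, 0) s \<noteq> 0 \<and> s * f \<in> Jp k" using L by (simp add: pts_def)
    then show "f \<in> pw varx varz k" unfolding line_def prod.case ev_axis using Jp_pws(4) pw_xz_cancel by blast
  qed
next
  assume ?R
  then have f: "f \<in> pw u v k" "f \<in> pw varx vary k" "f \<in> pw vary varz k" "f \<in> pw varx varz k"
    by (simp_all add: mem_MI_iff)
  have axis: "\<exists>s. line q s \<noteq> 0 \<and> s * f \<in> Jp k"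
    if "f \<in> pw a b k" "s * a \<in> Jp 1" "s * b \<in> Jp 1" "line q s \<noteq> 0" for s a b q
    using pw_Jp[OF that(2,3,1)] that(4) by (intro exI[of _ "s ^ k"]) (simp add: line_simps)
  show ?L
  proof
    fix q assume "q \<in> pts"
    then consider "q = (0, 0, 1)" | "q = (1, 0, 0)" | "q = (0, 1, 0)" | \<zeta> \<eta> where "q = (1, \<zeta>, \<eta>)" "\<zeta> \<in> roots" "\<eta> \<in> roots"
      unfolding pts_def by blast
    then show "\<exists>s. line q s \<noteq> 0 \<and> s * f \<in> Jp k"
    proof cases
      case 1
      have "(v * w) * varx \<in> Jp 1" "(v * w) * vary \<in> Jp 1"
        by (rule Jp_dvd[OF f_Jp(1)], simp add: f1_def, rule Jp_dvd[OF f_Jp(2)], simp add: f2_def)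
      then show ?thesis
        by (rule axis[OF f(2)]) (use n_pos in \<open>simp add: 1 line_def lin_simps lin_gens v_def w_def power_0_left\<close>)
    next
      case 2
      have "(u * w) * vary \<in> Jp 1" "(u * w) * varz \<in> Jp 1"
        by (rule Jp_dvd[OF f_Jp(2)], simp add: f2_def, rule Jp_dvd[OF f_Jp(3)], simp add: f3_def)
      then show ?thesis
        by (rule axis[OF f(3)]) (use n_pos in \<open>simp add: 2 line_def lin_simps lin_gens u_def w_def power_0_left\<close>)
    next
      case 3
      have "(u * v) * varx \<in> Jp 1" "(u * v) * varz \<in> Jp 1"
        by (rule Jp_dvd[OF f_Jp(1)], simp add: f1_def, rule Jp_dvd[OF f_Jp(3)], simp add: f3_def)
      then show ?thesis
        by (rule axis[OF f(4)]) (use n_pos in \<open>simp add: 3 line_def lin_simps lin_gens u_def v_def power_0_left\<close>)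
    next
      case 4
      have "(varx * vary * varz) * u \<in> Jp 1" "(varx * vary * varz) * v \<in> Jp 1"
        by (rule Jp_dvd[OF f_Jp(3)], simp add: f3_def, rule Jp_dvd[OF f_Jp(1)], simp add: f1_def)
      then show ?thesis
        by (rule axis[OF f(1)]) (use 4 root_nonzero in \<open>simp add: line_def lin_simps lin_gens\<close>)
    qed
  qed
qed

lemma line_Jp_1:
  assumes "q \<in> pts" "f \<in> Jp 1"
  shows "line q f = 0"
proof -
  have "line q f1 = 0 \<and> line q f2 = 0 \<and> line q f3 = 0"
  proof -
    consider "q = (0, 0, 1)" | "q = (1, 0, 0)" | "q = (0, 1, 0)" | \<zeta> \<eta> where "q = (1, \<zeta>, \<eta>)" "\<zeta> \<in> roots" "\<eta> \<in> roots"
      using assms(1) unfolding pts_def by blast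
    then show ?thesis
    proof cases
      case 4
      have "lin 1 \<zeta> \<eta> w = 0" by (simp add: w_eq lin_simps lin_uv 4)
      then show ?thesis by (simp add: 4 line_def lin_simps lin_uv f1_def f2_def f3_def)
    qed (use n_pos in \<open>simp_all add: line_def lin_simps lin_gens f1_def f2_def f3_def u_def v_def w_def power_0_left\<close>)
  qed
  moreover obtain a b c where "f = f1 * a + f2 * b + f3 * c" using assms(2) by auto
  ultimately show ?thesis by (simp add: line_simps)
qed

lemma Jp_1_iff: "f \<in> Jp 1 \<longleftrightarrow> (\<forall>q\<in>pts. line q f = 0)"
proof
  assume *: "\<forall>q\<in>pts. line q f = 0"
  have "f \<in> MI 1 1 1 1"
    unfolding mem_MI_iff pw_uv_1_iff pw_xy_1_iff pw_yz_1_iff pw_xz_1_iff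
    using * ev_axis[of f] by (auto simp: pts_def line_def)
  then show "f \<in> Jp 1" by (rule MI_1_Jp)
qed (use line_Jp_1 in blast)

text \<open>The second form is chosen so that it meets the planes \<open>u v w = 0\<close> only in the lines of the Fermat
  ideal: on \<open>u = 0\<close> one has \<open>x\<^sup>n = y\<^sup>n\<close> and \<open>w = - v\<close>, so \<open>F2\<close> restricts to \<open>2 x\<^sup>n v\<^sup>2\<close>, and likewise on \<open>v = 0\<close>
  and \<open>w = 0\<close>.\<close>

definition "F1 = u * v * w"
definition "F2 = varx ^ n * v ^ 2 + vary ^ n * w ^ 2 + varz ^ n * u ^ 2"

lemma F_Jp: "F1 \<in> Jp 1" "F2 \<in> Jp 1"
proof -
  show "F1 \<in> Jp 1" unfolding F1_def by (rule Jp_1_products)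
  have "f1 dvd varx ^ n * v ^ 2" "f2 dvd vary ^ n * w ^ 2" "f3 dvd varz ^ n * u ^ 2"
    using n_pos unfolding f1_def f2_def f3_def by (auto intro!: mult_dvd_mono)
  then show "F2 \<in> Jp 1"
    unfolding F2_def using Jp_dvd f_Jp by (intro Jp_add) blast+
qed

text \<open>With \<open>a, b, c\<close> for \<open>x\<^sup>n, y\<^sup>n, z\<^sup>n\<close> and \<open>p, q, r\<close> for \<open>u, v, w\<close>. Modulo \<open>p q r\<close>, the second form times
  \<open>q r\<close> is \<open>2 a q r\<^sup>3\<close> and also \<open>2 b q\<^sup>3 r\<close>, and its product with \<open>p q\<close> is \<open>2 c p q\<^sup>3\<close>; hence its product with \<open>2 q\<^sup>3\<close> is \<open>2 a q\<^sup>5\<close>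
  up to multiples of the two forms.\<close>

lemma two_generators_identity:
  fixes a b c p q r :: "'a::comm_ring_1"
  assumes "b = a - p" "c = a - p - q" "r = - p - q"
  shows "2 * (a * q ^ 5) =
    (p * q * r) * (r * (a * (p + 2 * r) - r ^ 2 + c * p) + 2 * r ^ 3 - 2 * r * b * (p + 2 * r)
      + p * (c * (r + 2 * q) - q ^ 2 + b * r))
    + (a * q ^ 2 + b * r ^ 2 + c * p ^ 2) * (2 * q ^ 3 - q * r ^ 2 - p ^ 2 * q)"
  unfolding assms by (simp add: algebra_simps eval_nat_numeral)

lemma two_generators_aux:
  fixes a b c :: "complex poly poly poly"
  defines "A \<equiv> (a - b) * (b - c) * (c - a)"
    and "B \<equiv> a * (b - c) ^ 2 + b * (c - a) ^ 2 + c * (a - b) ^ 2"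
  shows "a * (b - c) ^ 5 \<in> pw A B 1"
proof -
  have half: "g \<in> pw A B 1" if "2 * g \<in> pw A B 1" for g
  proof -
    have "cst (1 / 2) * 2 = 1"
      by (simp add: cst_def numeral_poly one_pCons)
    then have "g = cst (1 / 2) * (2 * g)" by (simp add: mult.assoc[symmetric])
    then show ?thesis using pw_lmult[OF that] by metis
  qed
  have mem: "A * p + B * q \<in> pw A B 1" for p q unfolding pw_1_iff by blast
  have "\<exists>g h. 2 * (a * (b - c) ^ 5) = A * g + B * h"
    unfolding A_def B_def
    by (intro exI, rule two_generators_identity[of b a "a - b" c "b - c" "c - a"]) simp_all
  then have "2 * (a * (b - c) ^ 5) \<in> pw A B 1" using mem by metis
  then show ?thesis by (rule half)
qed

lemma F1_F2_power:
  assumes "f \<in> Jp 1"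
  shows "f ^ (3 * (n + 5)) \<in> pw F1 F2 1"
proof -
  let ?K = "pw F1 F2 1"
  have *: "varx ^ n * v ^ 5 \<in> ?K" "vary ^ n * w ^ 5 \<in> ?K" "varz ^ n * u ^ 5 \<in> ?K"
    using two_generators_aux[of "varx ^ n" "vary ^ n" "varz ^ n"]
      two_generators_aux[of "vary ^ n" "varz ^ n" "varx ^ n"]
      two_generators_aux[of "varz ^ n" "varx ^ n" "vary ^ n"]
    unfolding F1_def F2_def u_def v_def w_def by (simp_all only: ac_simps)
  have "f1 ^ (n + 5) = (varx ^ 5 * v ^ n) * (varx ^ n * v ^ 5)"
    "f2 ^ (n + 5) = (vary ^ 5 * w ^ n) * (vary ^ n * w ^ 5)"
    "f3 ^ (n + 5) = (varz ^ 5 * u ^ n) * (varz ^ n * u ^ 5)"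
    by (simp_all only: f1_def f2_def f3_def power_mult_distrib power_add ac_simps)
  then have g: "f1 ^ (n + 5) \<in> ?K" "f2 ^ (n + 5) \<in> ?K" "f3 ^ (n + 5) \<in> ?K"
    using * pw_lmult by metis+
  obtain p q r where f: "f = f1 * p + f2 * q + f3 * r" using assms by auto
  have m: "(g * h) ^ (n + 5) \<in> ?K" if "g ^ (n + 5) \<in> ?K" for g h
    using that pw_rmult by (metis power_mult_distrib)
  note add = power_add_mem[where K = ?K, OF pw_zero pw_add pw_lmult]
  have "f ^ ((n + 5) + (n + 5) + (n + 5)) \<in> ?K"
    unfolding f by (intro add m g)
  then show ?thesis by simp
qed

end

section \<open>Localization\<close>

locale mult_set = cring R for R (structure) +
  fixes M
  assumes M_sub: "M \<subseteq> carrier R" and M_one: "\<one> \<in> M"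
    and M_mult: "s \<in> M \<Longrightarrow> t \<in> M \<Longrightarrow> s \<otimes> t \<in> M"
begin

lemma M_carr [simp]: "s \<in> M \<Longrightarrow> s \<in> carrier R"
  using M_sub by blast

lemma mem_fraction: "(a, b) \<in> fraction R M r s \<longleftrightarrow>
    a \<in> carrier R \<and> b \<in> M \<and> (\<exists>t\<in>M. t \<otimes> (r \<otimes> b) = t \<otimes> (a \<otimes> s))"
  by (simp add: fraction_def)

lemma fraction_self: "r \<in> carrier R \<Longrightarrow> s \<in> M \<Longrightarrow> (r, s) \<in> fraction R M r s"
  using M_one by (auto simp: mem_fraction)

lemma fraction_subset:
  assumes "r \<in> carrier R" "s \<in> M" "r' \<in> carrier R" "s' \<in> M" "t \<in> M"
    and t: "t \<otimes> (r \<otimes> s') = t \<otimes> (r' \<otimes> s)"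
  shows "fraction R M r s \<subseteq> fraction R M r' s'"
proof (clarsimp simp: mem_fraction)
  fix a b t' assume *: "a \<in> carrier R" "b \<in> M" "t' \<in> M" "t' \<otimes> (r \<otimes> b) = t' \<otimes> (a \<otimes> s)"
  have c: "b \<in> carrier R" "t' \<in> carrier R" "t \<in> carrier R" "s \<in> carrier R" "s' \<in> carrier R" using * assms by simp_all
  have "(t \<otimes> t' \<otimes> s) \<otimes> (r' \<otimes> b) = (t \<otimes> (r' \<otimes> s)) \<otimes> (t' \<otimes> b)"
    using c * assms by (simp add: m_ac)
  also have "\<dots> = (t' \<otimes> (r \<otimes> b)) \<otimes> (t \<otimes> s')"
    unfolding t[symmetric] using c *(1) assms(1,3) by (simp add: m_ac)
  also have "\<dots> = (t' \<otimes> (a \<otimes> s)) \<otimes> (t \<otimes> s')" by (simp only: *(4))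
  also have "\<dots> = (t \<otimes> t' \<otimes> s) \<otimes> (a \<otimes> s')"
    using c *(1) by (simp add: m_ac)
  finally show "\<exists>t\<in>M. t \<otimes> (r' \<otimes> b) = t \<otimes> (a \<otimes> s')"
    using M_mult assms * by blast
qed

lemma fraction_eq_iff:
  assumes "r \<in> carrier R" "s \<in> M" "r' \<in> carrier R" "s' \<in> M"
  shows "fraction R M r s = fraction R M r' s' \<longleftrightarrow> (\<exists>t\<in>M. t \<otimes> (r \<otimes> s') = t \<otimes> (r' \<otimes> s))"
proof
  assume "fraction R M r s = fraction R M r' s'"
  then have "(r', s') \<in> fraction R M r s" using fraction_self assms by blast
  then show "\<exists>t\<in>M. t \<otimes> (r \<otimes> s') = t \<otimes> (r' \<otimes> s)" by (simp add: mem_fraction)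
next
  assume "\<exists>t\<in>M. t \<otimes> (r \<otimes> s') = t \<otimes> (r' \<otimes> s)"
  then show "fraction R M r s = fraction R M r' s'"
    using fraction_subset assms by (metis subset_antisym)
qed

lemma fraction_eqI:
  assumes "r \<in> carrier R" "s \<in> M" "r' \<in> carrier R" "s' \<in> M" "r \<otimes> s' = r' \<otimes> s"
  shows "fraction R M r s = fraction R M r' s'"
  using fraction_eq_iff[OF assms(1-4)] assms(5) M_one by auto

lemma fraction_mem_eq:
  assumes "(a, b) \<in> fraction R M r s" "r \<in> carrier R" "s \<in> M"
  shows "a \<in> carrier R" "b \<in> M" "fraction R M r s = fraction R M a b"
  using assms fraction_eq_iff[of r s a b] by (auto simp: mem_fraction)

abbreviation "L \<equiv> localization R M"

lemma L_carrier: "carrier L = {fraction R M r s | r s. r \<in> carrier R \<and> s \<in> M}"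
  and L_one: "\<one>\<^bsub>L\<^esub> = fraction R M \<one> \<one>"
  and L_zero: "\<zero>\<^bsub>L\<^esub> = fraction R M \<zero> \<one>"
  by (simp_all add: localization_def)

lemma L_mult:
  assumes "r \<in> carrier R" "s \<in> M" "r' \<in> carrier R" "s' \<in> M"
  shows "fraction R M r s \<otimes>\<^bsub>L\<^esub> fraction R M r' s' = fraction R M (r \<otimes> r') (s \<otimes> s')"
proof -
  have *: "fraction R M (a \<otimes> c) (b \<otimes> d) = fraction R M (r \<otimes> r') (s \<otimes> s')"
    if ab: "(a, b) \<in> fraction R M r s" and cd: "(c, d) \<in> fraction R M r' s'" for a b c d
  proof -
    note m = fraction_mem_eq[OF ab assms(1,2)] fraction_mem_eq[OF cd assms(3,4)]
    obtain t t' where t: "t \<in> M" "t \<otimes> (r \<otimes> b) = t \<otimes> (a \<otimes> s)" and t': "t' \<in> M" "t' \<otimes> (r' \<otimes> d) = t' \<otimes> (c \<otimes> s')"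
      using ab cd by (auto simp: mem_fraction)
    note cr = M_carr[OF t(1)] M_carr[OF t'(1)] M_carr[OF assms(2)] M_carr[OF assms(4)] M_carr[OF m(2)] M_carr[OF m(5)]
      m(1) m(4) assms(1) assms(3)
    have "(t \<otimes> t') \<otimes> ((a \<otimes> c) \<otimes> (s \<otimes> s')) = (t \<otimes> (a \<otimes> s)) \<otimes> (t' \<otimes> (c \<otimes> s'))"
      using cr by (simp add: m_ac)
    also have "\<dots> = (t \<otimes> t') \<otimes> ((r \<otimes> r') \<otimes> (b \<otimes> d))"
      unfolding t(2)[symmetric] t'(2)[symmetric] using cr by (simp add: m_ac)
    finally show ?thesis
      using fraction_eq_iff[of "a \<otimes> c" "b \<otimes> d" "r \<otimes> r'" "s \<otimes> s'"] cr m assms M_mult t(1) t'(1) by auto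
  qed
  have "fraction R M r s \<otimes>\<^bsub>L\<^esub> fraction R M r' s' =
    (\<Union>(a, b)\<in>fraction R M r s. \<Union>(c, d)\<in>fraction R M r' s'. fraction R M (a \<otimes> c) (b \<otimes> d))"
    by (simp add: localization_def)
  also have "\<dots> = fraction R M (r \<otimes> r') (s \<otimes> s')"
    using * fraction_self[OF assms(1,2)] fraction_self[OF assms(3,4)] by blast
  finally show ?thesis .
qed

lemma L_add:
  assumes "r \<in> carrier R" "s \<in> M" "r' \<in> carrier R" "s' \<in> M"
  shows "fraction R M r s \<oplus>\<^bsub>L\<^esub> fraction R M r' s' = fraction R M ((r \<otimes> s') \<oplus> (r' \<otimes> s)) (s \<otimes> s')"
proof -
  have *: "fraction R M ((a \<otimes> d) \<oplus> (c \<otimes> b)) (b \<otimes> d) = fraction R M ((r \<otimes> s') \<oplus> (r' \<otimes> s)) (s \<otimes> s')"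
    if ab: "(a, b) \<in> fraction R M r s" and cd: "(c, d) \<in> fraction R M r' s'" for a b c d
  proof -
    note m = fraction_mem_eq[OF ab assms(1,2)] fraction_mem_eq[OF cd assms(3,4)]
    obtain t t' where t: "t \<in> M" "t \<otimes> (r \<otimes> b) = t \<otimes> (a \<otimes> s)" and t': "t' \<in> M" "t' \<otimes> (r' \<otimes> d) = t' \<otimes> (c \<otimes> s')"
      using ab cd by (auto simp: mem_fraction)
    note cr = M_carr[OF t(1)] M_carr[OF t'(1)] M_carr[OF assms(2)] M_carr[OF assms(4)] M_carr[OF m(2)] M_carr[OF m(5)]
      m(1) m(4) assms(1) assms(3)
    have "(t \<otimes> t') \<otimes> (((a \<otimes> d) \<oplus> (c \<otimes> b)) \<otimes> (s \<otimes> s')) =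
      (t \<otimes> (a \<otimes> s)) \<otimes> (t' \<otimes> (d \<otimes> s')) \<oplus> (t' \<otimes> (c \<otimes> s')) \<otimes> (t \<otimes> (b \<otimes> s))"
      using cr by (simp add: m_ac l_distr r_distr)
    also have "\<dots> = (t \<otimes> t') \<otimes> (((r \<otimes> s') \<oplus> (r' \<otimes> s)) \<otimes> (b \<otimes> d))"
      unfolding t(2)[symmetric] t'(2)[symmetric] using cr by (simp add: m_ac l_distr r_distr)
    finally show ?thesis
      using fraction_eq_iff[of "(a \<otimes> d) \<oplus> (c \<otimes> b)" "b \<otimes> d" "(r \<otimes> s') \<oplus> (r' \<otimes> s)" "s \<otimes> s'"] cr m assms M_mult t(1) t'(1) by auto
  qed
  have "fraction R M r s \<oplus>\<^bsub>L\<^esub> fraction R M r' s' =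
    (\<Union>(a, b)\<in>fraction R M r s. \<Union>(c, d)\<in>fraction R M r' s'. fraction R M ((a \<otimes> d) \<oplus> (c \<otimes> b)) (b \<otimes> d))"
    by (simp add: localization_def)
  also have "\<dots> = fraction R M ((r \<otimes> s') \<oplus> (r' \<otimes> s)) (s \<otimes> s')"
    using * fraction_self[OF assms(1,2)] fraction_self[OF assms(3,4)] by blast
  finally show ?thesis .
qed

lemma L_cases:
  assumes "A \<in> carrier L"
  obtains r s where "A = fraction R M r s" "r \<in> carrier R" "s \<in> M"
  using assms unfolding L_carrier by blast

lemma L_closed: "r \<in> carrier R \<Longrightarrow> s \<in> M \<Longrightarrow> fraction R M r s \<in> carrier L"
  unfolding L_carrier by blast

lemma L_cring: "cring L"
proof (rule cringI)
  show "abelian_group L"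
  proof (rule abelian_groupI)
    fix x y assume "x \<in> carrier L" "y \<in> carrier L"
    then show "x \<oplus>\<^bsub>L\<^esub> y \<in> carrier L"
      by (elim L_cases) (simp add: L_add L_closed M_mult)
  next
    show "\<zero>\<^bsub>L\<^esub> \<in> carrier L" by (simp add: L_zero L_closed M_one)
  next
    fix x y z assume "x \<in> carrier L" "y \<in> carrier L" "z \<in> carrier L"
    then show "(x \<oplus>\<^bsub>L\<^esub> y) \<oplus>\<^bsub>L\<^esub> z = x \<oplus>\<^bsub>L\<^esub> (y \<oplus>\<^bsub>L\<^esub> z)"
      by (elim L_cases) (simp add: L_add M_mult l_distr r_distr m_ac a_ac)
  next
    fix x y assume "x \<in> carrier L" "y \<in> carrier L"
    then show "x \<oplus>\<^bsub>L\<^esub> y = y \<oplus>\<^bsub>L\<^esub> x"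
      by (elim L_cases) (simp add: L_add M_mult m_ac a_ac)
  next
    fix x assume "x \<in> carrier L"
    then show "\<zero>\<^bsub>L\<^esub> \<oplus>\<^bsub>L\<^esub> x = x"
      by (elim L_cases) (simp add: L_zero L_add M_one)
  next
    fix x assume "x \<in> carrier L"
    then obtain r s where x: "x = fraction R M r s" "r \<in> carrier R" "s \<in> M" by (rule L_cases)
    have "fraction R M (\<ominus> r) s \<oplus>\<^bsub>L\<^esub> x = fraction R M (\<ominus> r \<otimes> s \<oplus> r \<otimes> s) (s \<otimes> s)"
      using x by (simp add: L_add)
    also have "\<dots> = \<zero>\<^bsub>L\<^esub>"
      unfolding L_zero by (rule fraction_eqI) (use x M_mult M_one in \<open>simp_all add: l_minus l_neg\<close>)
    finally show "\<exists>y\<in>carrier L. y \<oplus>\<^bsub>L\<^esub> x = \<zero>\<^bsub>L\<^esub>" using L_closed x by blast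
  qed
next
  show "comm_monoid L"
  proof (rule comm_monoidI)
    fix x y assume "x \<in> carrier L" "y \<in> carrier L"
    then show "x \<otimes>\<^bsub>L\<^esub> y \<in> carrier L"
      by (elim L_cases) (simp add: L_mult L_closed M_mult)
  next
    show "\<one>\<^bsub>L\<^esub> \<in> carrier L" by (simp add: L_one L_closed M_one)
  next
    fix x y z assume "x \<in> carrier L" "y \<in> carrier L" "z \<in> carrier L"
    then show "(x \<otimes>\<^bsub>L\<^esub> y) \<otimes>\<^bsub>L\<^esub> z = x \<otimes>\<^bsub>L\<^esub> (y \<otimes>\<^bsub>L\<^esub> z)"
      by (elim L_cases) (simp add: L_mult M_mult m_ac)
  next
    fix x assume "x \<in> carrier L"
    then show "\<one>\<^bsub>L\<^esub> \<otimes>\<^bsub>L\<^esub> x = x"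
      by (elim L_cases) (simp add: L_one L_mult M_one)
  next
    fix x y assume "x \<in> carrier L" "y \<in> carrier L"
    then show "x \<otimes>\<^bsub>L\<^esub> y = y \<otimes>\<^bsub>L\<^esub> x"
      by (elim L_cases) (simp add: L_mult M_mult m_ac)
  qed
next
  fix x y z assume "x \<in> carrier L" "y \<in> carrier L" "z \<in> carrier L"
  then obtain r s r' s' r'' s'' where x: "x = fraction R M r s" "r \<in> carrier R" "s \<in> M"
    "y = fraction R M r' s'" "r' \<in> carrier R" "s' \<in> M" "z = fraction R M r'' s''" "r'' \<in> carrier R" "s'' \<in> M"
    by (elim L_cases)
  show "(x \<oplus>\<^bsub>L\<^esub> y) \<otimes>\<^bsub>L\<^esub> z = x \<otimes>\<^bsub>L\<^esub> z \<oplus>\<^bsub>L\<^esub> y \<otimes>\<^bsub>L\<^esub> z"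
    using x by (simp add: L_add L_mult M_mult, intro fraction_eqI) (simp_all add: M_mult l_distr r_distr m_ac)
qed

lemma loc_map_hom: "loc_map R M \<in> ring_hom R L"
  unfolding loc_map_def
  by (rule ring_hom_memI) (simp_all add: L_closed M_one L_mult L_add L_one)

definition ext :: "'a set \<Rightarrow> ('a \<times> 'a) set set" where
  "ext K = {fraction R M r s | r s. r \<in> K \<and> s \<in> M}"

lemma ext_ideal:
  assumes "ideal K R"
  shows "ideal (ext K) L"
proof -
  interpret K: ideal K R by fact
  interpret L: cring L by (rule L_cring)
  show ?thesis
  proof (rule idealI[OF L.ring_axioms])
    show "subgroup (ext K) (add_monoid L)"
    proof (rule L.add.subgroupI)
      show "ext K \<subseteq> carrier L" unfolding ext_def using L_closed K.Icarr by blast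
      show "ext K \<noteq> {}" unfolding ext_def using K.zero_closed M_one by blast
      fix x assume "x \<in> ext K"
      then obtain r s where x: "x = fraction R M r s" "r \<in> K" "s \<in> M" unfolding ext_def by blast
      then have rc: "r \<in> carrier R" by simp
      have "fraction R M (\<ominus> r) s \<oplus>\<^bsub>L\<^esub> x = fraction R M (\<ominus> r \<otimes> s \<oplus> r \<otimes> s) (s \<otimes> s)"
        using x rc by (simp add: L_add)
      also have "\<dots> = \<zero>\<^bsub>L\<^esub>"
        unfolding L_zero by (rule fraction_eqI) (use x rc M_mult M_one in \<open>simp_all add: l_minus l_neg\<close>)
      finally have "\<ominus>\<^bsub>L\<^esub> x = fraction R M (\<ominus> r) s"
        using L.minus_equality L_closed x rc by (metis a_inv_closed)
      then show "\<ominus>\<^bsub>L\<^esub> x \<in> ext K" unfolding ext_def using x K.a_inv_closed by blast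
      fix y assume "y \<in> ext K"
      then obtain r' s' where y: "y = fraction R M r' s'" "r' \<in> K" "s' \<in> M" unfolding ext_def by blast
      have "x \<oplus>\<^bsub>L\<^esub> y = fraction R M ((r \<otimes> s') \<oplus> (r' \<otimes> s)) (s \<otimes> s')"
        using x y rc by (simp add: L_add K.Icarr)
      moreover have "(r \<otimes> s') \<oplus> (r' \<otimes> s) \<in> K" using x y K.I_r_closed by simp
      ultimately show "x \<oplus>\<^bsub>L\<^esub> y \<in> ext K" unfolding ext_def using M_mult x y by blast
    qed
    fix a x assume a: "a \<in> ext K" and x: "x \<in> carrier L"
    obtain r s where r: "a = fraction R M r s" "r \<in> K" "s \<in> M" using a unfolding ext_def by blast
    obtain r' s' where r': "x = fraction R M r' s'" "r' \<in> carrier R" "s' \<in> M" using x by (rule L_cases)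
    have "x \<otimes>\<^bsub>L\<^esub> a = fraction R M (r' \<otimes> r) (s' \<otimes> s)" using r r' by (simp add: L_mult K.Icarr)
    then show "x \<otimes>\<^bsub>L\<^esub> a \<in> ext K" unfolding ext_def using K.I_l_closed r r' M_mult by blast
    have "a \<otimes>\<^bsub>L\<^esub> x = fraction R M (r \<otimes> r') (s \<otimes> s')" using r r' by (simp add: L_mult K.Icarr)
    then show "a \<otimes>\<^bsub>L\<^esub> x \<in> ext K" unfolding ext_def using K.I_r_closed r r' M_mult by blast
  qed
qed

lemma fraction_split:
  assumes "r \<in> carrier R" "s \<in> M"
  shows "fraction R M r s = fraction R M \<one> s \<otimes>\<^bsub>L\<^esub> loc_map R M r"
  unfolding loc_map_def using assms by (simp add: L_mult M_one)

lemma Idl_image_eq_ext: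
  assumes "ideal K R"
  shows "Idl\<^bsub>L\<^esub> (loc_map R M ` K) = ext K"
proof
  interpret K: ideal K R by fact
  interpret L: cring L by (rule L_cring)
  have "loc_map R M ` K \<subseteq> ext K" unfolding ext_def loc_map_def using M_one by blast
  then show "Idl\<^bsub>L\<^esub> (loc_map R M ` K) \<subseteq> ext K" by (rule L.genideal_minimal[OF ext_ideal[OF assms]])
  have sub: "loc_map R M ` K \<subseteq> carrier L" using K.Icarr by (auto simp: loc_map_def L_closed M_one)
  interpret I: ideal "Idl\<^bsub>L\<^esub> (loc_map R M ` K)" L by (rule L.genideal_ideal[OF sub])
  show "ext K \<subseteq> Idl\<^bsub>L\<^esub> (loc_map R M ` K)"
  proof
    fix x assume "x \<in> ext K"
    then obtain r s where r: "x = fraction R M r s" "r \<in> K" "s \<in> M" unfolding ext_def by blast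
    have "loc_map R M r \<in> Idl\<^bsub>L\<^esub> (loc_map R M ` K)" using L.genideal_self[OF sub] r by blast
    then show "x \<in> Idl\<^bsub>L\<^esub> (loc_map R M ` K)"
      using fraction_split[of r s] r I.I_l_closed L_closed by simp
  qed
qed

lemma fraction_mem_ext:
  assumes "ideal K R" "r \<in> carrier R" "s \<in> M"
  shows "fraction R M r s \<in> ext K \<longleftrightarrow> (\<exists>t\<in>M. t \<otimes> r \<in> K)"
proof
  interpret K: ideal K R by fact
  assume "fraction R M r s \<in> ext K"
  then obtain r' s' where r': "fraction R M r s = fraction R M r' s'" "r' \<in> K" "s' \<in> M" unfolding ext_def by blast
  then obtain t where t: "t \<in> M" "t \<otimes> (r \<otimes> s') = t \<otimes> (r' \<otimes> s)"
    using fraction_eq_iff[of r s r' s'] assms by auto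
  have "(t \<otimes> s') \<otimes> r = t \<otimes> (r \<otimes> s')" using t r' assms by (simp add: m_ac)
  also have "\<dots> \<in> K" unfolding t(2) using r' t assms by (simp add: K.I_l_closed K.I_r_closed)
  finally show "\<exists>t\<in>M. t \<otimes> r \<in> K" using M_mult t r' by blast
next
  interpret K: ideal K R by fact
  assume "\<exists>t\<in>M. t \<otimes> r \<in> K"
  then obtain t where t: "t \<in> M" "t \<otimes> r \<in> K" by blast
  have "fraction R M r s = fraction R M (t \<otimes> r) (t \<otimes> s)"
    by (rule fraction_eqI) (use assms t M_mult in \<open>simp_all add: m_ac\<close>)
  then show "fraction R M r s \<in> ext K" unfolding ext_def using t M_mult assms by blast
qed

end

lemma (in cring) mult_set_prime:
  assumes "primeideal P R"
  shows "mult_set R (carrier R - P)"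
proof -
  interpret P: primeideal P R by fact
  show ?thesis
  proof
    show "\<one> \<in> carrier R - P" using P.one_imp_carrier P.I_notcarr by auto
    fix s t assume "s \<in> carrier R - P" "t \<in> carrier R - P"
    then show "s \<otimes> t \<in> carrier R - P" using P.I_prime by auto
  qed auto
qed

lemma (in cring) contract_extend:
  assumes "primeideal P R" "ideal K R"
  shows "contract_loc R P (extend_loc R P K) = {r \<in> carrier R. \<exists>s\<in>carrier R - P. s \<otimes> r \<in> K}"
proof -
  interpret mult_set R "carrier R - P" by (rule mult_set_prime[OF assms(1)])
  show ?thesis
    unfolding contract_loc_def extend_loc_def loc_at_def Idl_image_eq_ext[OF assms(2)] loc_map_def
    using fraction_mem_ext[OF assms(2) _ M_one] by blast
qed

section \<open>Prime ideals of quotients and chains of primes\<close>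

lemma primeideal_vimage:
  assumes "cring R" "cring S" "h \<in> ring_hom R S" "primeideal Q S"
  shows "primeideal {r \<in> carrier R. h r \<in> Q} R"
proof -
  interpret R: cring R by fact
  interpret S: cring S by fact
  interpret h: ring_hom_ring R S h
    by (rule ring_hom_ringI2) (use assms R.ring_axioms S.ring_axioms in auto)
  interpret Q: primeideal Q S by fact
  have id: "ideal {r \<in> carrier R. h r \<in> Q} R"
    by (rule h.ideal_vimage) (rule Q.is_ideal)
  show ?thesis
  proof (rule primeidealI[OF id assms(1)])
    have "h \<one>\<^bsub>R\<^esub> \<notin> Q" using Q.one_imp_carrier Q.I_notcarr by auto
    then show "carrier R \<noteq> {r \<in> carrier R. h r \<in> Q}" by blast
    fix a b assume "a \<in> carrier R" "b \<in> carrier R" "a \<otimes>\<^bsub>R\<^esub> b \<in> {r \<in> carrier R. h r \<in> Q}"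
    then show "a \<in> {r \<in> carrier R. h r \<in> Q} \<or> b \<in> {r \<in> carrier R. h r \<in> Q}"
      using Q.I_prime[of "h a" "h b"] by auto
  qed
qed

text \<open>Chains of primes above an ideal \<open>I\<close>, so that chains in a quotient can be handled upstairs.\<close>

definition prime_chain :: "('a, 'm) ring_scheme \<Rightarrow> 'a set \<Rightarrow> nat \<Rightarrow> (nat \<Rightarrow> 'a set) \<Rightarrow> bool" where
  "prime_chain R I n P \<longleftrightarrow> (\<forall>i\<le>n. primeideal (P i) R \<and> I \<subseteq> P i) \<and> (\<forall>i<n. P i \<subset> P (Suc i))"

text \<open>Surjectivity of \<open>h\<close> is only required up to the primes of the chain: a difference of two
  successive primes has to be visible on the image. This covers localizations.\<close>

lemma prime_chain_vimage:
  assumes "cring R" "cring S" "h \<in> ring_hom R S" "prime_chain S J n Q"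
    and surj: "\<And>i x. i < n \<Longrightarrow> x \<in> Q (Suc i) \<Longrightarrow> x \<notin> Q i \<Longrightarrow> \<exists>r\<in>carrier R. h r \<in> Q (Suc i) \<and> h r \<notin> Q i"
    and I: "\<And>r. r \<in> I \<Longrightarrow> r \<in> carrier R \<and> h r \<in> J"
  shows "prime_chain R I n (\<lambda>i. {r \<in> carrier R. h r \<in> Q i})"
  unfolding prime_chain_def
proof (intro conjI allI impI)
  show "primeideal {r \<in> carrier R. h r \<in> Q i} R" if "i \<le> n" for i
    using assms(4) that unfolding prime_chain_def by (intro primeideal_vimage[OF assms(1-3)]) blast
  show "I \<subseteq> {r \<in> carrier R. h r \<in> Q i}" if "i \<le> n" for i
    using I assms(4) that unfolding prime_chain_def by blast
  show "{r \<in> carrier R. h r \<in> Q i} \<subset> {r \<in> carrier R. h r \<in> Q (Suc i)}" if "i < n" for i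
  proof -
    have "Q i \<subset> Q (Suc i)" using assms(4) that unfolding prime_chain_def by blast
    then show ?thesis using surj[OF that] by blast
  qed
qed

context cring
begin

lemma quot_mem_iff:
  assumes "ideal I R" "ideal P R" "I \<subseteq> P" "r \<in> carrier R"
  shows "I +> r \<in> (+>) I ` P \<longleftrightarrow> r \<in> P"
proof
  interpret I: ideal I R by fact
  interpret P: ideal P R by fact
  assume "I +> r \<in> (+>) I ` P"
  then obtain p where p: "p \<in> P" "I +> r = I +> p" by blast
  then have "r \<ominus> p \<in> I" using quotient_eq_iff_same_a_r_cos[OF assms(1,4) P.Icarr] by blast
  then have "(r \<ominus> p) \<oplus> p \<in> P" using p assms(3) P.a_closed by blast
  moreover have "(r \<ominus> p) \<oplus> p = r" using p P.Icarr assms(4) by (simp add: minus_eq a_assoc l_neg)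
  ultimately show "r \<in> P" by simp
qed blast

lemma quot_carrier: "carrier (R Quot I) = (+>) I ` carrier R"
  by (auto simp: FactRing_def A_RCOSETS_def RCOSETS_def a_r_coset_def r_coset_def)

lemma quot_prime:
  assumes I: "ideal I R" and "primeideal P R" "I \<subseteq> P"
  shows "primeideal ((+>) I ` P) (R Quot I)"
proof -
  interpret I: ideal I R by fact
  interpret P: primeideal P R by fact
  interpret Q: cring "R Quot I" by (rule I.quotient_is_cring[OF is_cring])
  have hom: "(+>) I \<in> ring_hom R (R Quot I)" by (rule I.rcos_ring_hom)
  note mem = quot_mem_iff[OF I P.is_ideal assms(3)]
  have id: "ideal ((+>) I ` P) (R Quot I)"
    using ring_ideal_imp_quot_ideal[OF I P.is_ideal] assms(3) by simp
  show ?thesis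
  proof (rule primeidealI[OF id Q.is_cring])
    have "I +> \<one> \<notin> (+>) I ` P" using mem[of \<one>] P.one_imp_carrier P.I_notcarr by auto
    then show "carrier (R Quot I) \<noteq> (+>) I ` P" unfolding quot_carrier by blast
    fix a b assume "a \<in> carrier (R Quot I)" "b \<in> carrier (R Quot I)" "a \<otimes>\<^bsub>R Quot I\<^esub> b \<in> (+>) I ` P"
    then obtain r s where rs: "r \<in> carrier R" "s \<in> carrier R" "a = I +> r" "b = I +> s"
      unfolding quot_carrier by blast
    then have "I +> (r \<otimes> s) \<in> (+>) I ` P"
      using \<open>a \<otimes>\<^bsub>R Quot I\<^esub> b \<in> _\<close> ring_hom_mult[OF hom] by simp
    then have "r \<otimes> s \<in> P" using mem rs by simp
    then show "a \<in> (+>) I ` P \<or> b \<in> (+>) I ` P" using P.I_prime rs by blast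
  qed
qed

lemma prime_chain_quot:
  assumes I: "ideal I R"
  shows "(\<exists>Q. prime_chain (R Quot I) {} n Q) \<longleftrightarrow> (\<exists>P. prime_chain R I n P)"
proof
  interpret I: ideal I R by fact
  interpret Q: cring "R Quot I" by (rule I.quotient_is_cring[OF is_cring])
  {
    assume "\<exists>Q. prime_chain (R Quot I) {} n Q"
    then obtain Q where Q: "prime_chain (R Quot I) {} n Q" by blast
    have zero: "\<zero>\<^bsub>R Quot I\<^esub> \<in> Q i" if "i \<le> n" for i
      using Q that unfolding prime_chain_def
      by (meson additive_subgroup.zero_closed ideal.axioms(1) primeideal.axioms(1))
    have Q': "prime_chain (R Quot I) {\<zero>\<^bsub>R Quot I\<^esub>} n Q"
      using Q zero unfolding prime_chain_def by blast
    have "prime_chain R I n (\<lambda>i. {r \<in> carrier R. I +> r \<in> Q i})"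
    proof (rule prime_chain_vimage[OF is_cring Q.is_cring I.rcos_ring_hom Q'])
      fix i x assume i: "i < n" "x \<in> Q (Suc i)" "x \<notin> Q i"
      then have "x \<in> carrier (R Quot I)"
        using Q unfolding prime_chain_def
        by (metis Suc_leI ideal.Icarr primeideal.axioms(1))
      then show "\<exists>r\<in>carrier R. I +> r \<in> Q (Suc i) \<and> I +> r \<notin> Q i"
        using i unfolding quot_carrier by blast
    next
      fix r assume "r \<in> I"
      then show "r \<in> carrier R \<and> I +> r \<in> {\<zero>\<^bsub>R Quot I\<^esub>}"
        using I.a_rcos_const by (auto simp: FactRing_def)
    qed
    then show "\<exists>P. prime_chain R I n P" by blast
  }
  {
    assume "\<exists>P. prime_chain R I n P"
    then obtain P where P: "prime_chain R I n P" by blast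
    have "(+>) I ` P i \<subset> (+>) I ` P (Suc i)" if "i < n" for i
    proof -
      have p: "primeideal (P i) R" "primeideal (P (Suc i)) R" "I \<subseteq> P i" "P i \<subset> P (Suc i)"
        using P that unfolding prime_chain_def by auto
      then obtain r where r: "r \<in> P (Suc i)" "r \<notin> P i" by blast
      then have "r \<in> carrier R" using p(2) ideal.Icarr primeideal.axioms(1) by metis
      then have "I +> r \<notin> (+>) I ` P i"
        using quot_mem_iff[OF I primeideal.axioms(1)[OF p(1)] p(3)] r by blast
      then show ?thesis using r p(4) by blast
    qed
    then have "prime_chain (R Quot I) {} n (\<lambda>i. (+>) I ` P i)"
      using P quot_prime[OF I] unfolding prime_chain_def by simp
    then show "\<exists>Q. prime_chain (R Quot I) {} n Q" by blast
  }
qed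

end

lemma krull_dim_eq: "krull_dim R = Sup {enat n | n. \<exists>P. prime_chain R {} n P}"
  unfolding krull_dim_def prime_chain_def by simp

lemma prime_chain_less:
  assumes "prime_chain R I n P" "m \<le> n"
  shows "prime_chain R I m P"
  using assms unfolding prime_chain_def by auto

lemma krull_dim_eqI:
  assumes "\<exists>P. prime_chain R {} n P" "\<nexists>P. prime_chain R {} (Suc n) P"
  shows "krull_dim R = enat n"
  unfolding krull_dim_eq
proof (rule antisym)
  have "m \<le> n" if "\<exists>P. prime_chain R {} m P" for m
    using that assms(2) prime_chain_less not_less_eq_eq by metis
  then show "Sup {enat n | n. \<exists>P. prime_chain R {} n P} \<le> enat n"
    by (intro Sup_least) (clarsimp, blast)
  show "enat n \<le> Sup {enat n | n. \<exists>P. prime_chain R {} n P}" using assms(1) by (intro Sup_upper) blast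
qed

section \<open>Local rings, ideal powers and regular elements\<close>

lemma local_ringI:
  fixes R (structure)
  assumes "cring R" "ideal M R" "M \<noteq> carrier R" and units: "\<And>a. a \<in> carrier R \<Longrightarrow> a \<notin> M \<Longrightarrow> a \<in> Units R"
  shows "local_ring R" "max_ideal R = M" "maximalideal M R"
proof -
  interpret cring R by fact
  have proper: "N \<subseteq> M" if N: "ideal N R" "N \<noteq> carrier R" for N
  proof
    interpret N: ideal N R by fact
    fix a assume a: "a \<in> N"
    then have "a \<in> carrier R" by (rule N.Icarr)
    show "a \<in> M"
    proof (rule ccontr)
      assume "a \<notin> M"
      then have "a \<in> Units R" using units \<open>a \<in> carrier R\<close> by blast
      then have "inv a \<otimes> a \<in> N" using a N.I_l_closed Units_inv_closed by blast
      then have "\<one> \<in> N" using Units_l_inv \<open>a \<in> Units R\<close> by simp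
      then show False using N.one_imp_carrier N(2) by blast
    qed
  qed
  show max: "maximalideal M R"
  proof (rule maximalidealI[OF assms(2)])
    show "carrier R \<noteq> M" using assms(3) by blast
    show "J = M \<or> J = carrier R" if "ideal J R" "M \<subseteq> J" "J \<subseteq> carrier R" for J
      using proper[OF that(1)] that by blast
  qed
  have uniq: "N = M" if "maximalideal N R" for N
  proof -
    interpret N: maximalideal N R by fact
    have "N \<subseteq> M" using proper[OF N.is_ideal] N.I_notcarr by blast
    then show ?thesis
      using N.I_maximal[OF assms(2)] assms(3) ideal.Icarr[OF assms(2)] by blast
  qed
  show "local_ring R" unfolding local_ring_def using max uniq assms(1) by blast
  show "max_ideal R = M" unfolding max_ideal_def using max uniq by (rule the_equality)
qed

context cring
begin

lemma ideal_power_0: "ideal_power R I 0 = carrier R"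
  by (simp add: nat_pow_def ideals_set_def)

lemma ideal_power_Suc: "ideal_power R I (Suc k) = ideal_power R I k \<cdot> I"
  by (simp add: nat_pow_def ideals_set_def)

lemma ideal_ideal_power: "ideal I R \<Longrightarrow> ideal (ideal_power R I k) R"
  by (induction k) (simp_all only: ideal_power_0 ideal_power_Suc oneideal ideal_prod_is_ideal)

lemma power_mem_ideal_power:
  assumes "ideal I R" "r \<in> I"
  shows "r [^] k \<in> ideal_power R I k"
proof (induction k)
  case (Suc k)
  then show ?case unfolding ideal_power_Suc nat_pow_Suc using assms(2) by (rule ideal_prod.prod)
next
  case 0
  show ?case unfolding ideal_power_0 by simp
qed

lemma ideal_power_subset: "ideal I R \<Longrightarrow> ideal_power R I (Suc k) \<subseteq> I"
  unfolding ideal_power_Suc using ideal_prod_inter[OF ideal_ideal_power, of I I k] by blast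

lemma ideal_power_mult:
  assumes "ideal I R" "r \<in> ideal_power R I j" "s \<in> ideal_power R I k"
  shows "r \<otimes> s \<in> ideal_power R I (j + k)"
proof -
  interpret S: semiring "ideals_set R" by (rule ideals_set_is_semiring)
  have "I \<in> carrier (ideals_set R)" using assms(1) by (simp add: ideals_set_def)
  then have "ideal_power R I (j + k) = ideal_power R I j \<cdot> ideal_power R I k"
    using S.nat_pow_mult[of I j k] by (simp add: ideals_set_def)
  then show ?thesis using assms(2,3) by (simp add: ideal_prod.prod)
qed

lemma nonzerodivisor_quot:
  assumes K: "ideal K R" and x: "x \<in> carrier R"
  shows "nonzerodivisor (R Quot K) (K +> x) \<longleftrightarrow> (\<forall>b\<in>carrier R. x \<otimes> b \<in> K \<longrightarrow> b \<in> K)"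
proof -
  interpret K: ideal K R by fact
  have hom: "(+>) K \<in> ring_hom R (R Quot K)" by (rule K.rcos_ring_hom)
  have zero: "K +> r = \<zero>\<^bsub>R Quot K\<^esub> \<longleftrightarrow> r \<in> K" if "r \<in> carrier R" for r
    using K.a_rcos_const K.rcos_const_imp_mem[OF that] by (auto simp: FactRing_def)
  have "(K +> x) \<otimes>\<^bsub>R Quot K\<^esub> (K +> b) = \<zero>\<^bsub>R Quot K\<^esub> \<longleftrightarrow> x \<otimes> b \<in> K" if "b \<in> carrier R" for b
    using ring_hom_mult[OF hom x that] zero[of "x \<otimes> b"] x that by simp
  then show ?thesis
    unfolding nonzerodivisor_def quot_carrier using zero x by auto
qed

lemma quot_noetherian:
  assumes "noetherian_ring R" "ideal K R"
  shows "noetherian_ring (R Quot K)"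
proof -
  interpret N: noetherian_ring R by fact
  interpret K: ideal K R by fact
  interpret Q: cring "R Quot K" by (rule K.quotient_is_cring[OF is_cring])
  interpret h: ring_hom_ring R "R Quot K" "(+>) K" by (rule K.rcos_ring_hom_ring)
  show ?thesis
  proof (rule Q.noetherian_ringI)
    fix J assume J: "ideal J (R Quot K)"
    interpret J: ideal J "R Quot K" by fact
    have "ideal {r \<in> carrier R. K +> r \<in> J} R" by (rule h.ideal_vimage[OF J])
    then obtain A where A: "A \<subseteq> carrier R" "finite A" "{r \<in> carrier R. K +> r \<in> J} = Idl A"
      using N.finetely_gen by blast
    let ?B = "(+>) K ` A"
    have B: "?B \<subseteq> carrier (R Quot K)" using A(1) by (auto simp: quot_carrier)
    have "ideal {r \<in> carrier R. K +> r \<in> Idl\<^bsub>R Quot K\<^esub> ?B} R" by (rule h.ideal_vimage[OF Q.genideal_ideal[OF B]])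
    moreover have "A \<subseteq> {r \<in> carrier R. K +> r \<in> Idl\<^bsub>R Quot K\<^esub> ?B}"
      using A(1) Q.genideal_self[OF B] by blast
    ultimately have "Idl A \<subseteq> {r \<in> carrier R. K +> r \<in> Idl\<^bsub>R Quot K\<^esub> ?B}"
      by (rule genideal_minimal)
    then have "J \<subseteq> Idl\<^bsub>R Quot K\<^esub> ?B"
      using J.Icarr A(3) unfolding quot_carrier by blast
    moreover have "?B \<subseteq> J" using genideal_self[OF A(1)] A(3) by blast
    then have "Idl\<^bsub>R Quot K\<^esub> ?B \<subseteq> J" by (rule Q.genideal_minimal[OF J])
    ultimately show "\<exists>A\<subseteq>carrier (R Quot K). finite A \<and> J = Idl\<^bsub>R Quot K\<^esub> A"
      using B A(2) by blast
  qed
qed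

lemma prime_power_mem:
  assumes "primeideal P R" "b \<in> carrier R" "b [^] (e::nat) \<in> P"
  shows "b \<in> P"
  using assms(3)
proof (induction e)
  interpret P: primeideal P R by fact
  case 0
  then show ?case using P.one_imp_carrier P.I_notcarr by simp
next
  interpret P: primeideal P R by fact
  case (Suc e)
  then show ?case using P.I_prime[of "b [^] e" b] assms(2) by auto
qed

text \<open>A product of elements chosen outside the prime, one from each ideal.\<close>

lemma element_of_intersection_outside_prime:
  assumes "primeideal P R" "finite A" "\<And>P'. P' \<in> A \<Longrightarrow> ideal P' R" "\<And>P'. P' \<in> A \<Longrightarrow> \<not> P' \<subseteq> P"
  shows "\<exists>g\<in>carrier R. g \<notin> P \<and> (\<forall>P'\<in>A. g \<in> P')"
  using assms(2-4)
proof (induction A rule: finite_induct)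
  interpret P: primeideal P R by fact
  case empty
  have "\<one> \<notin> P" using P.one_imp_carrier P.I_notcarr by auto
  then show ?case by auto
next
  interpret P: primeideal P R by fact
  case (insert P' A)
  then obtain g where g: "g \<in> carrier R" "g \<notin> P" "\<forall>P''\<in>A. g \<in> P''" by blast
  interpret P': ideal P' R using insert by blast
  obtain h where h: "h \<in> P'" "h \<notin> P" using insert by blast
  have "g \<otimes> h \<notin> P" using P.I_prime[of g h] g h P'.Icarr by blast
  moreover have "g \<otimes> h \<in> P''" if "P'' \<in> insert P' A" for P''
  proof (cases "P'' = P'")
    case False
    then have "ideal P'' R" "g \<in> P''" using that insert g by auto
    then show ?thesis using ideal.I_r_closed h P'.Icarr by metis
  qed (use g h P'.I_l_closed in simp)
  ultimately show ?case using g h P'.Icarr by (intro bexI[of _ "g \<otimes> h"]) auto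
qed

end

section \<open>Symbolic powers of radical ideals of dimension one\<close>

text \<open>The local ring of finitely many curve branches through a point. The condition \<open>dim_one\<close> says that the
  quotient by each of the primes has dimension one: modulo the prime, every nonzero element divides a
  power of any element of the maximal ideal. The element \<open>l\<close> is a common parameter.\<close>

locale radical_curve = cring R for R (structure) +
  fixes \<mm> :: "'a set" and \<L> :: "'a set set" and l :: 'a
  assumes noeth: "noetherian_ring R"
    and max_ideal: "ideal \<mm> R" "\<mm> \<noteq> carrier R"
    and units: "a \<in> carrier R \<Longrightarrow> a \<notin> \<mm> \<Longrightarrow> a \<in> Units R"
    and finite_primes: "finite \<L>" "\<L> \<noteq> {}"
    and prime: "P \<in> \<L> \<Longrightarrow> primeideal P R"
    and dim_one: "P \<in> \<L> \<Longrightarrow> a \<in> carrier R \<Longrightarrow> a \<notin> P \<Longrightarrow> b \<in> \<mm> \<Longrightarrow>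
       \<exists>(e::nat). \<exists>c\<in>carrier R. b [^] e \<ominus> c \<otimes> a \<in> P"
    and param: "l \<in> \<mm>" "P \<in> \<L> \<Longrightarrow> l \<notin> P"
begin

lemma proper_ideal_in_max:
  assumes "ideal N R" "N \<noteq> carrier R"
  shows "N \<subseteq> \<mm>"
proof
  interpret N: ideal N R by fact
  fix a assume a: "a \<in> N"
  show "a \<in> \<mm>"
  proof (rule ccontr)
    assume "a \<notin> \<mm>"
    then have u: "a \<in> Units R" using units N.Icarr[OF a] by blast
    then have "inv a \<otimes> a \<in> N" using a N.I_l_closed Units_inv_closed by blast
    then show False using Units_l_inv[OF u] N.one_imp_carrier assms(2) by simp
  qed
qed

lemma primes_above:
  assumes "P \<in> \<L>" "primeideal Q R" "P \<subseteq> Q"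
  shows "Q = P \<or> Q = \<mm>"
proof (cases "Q = P")
  case False
  interpret Q: primeideal Q R by fact
  obtain a where a: "a \<in> Q" "a \<notin> P" using False assms(3) by blast
  have "\<mm> \<subseteq> Q"
  proof
    fix b assume b: "b \<in> \<mm>"
    have bc: "b \<in> carrier R" using b max_ideal ideal.Icarr by metis
    obtain e :: nat and c where c: "c \<in> carrier R" "b [^] e \<ominus> c \<otimes> a \<in> P"
      using dim_one[OF assms(1) Q.Icarr[OF a(1)] a(2) b] by blast
    have "(b [^] e \<ominus> c \<otimes> a) \<oplus> c \<otimes> a \<in> Q"
      using c assms(3) a Q.I_l_closed Q.a_closed by blast
    moreover have "(b [^] e \<ominus> c \<otimes> a) \<oplus> c \<otimes> a = b [^] e"
      using bc c Q.Icarr[OF a(1)] by (simp add: minus_eq a_assoc l_neg)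
    ultimately show "b \<in> Q" using prime_power_mem[OF assms(2) bc] by simp
  qed
  moreover have "Q \<subseteq> \<mm>" using proper_ideal_in_max[OF Q.is_ideal] Q.I_notcarr by blast
  ultimately show ?thesis by blast
qed simp

lemma prime_subset_max: "P \<in> \<L> \<Longrightarrow> P \<subset> \<mm>"
  using proper_ideal_in_max[of P] prime[of P] param
  by (metis primeideal.axioms(1) primeideal.I_notcarr psubsetI)

lemma primes_incomparable: "P \<in> \<L> \<Longrightarrow> P' \<in> \<L> \<Longrightarrow> P' \<subseteq> P \<Longrightarrow> P' = P"
  using primes_above[of P' P] prime prime_subset_max by blast

definition I where "I = \<Inter>\<L>"

lemma I_ideal: "ideal I R"
  unfolding I_def using prime primeideal.axioms(1) finite_primes by (intro i_Intersect) blast+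

lemma separating_element:
  assumes "P \<in> \<L>"
  shows "\<exists>t\<in>carrier R. t \<notin> P \<and> (\<forall>P'\<in>\<L> - {P}. t \<in> P')"
  using assms primes_incomparable prime finite_primes primeideal.axioms(1)
  by (intro element_of_intersection_outside_prime) blast+

lemma prime_above_I:
  assumes "primeideal Q R" "I \<subseteq> Q"
  shows "\<exists>P\<in>\<L>. P \<subseteq> Q"
proof (rule ccontr)
  assume "\<not> ?thesis"
  then obtain g where "g \<in> carrier R" "g \<notin> Q" "\<forall>P\<in>\<L>. g \<in> P"
    using element_of_intersection_outside_prime[OF assms(1) finite_primes(1)] prime primeideal.axioms(1) by blast
  then show False using assms(2) unfolding I_def by blast
qed

text \<open>Since \<open>I\<close> is the intersection of the primes, the annihilator of \<open>t\<close> modulo \<open>I\<close> is the intersection of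
  the primes that do not contain \<open>t\<close>. It is prime only if it is one of them.\<close>

lemma Ass_quot_I: "Ass_quot R I = \<L>"
proof -
  interpret I: ideal I R by (rule I_ideal)
  have hom: "(+>) I \<in> ring_hom R (R Quot I)" by (rule I.rcos_ring_hom)
  have zero: "I +> r = \<zero>\<^bsub>R Quot I\<^esub> \<longleftrightarrow> r \<in> I" if "r \<in> carrier R" for r
    using I.a_rcos_const I.rcos_const_imp_mem[OF that] by (auto simp: FactRing_def)
  have mult: "(I +> r) \<otimes>\<^bsub>R Quot I\<^esub> (I +> t) = \<zero>\<^bsub>R Quot I\<^esub> \<longleftrightarrow> r \<otimes> t \<in> I"
    if "r \<in> carrier R" "t \<in> carrier R" for r t
    using ring_hom_mult[OF hom that] zero[of "r \<otimes> t"] that by simp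
  have ass: "P \<in> Ass_quot R I \<longleftrightarrow> primeideal P R \<and> (\<exists>t\<in>carrier R. P = {r \<in> carrier R. r \<otimes> t \<in> I})" for P
    unfolding Ass_quot_def quot_carrier using mult by (auto cong: conj_cong)
  show ?thesis
  proof (intro equalityI subsetI)
    fix P assume "P \<in> Ass_quot R I"
    then obtain t where P: "primeideal P R" and t: "t \<in> carrier R" "P = {r \<in> carrier R. r \<otimes> t \<in> I}"
      unfolding ass by blast
    have "\<exists>P'\<in>{P' \<in> \<L>. t \<notin> P'}. P' \<subseteq> P"
    proof (rule ccontr)
      assume "\<not> ?thesis"
      then have "\<exists>g\<in>carrier R. g \<notin> P \<and> (\<forall>P'\<in>{P' \<in> \<L>. t \<notin> P'}. g \<in> P')"
        using finite_primes(1) prime primeideal.axioms(1)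
        by (intro element_of_intersection_outside_prime[OF P]) (simp, blast+)
      then obtain g where g: "g \<in> carrier R" "g \<notin> P" "\<forall>P'\<in>{P' \<in> \<L>. t \<notin> P'}. g \<in> P'"
        by blast
      have "g \<otimes> t \<in> P'" if P': "P' \<in> \<L>" for P'
      proof -
        interpret P': primeideal P' R by (rule prime[OF P'])
        show ?thesis using g t P' P'.I_l_closed P'.I_r_closed by blast
      qed
      then show False using g t unfolding I_def by blast
    qed
    then obtain P' where P': "P' \<in> \<L>" "t \<notin> P'" "P' \<subseteq> P" by blast
    have "P \<subseteq> P'"
      using t P' primeideal.I_prime[OF prime[OF P'(1)]] unfolding I_def by blast
    then show "P \<in> \<L>" using P' by (metis subset_antisym)
  next
    fix P assume P: "P \<in> \<L>"
    interpret P: primeideal P R by (rule prime[OF P])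
    obtain t where t: "t \<in> carrier R" "t \<notin> P" "\<forall>P'\<in>\<L> - {P}. t \<in> P'" using separating_element[OF P] by blast
    have "P = {r \<in> carrier R. r \<otimes> t \<in> I}"
    proof (intro equalityI subsetI)
      fix r assume r: "r \<in> P"
      have "r \<otimes> t \<in> P'" if P': "P' \<in> \<L>" for P'
      proof (cases "P' = P")
        case True
        then show ?thesis using r t P.I_r_closed by blast
      next
        case False
        then show ?thesis using t P' ideal.I_l_closed[OF primeideal.axioms(1)[OF prime[OF P']]] P.Icarr[OF r] by blast
      qed
      then show "r \<in> {r \<in> carrier R. r \<otimes> t \<in> I}" using r P.Icarr unfolding I_def by blast
    next
      fix r assume "r \<in> {r \<in> carrier R. r \<otimes> t \<in> I}"
      then show "r \<in> P" using P.I_prime[of r t] t P unfolding I_def by blast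
    qed
    then show "P \<in> Ass_quot R I" unfolding ass using t(1) P.primeideal by blast
  qed
qed

lemma symbolic_power_eq:
  "symbolic_power R I k = {r \<in> carrier R. \<forall>P\<in>\<L>. \<exists>s\<in>carrier R - P. s \<otimes> r \<in> ideal_power R I k}"
proof -
  have "contract_loc R P (extend_loc R P (ideal_power R I k)) =
    {r \<in> carrier R. \<exists>s\<in>carrier R - P. s \<otimes> r \<in> ideal_power R I k}" if "P \<in> \<L>" for P
    by (rule contract_extend[OF prime[OF that] ideal_ideal_power[OF I_ideal]])
  then show ?thesis unfolding symbolic_power_def Ass_quot_I by auto
qed

lemma symbolic_power_ideal: "ideal (symbolic_power R I k) R"
proof -
  interpret K: ideal "ideal_power R I k" R by (rule ideal_ideal_power[OF I_ideal])
  show ?thesis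
    unfolding symbolic_power_eq
  proof (rule idealI[OF ring_axioms], rule add.subgroupI)
    let ?S = "{r \<in> carrier R. \<forall>P\<in>\<L>. \<exists>s\<in>carrier R - P. s \<otimes> r \<in> ideal_power R I k}"
    have one: "\<one> \<in> carrier R - P" if "P \<in> \<L>" for P
      using ideal.one_imp_carrier[OF primeideal.axioms(1)[OF prime[OF that]]] primeideal.I_notcarr[OF prime[OF that]] by auto
    show "?S \<subseteq> carrier R" by blast
    have "\<exists>s\<in>carrier R - P. s \<otimes> \<zero> \<in> ideal_power R I k" if "P \<in> \<L>" for P
      using one[OF that] K.zero_closed by (intro bexI[of _ \<one>]) simp_all
    then have "\<zero> \<in> ?S" by simp
    then show "?S \<noteq> {}" by blast
    fix r assume r: "r \<in> ?S"
    show "\<ominus> r \<in> ?S"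
    proof (intro CollectI conjI ballI)
      show "\<ominus> r \<in> carrier R" using r by simp
      fix P assume "P \<in> \<L>"
      then obtain s where s: "s \<in> carrier R - P" "s \<otimes> r \<in> ideal_power R I k" using r by blast
      then have "s \<otimes> \<ominus> r \<in> ideal_power R I k" using r K.a_inv_closed[OF s(2)] by (simp add: r_minus)
      then show "\<exists>s\<in>carrier R - P. s \<otimes> \<ominus> r \<in> ideal_power R I k" using s by blast
    qed
    fix r' assume r': "r' \<in> ?S"
    show "r \<oplus> r' \<in> ?S"
    proof (intro CollectI conjI ballI)
      show "r \<oplus> r' \<in> carrier R" using r r' by simp
      fix P assume P: "P \<in> \<L>"
      interpret P: primeideal P R by (rule prime[OF P])
      obtain s where s: "s \<in> carrier R - P" "s \<otimes> r \<in> ideal_power R I k" using r P by blast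
      obtain s' where s': "s' \<in> carrier R - P" "s' \<otimes> r' \<in> ideal_power R I k" using r' P by blast
      have "(s \<otimes> s') \<otimes> (r \<oplus> r') = s' \<otimes> (s \<otimes> r) \<oplus> s \<otimes> (s' \<otimes> r')"
        using s s' r r' by (simp add: r_distr m_ac)
      then have "(s \<otimes> s') \<otimes> (r \<oplus> r') \<in> ideal_power R I k"
        using s s' K.I_l_closed K.a_closed by simp
      moreover have "s \<otimes> s' \<in> carrier R - P" using s s' P.I_prime by auto
      ultimately show "\<exists>s\<in>carrier R - P. s \<otimes> (r \<oplus> r') \<in> ideal_power R I k" by blast
    qed
  next
    let ?S = "{r \<in> carrier R. \<forall>P\<in>\<L>. \<exists>s\<in>carrier R - P. s \<otimes> r \<in> ideal_power R I k}"
    fix r x assume r: "r \<in> ?S" and x: "x \<in> carrier R"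
    have "s \<otimes> (x \<otimes> r) \<in> ideal_power R I k" if "s \<in> carrier R" "s \<otimes> r \<in> ideal_power R I k" for s
    proof -
      have "s \<otimes> (x \<otimes> r) = x \<otimes> (s \<otimes> r)" using that r x by (simp add: m_ac)
      then show ?thesis using K.I_l_closed that x by simp
    qed
    then have "\<exists>s\<in>carrier R - P. s \<otimes> (x \<otimes> r) \<in> ideal_power R I k" if "P \<in> \<L>" for P
      using r that by blast
    then show "x \<otimes> r \<in> ?S" using r x by simp
    then show "r \<otimes> x \<in> ?S" using r x by (simp add: m_comm)
  qed
qed

lemma ideal_power_subset_symbolic: "ideal_power R I k \<subseteq> symbolic_power R I k"
proof
  fix r assume r: "r \<in> ideal_power R I k"
  have rc: "r \<in> carrier R" using r ideal.Icarr[OF ideal_ideal_power[OF I_ideal]] by blast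
  have one: "\<one> \<in> carrier R - P" if "P \<in> \<L>" for P
    using ideal.one_imp_carrier[OF primeideal.axioms(1)[OF prime[OF that]]] primeideal.I_notcarr[OF prime[OF that]] by auto
  show "r \<in> symbolic_power R I k"
    unfolding symbolic_power_eq
  proof (intro CollectI conjI ballI rc)
    fix P assume "P \<in> \<L>"
    then show "\<exists>s\<in>carrier R - P. s \<otimes> r \<in> ideal_power R I k"
      using r rc one by (intro bexI[of _ \<one>]) simp_all
  qed
qed

lemma symbolic_power_subset_prime:
  assumes "P \<in> \<L>"
  shows "symbolic_power R I (Suc k) \<subseteq> P"
proof
  interpret P: primeideal P R by (rule prime[OF assms])
  fix r assume "r \<in> symbolic_power R I (Suc k)"
  then obtain s where s: "r \<in> carrier R" "s \<in> carrier R - P" "s \<otimes> r \<in> ideal_power R I (Suc k)"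
    unfolding symbolic_power_eq using assms by blast
  then have "s \<otimes> r \<in> P" using ideal_power_subset[OF I_ideal, of k] assms unfolding I_def by blast
  then show "r \<in> P" using P.I_prime s by blast
qed

lemma symbolic_power_cancel:
  assumes "r \<in> carrier R" "s \<in> carrier R" "\<And>P. P \<in> \<L> \<Longrightarrow> s \<notin> P" "s \<otimes> r \<in> symbolic_power R I k"
  shows "r \<in> symbolic_power R I k"
  unfolding symbolic_power_eq
proof (intro CollectI conjI ballI assms(1))
  fix P assume P: "P \<in> \<L>"
  interpret P: primeideal P R by (rule prime[OF P])
  obtain t where t: "t \<in> carrier R - P" "t \<otimes> (s \<otimes> r) \<in> ideal_power R I k"
    using assms(4) P unfolding symbolic_power_eq by blast
  have "t \<otimes> s \<in> carrier R - P" using t assms(2) assms(3)[OF P] P.I_prime by auto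
  moreover have "(t \<otimes> s) \<otimes> r \<in> ideal_power R I k" using t assms(1,2) by (simp add: m_assoc)
  ultimately show "\<exists>s\<in>carrier R - P. s \<otimes> r \<in> ideal_power R I k" by blast
qed

text \<open>An element of one of the primes is a zero divisor modulo the symbolic power: multiplied with
  an element of all other primes it lies in \<open>I\<close>.\<close>

lemma regular_outside_primes:
  assumes a: "a \<in> carrier R" and reg: "\<And>b. b \<in> carrier R \<Longrightarrow> a \<otimes> b \<in> symbolic_power R I (Suc k) \<Longrightarrow> b \<in> symbolic_power R I (Suc k)"
    and P: "P \<in> \<L>"
  shows "a \<notin> P"
proof
  assume aP: "a \<in> P"
  interpret P: primeideal P R by (rule prime[OF P])
  obtain t where t: "t \<in> carrier R" "t \<notin> P" "\<forall>P'\<in>\<L> - {P}. t \<in> P'" using separating_element[OF P] by blast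
  have "a \<otimes> t \<in> P'" if P': "P' \<in> \<L>" for P'
  proof (cases "P' = P")
    case True
    then show ?thesis using aP t P.I_r_closed by blast
  next
    case False
    then show ?thesis using t P' ideal.I_l_closed[OF primeideal.axioms(1)[OF prime[OF P']]] a by blast
  qed
  then have "a \<otimes> t \<in> I" unfolding I_def by blast
  then have "(a \<otimes> t) [^] Suc k \<in> symbolic_power R I (Suc k)"
    using power_mem_ideal_power[OF I_ideal] ideal_power_subset_symbolic by blast
  then have *: "a [^] Suc k \<otimes> t [^] Suc k \<in> symbolic_power R I (Suc k)"
    using a t(1) by (simp only: nat_pow_distrib)
  have "t [^] Suc k \<in> symbolic_power R I (Suc k)"
    if "a [^] j \<otimes> t [^] Suc k \<in> symbolic_power R I (Suc k)" for j :: nat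
    using that
  proof (induction j)
    case 0
    then show ?case using t(1) by simp
  next
    case (Suc j)
    have "a \<otimes> (a [^] j \<otimes> t [^] Suc k) \<in> symbolic_power R I (Suc k)"
      using Suc.prems a t(1) by (simp add: m_ac)
    moreover have "a [^] j \<otimes> t [^] Suc k \<in> carrier R" using a t(1) by simp
    ultimately show ?case using Suc.IH reg by blast
  qed
  then have "t [^] Suc k \<in> P" using * symbolic_power_subset_prime[OF P] by blast
  then show False using prime_power_mem[OF prime[OF P] t(1)] t(2) by blast
qed

text \<open>Multiply the relations that \<open>dim_one\<close> gives for the single primes to land in \<open>I\<close>, then take the
  \<open>k\<close>-th power.\<close>

lemma power_mod_regular:
  assumes a: "a \<in> carrier R" "\<And>P. P \<in> \<L> \<Longrightarrow> a \<notin> P" and b: "b \<in> \<mm>"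
  shows "\<exists>(e::nat). \<exists>c\<in>carrier R. b [^] e \<ominus> c \<otimes> a \<in> ideal_power R I k"
proof -
  have bc: "b \<in> carrier R" using b max_ideal ideal.Icarr by metis
  have prod: "(b [^] e \<ominus> c \<otimes> a) \<otimes> (b [^] e' \<ominus> c' \<otimes> a) =
      b [^] (e + e') \<ominus> (b [^] e \<otimes> c' \<oplus> c \<otimes> b [^] e' \<ominus> c \<otimes> c' \<otimes> a) \<otimes> a"
    if "c \<in> carrier R" "c' \<in> carrier R" for e e' :: nat and c c'
  proof -
    define p q where "p = b [^] e" and "q = b [^] e'"
    have pq: "p \<in> carrier R" "q \<in> carrier R" "b [^] (e + e') = p \<otimes> q"
      using bc by (simp_all add: p_def q_def nat_pow_mult)
    show ?thesis
      unfolding pq(3) p_def[symmetric] q_def[symmetric] using that a(1) pq(1,2) by algebra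
  qed
  have "\<exists>(e::nat). \<exists>c\<in>carrier R. \<forall>P\<in>A. b [^] e \<ominus> c \<otimes> a \<in> P" if "finite A" "A \<subseteq> \<L>" for A
    using that
  proof (induction A rule: finite_induct)
    case (insert P A)
    then obtain e :: nat and c where c: "c \<in> carrier R" "\<forall>P\<in>A. b [^] e \<ominus> c \<otimes> a \<in> P" by auto
    obtain e' :: nat and c' where c': "c' \<in> carrier R" "b [^] e' \<ominus> c' \<otimes> a \<in> P"
      using dim_one[of P a b] a b insert by blast
    let ?g = "(b [^] e \<ominus> c \<otimes> a) \<otimes> (b [^] e' \<ominus> c' \<otimes> a)"
    have "?g \<in> P'" if P': "P' \<in> insert P A" for P'
    proof -
      interpret P': primeideal P' R using prime P' insert by blast
      have "b [^] e \<ominus> c \<otimes> a \<in> P' \<or> b [^] e' \<ominus> c' \<otimes> a \<in> P'" using P' c c' by blast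
      then show ?thesis using P'.I_l_closed P'.I_r_closed bc c c' a(1) by auto
    qed
    moreover have "b [^] e \<otimes> c' \<oplus> c \<otimes> b [^] e' \<ominus> c \<otimes> c' \<otimes> a \<in> carrier R" using bc c c' a(1) by simp
    ultimately show ?case unfolding prod[OF c(1) c'(1)] by blast
  qed auto
  from this[OF finite_primes(1) subset_refl]
  obtain e :: nat and c where "c \<in> carrier R" "\<forall>P\<in>\<L>. b [^] e \<ominus> c \<otimes> a \<in> P" by blast
  then have c: "c \<in> carrier R" "b [^] e \<ominus> c \<otimes> a \<in> I" unfolding I_def by simp_all
  have "\<exists>c'\<in>carrier R. b [^] (e * k) \<ominus> c' \<otimes> a \<in> ideal_power R I k"
  proof (induction k)
    case 0
    have "b [^] (e * 0) \<ominus> \<zero> \<otimes> a \<in> carrier R" using bc a(1) by simp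
    then show ?case unfolding ideal_power_0 by blast
  next
    case (Suc k)
    then obtain c' where c': "c' \<in> carrier R" "b [^] (e * k) \<ominus> c' \<otimes> a \<in> ideal_power R I k" by blast
    have "(b [^] (e * k) \<ominus> c' \<otimes> a) \<otimes> (b [^] e \<ominus> c \<otimes> a) \<in> ideal_power R I (Suc k)"
      unfolding ideal_power_Suc using c'(2) c(2) by (rule ideal_prod.prod)
    moreover have "b [^] (e * k) \<otimes> c \<oplus> c' \<otimes> b [^] e \<ominus> c' \<otimes> c \<otimes> a \<in> carrier R" using bc c c' a(1) by simp
    moreover have "e * k + e = e * Suc k" by simp
    ultimately show ?case using prod[OF c'(1) c(1), of "e * k" e] by metis
  qed
  then show ?thesis by blast
qed

text \<open>The quotient has dimension one because only the given primes and the maximal ideal contain the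
  symbolic power. The parameter \<open>l\<close> is regular, so the depth is at least one. It is not larger: a
  regular element avoids the primes, and modulo such an element the maximal ideal is nilpotent.\<close>

theorem Cohen_Macaulay_symbolic:
  assumes "1 \<le> k"
  shows "Cohen_Macaulay (R Quot symbolic_power R I k)"
proof -
  obtain k' where k': "k = Suc k'" using assms by (cases k) auto
  define J where "J = symbolic_power R I k"
  define B where "B = R Quot J"
  have J: "ideal J R" unfolding J_def by (rule symbolic_power_ideal)
  interpret J: ideal J R by (rule J)
  interpret B: cring B unfolding B_def by (rule J.quotient_is_cring[OF is_cring])
  have hom: "(+>) J \<in> ring_hom R B" unfolding B_def by (rule J.rcos_ring_hom)
  interpret h: ring_hom_ring R B "(+>) J" unfolding B_def by (rule J.rcos_ring_hom_ring)
  have carrB: "carrier B = (+>) J ` carrier R" unfolding B_def by (rule quot_carrier)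
  have zeroB: "J +> r = \<zero>\<^bsub>B\<^esub> \<longleftrightarrow> r \<in> J" if "r \<in> carrier R" for r
    unfolding B_def using J.a_rcos_const J.rcos_const_imp_mem[OF that] by (auto simp: FactRing_def)
  have J_prime: "J \<subseteq> P" if "P \<in> \<L>" for P
    unfolding J_def k' by (rule symbolic_power_subset_prime[OF that])
  have J_max: "J \<subseteq> \<mm>" using J_prime prime_subset_max finite_primes(2) by blast
  let ?m = "(+>) J ` \<mm>"
  have memm: "J +> r \<in> ?m \<longleftrightarrow> r \<in> \<mm>" if "r \<in> carrier R" for r
    by (rule quot_mem_iff[OF J max_ideal(1) J_max that])
  have m_ideal: "ideal ?m B"
    unfolding B_def using ring_ideal_imp_quot_ideal[OF J max_ideal(1)] J_max by simp
  have one_max: "\<one> \<notin> \<mm>" using ideal.one_imp_carrier[OF max_ideal(1)] max_ideal(2) by blast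
  have m_proper: "?m \<noteq> carrier B" using memm[of \<one>] one_max unfolding carrB by blast
  have local: "local_ring B" "max_ideal B = ?m"
  proof -
    have "x \<in> Units B" if x: "x \<in> carrier B" "x \<notin> ?m" for x
    proof -
      obtain r where r: "r \<in> carrier R" "x = J +> r" using x unfolding carrB by blast
      then have "r \<in> Units R" using x memm units by blast
      then have i: "inv r \<in> carrier R" "inv r \<otimes> r = \<one>" "r \<otimes> inv r = \<one>" by simp_all
      have "(J +> inv r) \<otimes>\<^bsub>B\<^esub> (J +> r) = \<one>\<^bsub>B\<^esub>" "(J +> r) \<otimes>\<^bsub>B\<^esub> (J +> inv r) = \<one>\<^bsub>B\<^esub>"
        using h.hom_mult[OF i(1) r(1)] h.hom_mult[OF r(1) i(1)] i(2,3) h.hom_one by simp_all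
      then show ?thesis
        unfolding r(2) Units_def using h.hom_closed[OF i(1)] h.hom_closed[OF r(1)] by blast
    qed
    then show "local_ring B" "max_ideal B = ?m"
      using local_ringI[OF B.is_cring m_ideal m_proper] by blast+
  qed
  have noethB: "noetherian_ring B" unfolding B_def by (rule quot_noetherian[OF noeth J])
  have dim: "krull_dim B = enat 1"
  proof (rule krull_dim_eqI)
    obtain P where P: "P \<in> \<L>" using finite_primes(2) by blast
    have "primeideal \<mm> R"
      using local_ringI(3)[OF is_cring max_ideal units] maximalideal_prime by blast
    then have "prime_chain R J 1 (\<lambda>i. if i = 0 then P else \<mm>)"
      unfolding prime_chain_def using prime[OF P] J_prime[OF P] J_max prime_subset_max[OF P] by auto
    then show "\<exists>Q. prime_chain B {} 1 Q" unfolding B_def prime_chain_quot[OF J] by blast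
    show "\<nexists>Q. prime_chain B {} (Suc 1) Q"
      unfolding B_def prime_chain_quot[OF J]
    proof
      assume "\<exists>Q. prime_chain R J (Suc 1) Q"
      then obtain Q where Q: "prime_chain R J 2 Q" by (auto simp: numeral_2_eq_2)
      have p: "primeideal (Q 0) R" "primeideal (Q 1) R" "primeideal (Q 2) R" "J \<subseteq> Q 0" "Q 0 \<subset> Q 1" "Q 1 \<subset> Q 2"
        using Q unfolding prime_chain_def by (auto simp: numeral_2_eq_2)
      have "I \<subseteq> Q 0"
      proof
        fix r assume r: "r \<in> I"
        then have "r [^] k \<in> J" unfolding J_def using power_mem_ideal_power[OF I_ideal] ideal_power_subset_symbolic by blast
        then have "r [^] k \<in> Q 0" using p(4) by blast
        then show "r \<in> Q 0" by (rule prime_power_mem[OF p(1) ideal.Icarr[OF I_ideal r]])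
      qed
      then obtain P where P: "P \<in> \<L>" "P \<subseteq> Q 0" using prime_above_I[OF p(1)] by blast
      have "P \<subseteq> Q 1" "P \<subseteq> Q 2" "Q 1 \<noteq> P" "Q 2 \<noteq> P" "Q 1 \<noteq> Q 2" using P(2) p(5,6) by auto
      then show False using primes_above[OF P(1) p(2)] primes_above[OF P(1) p(3)] by auto
    qed
  qed
  have reg_iff: "nonzerodivisor (B Quot K) (K +>\<^bsub>B\<^esub> x) \<longleftrightarrow> (\<forall>b\<in>carrier B. x \<otimes>\<^bsub>B\<^esub> b \<in> K \<longrightarrow> b \<in> K)"
    if "ideal K B" "x \<in> carrier B" for K x by (rule B.nonzerodivisor_quot[OF that])
  have Idl0: "Idl\<^bsub>B\<^esub> {} = {\<zero>\<^bsub>B\<^esub>}"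
    using B.genideal_minimal[OF B.zeroideal, of "{}"] additive_subgroup.zero_closed[OF ideal.axioms(1)[OF B.genideal_ideal[of "{}"]]] by auto
  have lc: "l \<in> carrier R" using param max_ideal ideal.Icarr by metis
  have "regular_sequence B [J +> l]"
  proof -
    have "nonzerodivisor (B Quot {\<zero>\<^bsub>B\<^esub>}) ({\<zero>\<^bsub>B\<^esub>} +>\<^bsub>B\<^esub> (J +> l))"
      unfolding reg_iff[OF B.zeroideal h.hom_closed[OF lc]]
    proof (intro ballI impI)
      fix b assume "b \<in> carrier B" "(J +> l) \<otimes>\<^bsub>B\<^esub> b \<in> {\<zero>\<^bsub>B\<^esub>}"
      then obtain r where r: "r \<in> carrier R" "b = J +> r" "J +> (l \<otimes> r) = \<zero>\<^bsub>B\<^esub>"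
        unfolding carrB using lc by auto
      then have "l \<otimes> r \<in> J" using zeroB[of "l \<otimes> r"] lc by simp
      then have "r \<in> J" unfolding J_def using symbolic_power_cancel[OF r(1) lc param(2)] by blast
      then show "b \<in> {\<zero>\<^bsub>B\<^esub>}" using zeroB r by simp
    qed
    moreover have "Idl\<^bsub>B\<^esub> {J +> l} \<subseteq> ?m"
      using B.genideal_minimal[OF m_ideal] param by blast
    then have "Idl\<^bsub>B\<^esub> {J +> l} \<noteq> carrier B" using m_proper ideal.Icarr[OF m_ideal] by blast
    ultimately show ?thesis unfolding regular_sequence_def using lc Idl0 by (simp add: Let_def)
  qed
  then have ge: "enat 1 \<le> depth B"
    unfolding depth_def local(2) using param by (intro Sup_upper) (force intro!: exI[of _ "[J +> l]"])
  have "length xs \<le> 1" if xs: "regular_sequence B xs" "set xs \<subseteq> ?m" for xs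
  proof (rule ccontr)
    assume "\<not> length xs \<le> 1"
    then have len: "0 < length xs" "1 < length xs" by auto
    then have "xs ! 0 \<in> ?m" "xs ! 1 \<in> ?m" using xs(2) by (meson nth_mem subsetD)+
    then obtain a b where ab: "a \<in> \<mm>" "b \<in> \<mm>" "xs ! 0 = J +> a" "xs ! 1 = J +> b" by blast
    then have c: "a \<in> carrier R" "b \<in> carrier R" using max_ideal ideal.Icarr by metis+
    have take1: "set (take 1 xs) = {J +> a}" using len ab(3) by (cases xs) auto
    define K where "K = Idl\<^bsub>B\<^esub> {J +> a}"
    have K: "ideal K B" unfolding K_def using h.hom_closed[OF c(1)] by (intro B.genideal_ideal) blast
    interpret K: ideal K B by (rule K)
    have "nonzerodivisor (B Quot {\<zero>\<^bsub>B\<^esub>}) ({\<zero>\<^bsub>B\<^esub>} +>\<^bsub>B\<^esub> (J +> a))"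
      using xs(1) len(1) ab(3) Idl0 unfolding regular_sequence_def Let_def by force
    then have nz: "\<forall>b\<in>carrier B. (J +> a) \<otimes>\<^bsub>B\<^esub> b \<in> {\<zero>\<^bsub>B\<^esub>} \<longrightarrow> b \<in> {\<zero>\<^bsub>B\<^esub>}"
      by (simp only: reg_iff[OF B.zeroideal h.hom_closed[OF c(1)]])
    have a_reg: "r \<in> J" if "r \<in> carrier R" "a \<otimes> r \<in> J" for r
    proof -
      have "(J +> a) \<otimes>\<^bsub>B\<^esub> (J +> r) = \<zero>\<^bsub>B\<^esub>" using zeroB[of "a \<otimes> r"] that c(1) by simp
      then have "J +> r = \<zero>\<^bsub>B\<^esub>" using nz h.hom_closed[OF that(1)] by blast
      then show ?thesis using zeroB[OF that(1)] by blast
    qed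
    have aP: "a \<notin> P" if "P \<in> \<L>" for P
      using regular_outside_primes[OF c(1) _ that, of k'] a_reg unfolding J_def k' by blast
    obtain e :: nat and d where d: "d \<in> carrier R" "b [^] e \<ominus> d \<otimes> a \<in> J"
      using power_mod_regular[OF c(1) aP ab(2), of k] ideal_power_subset_symbolic[of k] unfolding J_def by blast
    have aK: "J +> a \<in> K" unfolding K_def using h.hom_closed[OF c(1)] by (intro B.genideal_self'[of "J +> a"])
    have "J +> (b [^] e) = J +> ((b [^] e \<ominus> d \<otimes> a) \<oplus> d \<otimes> a)"
      using c d(1) by (simp add: minus_eq a_assoc l_neg)
    also have "\<dots> = \<zero>\<^bsub>B\<^esub> \<oplus>\<^bsub>B\<^esub> (J +> d) \<otimes>\<^bsub>B\<^esub> (J +> a)"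
      using c d zeroB[of "b [^] e \<ominus> d \<otimes> a"] by simp
    also have "\<dots> \<in> K" using aK d(1) K.I_l_closed c by simp
    finally have bK: "(J +> b) [^]\<^bsub>B\<^esub> e \<in> K" using c(2) by (simp add: h.hom_nat_pow)
    have "nonzerodivisor (B Quot K) (K +>\<^bsub>B\<^esub> (J +> b))"
      using xs(1) len(2) ab(4) take1 unfolding regular_sequence_def Let_def K_def by force
    then have b_reg: "y \<in> K" if "y \<in> carrier B" "(J +> b) \<otimes>\<^bsub>B\<^esub> y \<in> K" for y
      using that unfolding reg_iff[OF K h.hom_closed[OF c(2)]] by blast
    have "\<one>\<^bsub>B\<^esub> \<in> K" if "(J +> b) [^]\<^bsub>B\<^esub> i \<in> K" for i :: nat
      using that
    proof (induction i)
      case (Suc i)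
      have p: "(J +> b) [^]\<^bsub>B\<^esub> i \<in> carrier B" using h.hom_closed[OF c(2)] by (rule B.nat_pow_closed)
      have "(J +> b) \<otimes>\<^bsub>B\<^esub> (J +> b) [^]\<^bsub>B\<^esub> i \<in> K"
        using Suc.prems B.m_comm[OF h.hom_closed[OF c(2)] p] by (simp only: B.nat_pow_Suc)
      then show ?case using Suc.IH b_reg[OF p] by blast
    qed (simp only: B.nat_pow_0)
    from this[OF bK]
    have "K = carrier B" by (rule K.one_imp_carrier)
    moreover have "K \<subseteq> Idl\<^bsub>B\<^esub> (set xs)"
      unfolding K_def using xs(1) len(1) ab(3) unfolding regular_sequence_def
      by (intro B.subset_Idl_subset) (metis empty_subsetI insert_subset nth_mem)+
    moreover have "Idl\<^bsub>B\<^esub> (set xs) \<noteq> carrier B" "Idl\<^bsub>B\<^esub> (set xs) \<subseteq> carrier B"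
      using xs(1) ideal.Icarr[OF B.genideal_ideal] unfolding regular_sequence_def by blast+
    ultimately show False by blast
  qed
  then have "depth B \<le> enat 1"
    unfolding depth_def local(2) by (intro Sup_least) force
  then have "depth B = krull_dim B" using ge dim by simp
  then show ?thesis
    unfolding Cohen_Macaulay_def J_def[symmetric] B_def[symmetric] using noethB local(1) by simp
qed

end

section \<open>Noetherian subrings and the Hilbert basis theorem\<close>

text \<open>The \<open>A\<close>-linear combinations of elements of \<open>F\<close>, for a subring \<open>A\<close> of \<open>R\<close>.\<close>

inductive_set aspan :: "('a, 'm) ring_scheme \<Rightarrow> 'a set \<Rightarrow> 'a set \<Rightarrow> 'a set"
  for R (structure) and A F where
  zero: "\<zero> \<in> aspan R A F"
| step: "a \<in> A \<Longrightarrow> f \<in> F \<Longrightarrow> s \<in> aspan R A F \<Longrightarrow> a \<otimes> f \<oplus> s \<in> aspan R A F"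

definition submod :: "('a, 'm) ring_scheme \<Rightarrow> 'a set \<Rightarrow> 'a set \<Rightarrow> bool" where
  "submod R A J \<longleftrightarrow> \<zero>\<^bsub>R\<^esub> \<in> J \<and> (\<forall>x\<in>J. \<forall>y\<in>J. x \<oplus>\<^bsub>R\<^esub> y \<in> J) \<and> (\<forall>a\<in>A. \<forall>x\<in>J. a \<otimes>\<^bsub>R\<^esub> x \<in> J)"

text \<open>Being Noetherian is stated for subrings of a fixed ring, because the Hilbert basis theorem is used to
  adjoin generators one after the other inside that ring.\<close>

definition noetherian_sub :: "('a, 'm) ring_scheme \<Rightarrow> 'a set \<Rightarrow> bool" where
  "noetherian_sub R A \<longleftrightarrow> subring A R \<and>
     (\<forall>J. J \<subseteq> A \<longrightarrow> submod R A J \<longrightarrow> (\<exists>F. finite F \<and> F \<subseteq> J \<and> J \<subseteq> aspan R A F))"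

lemma submodD:
  assumes "submod R A J"
  shows "\<zero>\<^bsub>R\<^esub> \<in> J" "x \<in> J \<Longrightarrow> y \<in> J \<Longrightarrow> x \<oplus>\<^bsub>R\<^esub> y \<in> J" "a \<in> A \<Longrightarrow> x \<in> J \<Longrightarrow> a \<otimes>\<^bsub>R\<^esub> x \<in> J"
  using assms unfolding submod_def by auto

lemma aspan_subset_submod:
  assumes "submod R A J" "F \<subseteq> J"
  shows "aspan R A F \<subseteq> J"
proof
  fix x assume "x \<in> aspan R A F"
  then show "x \<in> J"
    by induction (use submodD[OF assms(1)] assms(2) in blast)+
qed

context cring
begin

lemma aspan_carrier:
  assumes "A \<subseteq> carrier R" "F \<subseteq> carrier R" "x \<in> aspan R A F"
  shows "x \<in> carrier R"
  using assms(3) by induction (use assms(1,2) in auto)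

lemma submod_aspan:
  assumes A: "subring A R" and F: "F \<subseteq> carrier R"
  shows "submod R A (aspan R A F)"
proof -
  note Ac = subringE(1)[OF A]
  have c: "x \<in> carrier R" if "x \<in> aspan R A F" for x by (rule aspan_carrier[OF Ac F that])
  have add: "x \<oplus> y \<in> aspan R A F" if "x \<in> aspan R A F" "y \<in> aspan R A F" for x y
    using that
  proof induction
    case zero
    then show ?case using c by simp
  next
    case (step a f s)
    then have "a \<otimes> f \<oplus> (s \<oplus> y) \<in> aspan R A F" by (intro aspan.step)
    moreover have "a \<otimes> f \<oplus> (s \<oplus> y) = (a \<otimes> f \<oplus> s) \<oplus> y"
      using step Ac F c by (simp add: a_assoc subsetD)
    ultimately show ?case by simp
  qed
  have mult: "b \<otimes> x \<in> aspan R A F" if "b \<in> A" "x \<in> aspan R A F" for b x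
    using that(2,1)
  proof induction
    case zero
    then show ?case using Ac aspan.zero by (simp add: subsetD)
  next
    case (step a f s)
    then have "(b \<otimes> a) \<otimes> f \<oplus> b \<otimes> s \<in> aspan R A F" using subringE(6)[OF A] by (intro aspan.step) auto
    moreover have "(b \<otimes> a) \<otimes> f \<oplus> b \<otimes> s = b \<otimes> (a \<otimes> f \<oplus> s)"
      using step Ac F c by (simp add: r_distr m_assoc subsetD)
    ultimately show ?case by simp
  qed
  show ?thesis unfolding submod_def using aspan.zero add mult by blast
qed

lemma aspan_self:
  assumes A: "subring A R" and "F \<subseteq> carrier R" "f \<in> F"
  shows "f \<in> aspan R A F"
proof -
  have "\<one> \<otimes> f \<oplus> \<zero> \<in> aspan R A F" by (intro aspan.step aspan.zero subringE(3)[OF A] assms)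
  then show ?thesis using assms by (simp add: subsetD)
qed

lemma noetherian_sub_carrier:
  assumes "noetherian_sub R (carrier R)"
  shows "noetherian_ring R"
proof (rule noetherian_ringI)
  fix J assume J: "ideal J R"
  interpret J: ideal J R by fact
  have "J \<subseteq> carrier R" "submod R (carrier R) J"
    unfolding submod_def using J.Icarr J.I_l_closed by auto
  then obtain F where F: "finite F" "F \<subseteq> J" "J \<subseteq> aspan R (carrier R) F"
    using assms unfolding noetherian_sub_def by blast
  have Fc: "F \<subseteq> carrier R" using F J.Icarr by blast
  interpret G: ideal "Idl F" R by (rule genideal_ideal[OF Fc])
  have "submod R (carrier R) (Idl F)" unfolding submod_def using G.I_l_closed by auto
  then have "aspan R (carrier R) F \<subseteq> Idl F" by (rule aspan_subset_submod[OF _ genideal_self[OF Fc]])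
  moreover have "Idl F \<subseteq> J" by (rule genideal_minimal[OF J F(2)])
  ultimately show "\<exists>A\<subseteq>carrier R. finite A \<and> J = Idl A" using F Fc by blast
qed

text \<open>An ideal of the image is generated by the images of generators of its preimage.\<close>

lemma noetherian_sub_image:
  assumes "noetherian_ring S" and h: "ring_hom_ring S R h"
  shows "noetherian_sub R (h ` carrier S)"
  unfolding noetherian_sub_def
proof (intro conjI allI impI)
  interpret S: noetherian_ring S by fact
  interpret h: ring_hom_ring S R h by fact
  show sub: "subring (h ` carrier S) R" using h.img_is_subring[OF S.carrier_is_subring] .
  fix J assume J: "J \<subseteq> h ` carrier S" "submod R (h ` carrier S) J"
  let ?K = "{s \<in> carrier S. h s \<in> J}"
  have idealI': "ideal {s \<in> carrier S. h s \<in> N} S" if N: "submod R (h ` carrier S) N" for N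
  proof (rule idealI[OF S.ring_axioms], rule S.add.subgroupI)
    show "{s \<in> carrier S. h s \<in> N} \<subseteq> carrier S" by blast
    have "\<zero>\<^bsub>S\<^esub> \<in> {s \<in> carrier S. h s \<in> N}" using submodD(1)[OF N] by simp
    then show "{s \<in> carrier S. h s \<in> N} \<noteq> {}" by blast
    fix a assume a: "a \<in> {s \<in> carrier S. h s \<in> N}"
    have "h (\<ominus>\<^bsub>S\<^esub> \<one>\<^bsub>S\<^esub>) \<in> h ` carrier S" by (rule imageI) simp
    then have "h (\<ominus>\<^bsub>S\<^esub> \<one>\<^bsub>S\<^esub>) \<otimes> h a \<in> N" using a submodD(3)[OF N] by blast
    then have "h (\<ominus>\<^bsub>S\<^esub> \<one>\<^bsub>S\<^esub> \<otimes>\<^bsub>S\<^esub> a) \<in> N" using a by simp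
    moreover have "\<ominus>\<^bsub>S\<^esub> \<one>\<^bsub>S\<^esub> \<otimes>\<^bsub>S\<^esub> a = \<ominus>\<^bsub>S\<^esub> a" using a S.l_minus[of "\<one>\<^bsub>S\<^esub>" a] by simp
    ultimately show "\<ominus>\<^bsub>S\<^esub> a \<in> {s \<in> carrier S. h s \<in> N}" using a by simp
    fix b assume "b \<in> {s \<in> carrier S. h s \<in> N}"
    then show "a \<oplus>\<^bsub>S\<^esub> b \<in> {s \<in> carrier S. h s \<in> N}" using a submodD(2)[OF N] by simp
  next
    fix a x assume a: "a \<in> {s \<in> carrier S. h s \<in> N}" and x: "x \<in> carrier S"
    have "h x \<otimes> h a \<in> N" using a x by (intro submodD(3)[OF N]) auto
    then show "x \<otimes>\<^bsub>S\<^esub> a \<in> {s \<in> carrier S. h s \<in> N}" "a \<otimes>\<^bsub>S\<^esub> x \<in> {s \<in> carrier S. h s \<in> N}"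
      using a x m_comm[of "h x" "h a"] by auto
  qed
  obtain A where A: "A \<subseteq> carrier S" "finite A" "?K = Idl\<^bsub>S\<^esub> A"
    using S.finetely_gen[OF idealI'[OF J(2)]] by blast
  have hA: "h ` A \<subseteq> carrier R" using A(1) by auto
  let ?N = "aspan R (h ` carrier S) (h ` A)"
  have "Idl\<^bsub>S\<^esub> A \<subseteq> {s \<in> carrier S. h s \<in> ?N}"
    by (rule S.genideal_minimal[OF idealI'[OF submod_aspan[OF sub hA]]])
       (use A(1) aspan_self[OF sub hA] in blast)
  then have "J \<subseteq> ?N" using J(1) A(3) by blast
  moreover have "h ` A \<subseteq> J" using S.genideal_self[OF A(1)] A(3) by blast
  ultimately show "\<exists>F. finite F \<and> F \<subseteq> J \<and> J \<subseteq> aspan R (h ` carrier S) F"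
    using A(2) by blast
qed

text \<open>The powers of \<open>b\<close> may be linearly dependent over \<open>A\<close>, so an element can have several degrees and
  leading coefficients. Hilbert's argument does not need them to be unique.\<close>

primrec polys_below :: "'a set \<Rightarrow> 'a \<Rightarrow> nat \<Rightarrow> 'a set" where
  "polys_below A b 0 = {\<zero>}"
| "polys_below A b (Suc d) = {p \<oplus> a \<otimes> b [^] d | p a. p \<in> polys_below A b d \<and> a \<in> A}"

definition adjoin :: "'a set \<Rightarrow> 'a \<Rightarrow> 'a set" where
  "adjoin A b = (\<Union>d. polys_below A b d)"

context
  fixes A b
  assumes A: "subring A R" and b: "b \<in> carrier R"
begin

lemma A_carr: "a \<in> A \<Longrightarrow> a \<in> carrier R"
  using subringE(1)[OF A] by blast

abbreviation "D \<equiv> polys_below A b"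

lemma D_carr: "p \<in> D d \<Longrightarrow> p \<in> carrier R"
  by (induction d arbitrary: p) (use A_carr b in auto)

lemma D_Suc_I: "p \<in> D d \<Longrightarrow> a \<in> A \<Longrightarrow> p \<oplus> a \<otimes> b [^] d \<in> D (Suc d)"
  by auto

lemma D_mono_Suc: "p \<in> D d \<Longrightarrow> p \<in> D (Suc d)"
  using D_Suc_I[of p d \<zero>] subringE(2)[OF A] D_carr[of p d] b by simp

lemma D_mono: "d \<le> e \<Longrightarrow> p \<in> D d \<Longrightarrow> p \<in> D e"
  by (induction rule: dec_induct) (simp_all only: D_mono_Suc)

lemma D_zero: "\<zero> \<in> D d"
  using D_mono[of 0 d \<zero>] by simp

lemma D_add: "p \<in> D d \<Longrightarrow> q \<in> D d \<Longrightarrow> p \<oplus> q \<in> D d"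
proof (induction d arbitrary: p q)
  case (Suc d)
  obtain p' a where p: "p = p' \<oplus> a \<otimes> b [^] d" "p' \<in> D d" "a \<in> A" using Suc.prems by auto
  obtain q' c where q: "q = q' \<oplus> c \<otimes> b [^] d" "q' \<in> D d" "c \<in> A" using Suc.prems by auto
  note cr = D_carr[OF p(2)] D_carr[OF q(2)] A_carr[OF p(3)] A_carr[OF q(3)] nat_pow_closed[OF b, of d]
  have "p \<oplus> q = (p' \<oplus> q') \<oplus> (a \<oplus> c) \<otimes> b [^] d"
    unfolding p(1) q(1) using cr by (simp add: l_distr a_ac)
  then show ?case using D_Suc_I[OF Suc.IH[OF p(2) q(2)] subringE(7)[OF A p(3) q(3)]] by simp
qed simp

lemma D_smult: "p \<in> D d \<Longrightarrow> c \<in> A \<Longrightarrow> c \<otimes> p \<in> D d"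
proof (induction d arbitrary: p)
  case 0
  then show ?case using A_carr by simp
next
  case (Suc d)
  obtain p' a where p: "p = p' \<oplus> a \<otimes> b [^] d" "p' \<in> D d" "a \<in> A" using Suc.prems by auto
  note cr = D_carr[OF p(2)] A_carr[OF p(3)] A_carr[OF Suc.prems(2)] nat_pow_closed[OF b, of d]
  have "c \<otimes> p = c \<otimes> p' \<oplus> (c \<otimes> a) \<otimes> b [^] d"
    unfolding p(1) using cr by (simp add: r_distr m_assoc)
  then show ?case using D_Suc_I[OF Suc.IH[OF p(2) Suc.prems(2)] subringE(6)[OF A Suc.prems(2) p(3)]] by simp
qed

lemma D_shift: "p \<in> D d \<Longrightarrow> b \<otimes> p \<in> D (Suc d)"
proof (induction d arbitrary: p)
  case 0
  then show ?case using D_zero[of 1] b by simp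
next
  case (Suc d)
  obtain p' a where p: "p = p' \<oplus> a \<otimes> b [^] d" "p' \<in> D d" "a \<in> A" using Suc.prems by auto
  note cr = D_carr[OF p(2)] A_carr[OF p(3)] nat_pow_closed[OF b, of d]
  have "b \<otimes> p = b \<otimes> p' \<oplus> a \<otimes> b [^] Suc d"
    unfolding p(1) using cr b by (simp add: r_distr m_ac)
  then show ?case using D_Suc_I[OF Suc.IH[OF p(2)] p(3)] by simp
qed

lemma D_shift_power: "p \<in> D d \<Longrightarrow> b [^] j \<otimes> p \<in> D (d + j)"
proof (induction j)
  case 0
  then show ?case using D_carr by simp
next
  case (Suc j)
  have "b [^] Suc j \<otimes> p = b \<otimes> (b [^] j \<otimes> p)" using b D_carr[OF Suc.prems] by (simp add: m_ac)
  then show ?case using D_shift[OF Suc.IH[OF Suc.prems]] by (simp del: polys_below.simps)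
qed

lemma adjoinI: "p \<in> D d \<Longrightarrow> p \<in> adjoin A b"
  unfolding adjoin_def by blast

lemma adjoinE: "p \<in> adjoin A b \<Longrightarrow> (\<And>d. p \<in> D d \<Longrightarrow> thesis) \<Longrightarrow> thesis"
  unfolding adjoin_def by blast

lemma A_subset_adjoin: "a \<in> A \<Longrightarrow> a \<in> adjoin A b"
  using adjoinI[OF D_Suc_I[of \<zero> 0 a]] A_carr by simp

lemma b_adjoin: "b \<in> adjoin A b"
  using adjoinI[OF D_shift[of \<one> 1]] D_Suc_I[of \<zero> 0 \<one>] subringE(3)[OF A] b
  by (simp del: polys_below.simps(2))

lemma adjoin_add:
  assumes "p \<in> adjoin A b" "q \<in> adjoin A b"
  shows "p \<oplus> q \<in> adjoin A b"
proof -
  obtain d e where d: "p \<in> D d" "q \<in> D e" using assms by (elim adjoinE)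
  then have "p \<in> D (max d e)" "q \<in> D (max d e)" by (auto intro: D_mono[OF max.cobounded1] D_mono[OF max.cobounded2])
  then show ?thesis using D_add adjoinI by blast
qed

lemma adjoin_mult:
  assumes p: "p \<in> adjoin A b" and "q \<in> adjoin A b"
  shows "p \<otimes> q \<in> adjoin A b"
proof -
  obtain d e where d: "p \<in> D d" and e: "q \<in> D e" using assms by (elim adjoinE)
  show ?thesis using e
  proof (induction e arbitrary: q)
    case 0
    then show ?case using D_carr[OF d] D_zero adjoinI by simp
  next
    case (Suc e)
    obtain q' a where q: "q = q' \<oplus> a \<otimes> b [^] e" "q' \<in> D e" "a \<in> A" using Suc.prems by auto
    note cr = D_carr[OF q(2)] A_carr[OF q(3)] D_carr[OF d] nat_pow_closed[OF b, of e]
    have "p \<otimes> q = p \<otimes> q' \<oplus> a \<otimes> (b [^] e \<otimes> p)"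
      unfolding q(1) using cr by (simp add: r_distr m_ac)
    then show ?case using adjoin_add[OF Suc.IH[OF q(2)] adjoinI[OF D_smult[OF D_shift_power[OF d] q(3)]]] by simp
  qed
qed

lemma subring_adjoin: "subring (adjoin A b) R"
proof (rule subringI)
  show "adjoin A b \<subseteq> carrier R" unfolding adjoin_def using D_carr by blast
  show "\<one> \<in> adjoin A b" using A_subset_adjoin subringE(3)[OF A] by blast
  fix p q assume pq: "p \<in> adjoin A b" "q \<in> adjoin A b"
  have pc: "p \<in> carrier R" using pq D_carr by (elim adjoinE)
  have "\<ominus> \<one> \<in> A" using subringE(3,5)[OF A] by blast
  then have "(\<ominus> \<one>) \<otimes> p \<in> adjoin A b" using pq(1) A_subset_adjoin adjoin_mult by blast
  moreover have "(\<ominus> \<one>) \<otimes> p = \<ominus> p" using pc by (simp add: l_minus)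
  ultimately show "\<ominus> p \<in> adjoin A b" by simp
  show "p \<otimes> q \<in> adjoin A b" "p \<oplus> q \<in> adjoin A b" using adjoin_mult adjoin_add pq by blast+
qed

text \<open>Hilbert's argument: the ideals of leading coefficients in degree \<open>d\<close> increase with \<open>d\<close> and
  become stationary at some \<open>N\<close>; finitely many elements whose leading coefficients generate
  these ideals for \<open>d \<le> N\<close> then generate everything, by cancelling leading terms.\<close>

lemma noetherian_sub_adjoin:
  assumes noeth: "noetherian_sub R A"
  shows "noetherian_sub R (adjoin A b)"
  unfolding noetherian_sub_def
proof (intro conjI allI impI subring_adjoin)
  fix J assume J: "J \<subseteq> adjoin A b" "submod R (adjoin A b) J"
  define Ld where "Ld d = {a \<in> A. \<exists>p\<in>D d. p \<oplus> a \<otimes> b [^] d \<in> J}" for d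
  have bpow: "b [^] j \<in> adjoin A b" for j :: nat
    using b_adjoin adjoin_mult A_subset_adjoin subringE(3)[OF A] by (induction j) auto
  have Ld_submod: "submod R A (Ld d)" for d
    unfolding submod_def
  proof (intro conjI ballI)
    have "\<zero> \<oplus> \<zero> \<otimes> b [^] d \<in> J" using submodD(1)[OF J(2)] b by simp
    then show "\<zero> \<in> Ld d" unfolding Ld_def using D_zero subringE(2)[OF A] by blast
  next
    fix x y assume "x \<in> Ld d" "y \<in> Ld d"
    then obtain p q where x: "x \<in> A" "p \<in> D d" "p \<oplus> x \<otimes> b [^] d \<in> J" and y: "y \<in> A" "q \<in> D d" "q \<oplus> y \<otimes> b [^] d \<in> J"
      unfolding Ld_def by blast
    note cr = D_carr[OF x(2)] D_carr[OF y(2)] A_carr[OF x(1)] A_carr[OF y(1)] nat_pow_closed[OF b, of d]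
    have "(p \<oplus> q) \<oplus> (x \<oplus> y) \<otimes> b [^] d = (p \<oplus> x \<otimes> b [^] d) \<oplus> (q \<oplus> y \<otimes> b [^] d)"
      using cr by (simp add: l_distr a_ac)
    then have "(p \<oplus> q) \<oplus> (x \<oplus> y) \<otimes> b [^] d \<in> J" using submodD(2)[OF J(2) x(3) y(3)] by simp
    then show "x \<oplus> y \<in> Ld d" unfolding Ld_def using D_add[OF x(2) y(2)] subringE(7)[OF A x(1) y(1)] by blast
  next
    fix c x assume c: "c \<in> A" and "x \<in> Ld d"
    then obtain p where x: "x \<in> A" "p \<in> D d" "p \<oplus> x \<otimes> b [^] d \<in> J" unfolding Ld_def by blast
    note cr = D_carr[OF x(2)] A_carr[OF x(1)] A_carr[OF c] nat_pow_closed[OF b, of d]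
    have "c \<otimes> p \<oplus> (c \<otimes> x) \<otimes> b [^] d = c \<otimes> (p \<oplus> x \<otimes> b [^] d)"
      using cr by (simp add: r_distr m_assoc)
    then have "c \<otimes> p \<oplus> (c \<otimes> x) \<otimes> b [^] d \<in> J" using submodD(3)[OF J(2) A_subset_adjoin[OF c] x(3)] by simp
    then show "c \<otimes> x \<in> Ld d" unfolding Ld_def using D_smult[OF x(2) c] subringE(6)[OF A c x(1)] by blast
  qed
  have Ld_Suc: "Ld d \<subseteq> Ld (Suc d)" for d
  proof
    fix x assume "x \<in> Ld d"
    then obtain p where x: "x \<in> A" "p \<in> D d" "p \<oplus> x \<otimes> b [^] d \<in> J" unfolding Ld_def by blast
    note cr = D_carr[OF x(2)] A_carr[OF x(1)] nat_pow_closed[OF b, of d]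
    have "b \<otimes> p \<oplus> x \<otimes> b [^] Suc d = b \<otimes> (p \<oplus> x \<otimes> b [^] d)"
      using cr b by (simp add: r_distr m_ac)
    then have "b \<otimes> p \<oplus> x \<otimes> b [^] Suc d \<in> J" using submodD(3)[OF J(2) b_adjoin x(3)] by simp
    then show "x \<in> Ld (Suc d)" unfolding Ld_def using D_shift[OF x(2)] x(1) by blast
  qed
  have Ld_mono: "Ld d \<subseteq> Ld e" if "d \<le> e" for d e
    using lift_Suc_mono_le[of Ld, OF Ld_Suc that] .
  have "submod R A (\<Union>d. Ld d)"
    unfolding submod_def
  proof (intro conjI ballI)
    show "\<zero> \<in> (\<Union>d. Ld d)" using submodD(1)[OF Ld_submod] by blast
    fix x y assume "x \<in> (\<Union>d. Ld d)" "y \<in> (\<Union>d. Ld d)"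
    then obtain d e where "x \<in> Ld d" "y \<in> Ld e" by blast
    then have "x \<in> Ld (max d e)" "y \<in> Ld (max d e)" using Ld_mono[of d "max d e"] Ld_mono[of e "max d e"] by auto
    then show "x \<oplus> y \<in> (\<Union>d. Ld d)" using submodD(2)[OF Ld_submod] by blast
  next
    fix c x assume "c \<in> A" "x \<in> (\<Union>d. Ld d)"
    then show "c \<otimes> x \<in> (\<Union>d. Ld d)" using submodD(3)[OF Ld_submod] by blast
  qed
  moreover have "(\<Union>d. Ld d) \<subseteq> A" unfolding Ld_def by blast
  ultimately obtain F where F: "finite F" "F \<subseteq> (\<Union>d. Ld d)" "(\<Union>d. Ld d) \<subseteq> aspan R A F"
    using noeth unfolding noetherian_sub_def by blast
  have "\<exists>N. F \<subseteq> Ld N" using F(1,2)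
  proof (induction F rule: finite_induct)
    case (insert x F)
    then obtain N d where "F \<subseteq> Ld N" "x \<in> Ld d" by auto
    then have "insert x F \<subseteq> Ld (max N d)" using Ld_mono[of N "max N d"] Ld_mono[of d "max N d"] by auto
    then show ?case by blast
  qed simp
  then obtain N where "F \<subseteq> Ld N" by blast
  then have "aspan R A F \<subseteq> Ld N" by (rule aspan_subset_submod[OF Ld_submod])
  then have stat: "Ld d \<subseteq> Ld N" for d using F(3) by blast
  have "Ld d \<subseteq> A" for d unfolding Ld_def by blast
  then have "\<forall>d. \<exists>F. finite F \<and> F \<subseteq> Ld d \<and> Ld d \<subseteq> aspan R A F"
    using noeth Ld_submod unfolding noetherian_sub_def by simp
  from choice[OF this] obtain G where
    G: "\<And>d. finite (G d)" "\<And>d. G d \<subseteq> Ld d" "\<And>d. Ld d \<subseteq> aspan R A (G d)"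
    by blast
  define q where "q d a = (SOME p. p \<in> D d \<and> p \<oplus> a \<otimes> b [^] d \<in> J)" for d a
  have q: "q d a \<in> D d" "q d a \<oplus> a \<otimes> b [^] d \<in> J" if "a \<in> G d" for d a
  proof -
    have "a \<in> Ld d" using G(2) that by blast
    then have "\<exists>p. p \<in> D d \<and> p \<oplus> a \<otimes> b [^] d \<in> J" unfolding Ld_def by blast
    from someI_ex[OF this] show "q d a \<in> D d" "q d a \<oplus> a \<otimes> b [^] d \<in> J" unfolding q_def by blast+
  qed
  define E where "E = (\<Union>d\<in>{..N}. (\<lambda>a. q d a \<oplus> a \<otimes> b [^] d) ` G d)"
  have E: "finite E" "E \<subseteq> J" unfolding E_def using G(1) q(2) by auto
  have Ec: "E \<subseteq> carrier R" using E(2) J(1) subringE(1)[OF subring_adjoin] by blast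
  let ?T = "aspan R (adjoin A b) E"
  have T: "submod R (adjoin A b) ?T" by (rule submod_aspan[OF subring_adjoin Ec])
  have TJ: "?T \<subseteq> J" by (rule aspan_subset_submod[OF J(2) E(2)])
  have lead: "\<exists>p\<in>D d. p \<oplus> a \<otimes> b [^] d \<in> ?T" if d': "d' \<le> d" "d' \<le> N" and a: "a \<in> aspan R A (G d')" for d d' a
    using a
  proof induction
    case zero
    have "\<zero> \<oplus> \<zero> \<otimes> b [^] d \<in> ?T" using b aspan.zero by simp
    then show ?case using D_zero by blast
  next
    case (step c g s)
    then obtain p where p: "p \<in> D d" "p \<oplus> s \<otimes> b [^] d \<in> ?T" by blast
    have gA: "g \<in> A" using step(2) G(2)[of d'] unfolding Ld_def by blast
    have Gc: "G d' \<subseteq> carrier R" using G(2)[of d'] A_carr unfolding Ld_def by blast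
    have sc: "s \<in> carrier R" using step(3) aspan_carrier[OF subringE(1)[OF A] Gc] by blast
    let ?e = "q d' g \<oplus> g \<otimes> b [^] d'"
    have "?e \<in> E" unfolding E_def using d'(2) step(2) by blast
    then have "(c \<otimes> b [^] (d - d')) \<otimes> ?e \<in> ?T"
      using T aspan_self[OF subring_adjoin Ec] adjoin_mult[OF A_subset_adjoin[OF step(1)] bpow]
      by (intro submodD(3)[OF T]) auto
    then have 1: "(c \<otimes> b [^] (d - d')) \<otimes> ?e \<oplus> (p \<oplus> s \<otimes> b [^] d) \<in> ?T" using p(2) submodD(2)[OF T] by blast
    have qD: "c \<otimes> (b [^] (d - d') \<otimes> q d' g) \<in> D d"
      using D_smult[OF D_shift_power[OF q(1)[OF step(2)]] step(1), of "d - d'"] d' by (simp del: polys_below.simps)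
    have bd: "b [^] d = b [^] (d - d') \<otimes> b [^] d'" using d' b by (simp add: nat_pow_mult)
    have "(c \<otimes> b [^] (d - d')) \<otimes> ?e \<oplus> (p \<oplus> s \<otimes> b [^] d)
      = (c \<otimes> (b [^] (d - d') \<otimes> q d' g) \<oplus> p) \<oplus> (c \<otimes> g \<oplus> s) \<otimes> b [^] d"
      unfolding bd
      using A_carr[OF step(1)] A_carr[OF gA] D_carr[OF p(1)] D_carr[OF q(1)[OF step(2)]] sc
        nat_pow_closed[OF b, of d'] nat_pow_closed[OF b, of "d - d'"]
      by (simp add: l_distr r_distr m_ac a_ac)
    then show ?case using 1 D_add[OF qD p(1)] by auto
  qed
  have "f \<in> ?T" if "f \<in> D d" "f \<in> J" for f d
    using that
  proof (induction d arbitrary: f)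
    case 0
    then show ?case using aspan.zero by simp
  next
    case (Suc d)
    then obtain p a where f: "f = p \<oplus> a \<otimes> b [^] d" "p \<in> D d" "a \<in> A" by auto
    have "a \<in> Ld d" unfolding Ld_def using f Suc.prems by blast
    then have "a \<in> aspan R A (G (min d N))" using stat[of d] G(3) by (cases "d \<le> N") (auto simp: min_def)
    then obtain p' where p': "p' \<in> D d" "p' \<oplus> a \<otimes> b [^] d \<in> ?T" using lead[of "min d N" d a] by auto
    note cr = D_carr[OF f(2)] D_carr[OF p'(1)] A_carr[OF f(3)] nat_pow_closed[OF b, of d]
    have m1: "\<ominus> \<one> \<in> A" using subringE(3,5)[OF A] by blast
    have "p \<oplus> (\<ominus> \<one>) \<otimes> p' \<in> D d" using D_add f(2) D_smult[OF p'(1) m1] by blast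
    moreover have eq: "p \<oplus> (\<ominus> \<one>) \<otimes> p' = f \<oplus> (\<ominus> \<one>) \<otimes> (p' \<oplus> a \<otimes> b [^] d)"
      unfolding f(1) using cr by (simp add: l_minus minus_add a_ac r_neg r_neg1 r_neg2)
    moreover have "f \<oplus> (\<ominus> \<one>) \<otimes> (p' \<oplus> a \<otimes> b [^] d) \<in> J"
      using Suc.prems(2) p'(2) TJ submodD(2,3)[OF J(2)] A_subset_adjoin[OF m1] by blast
    ultimately have "p \<oplus> (\<ominus> \<one>) \<otimes> p' \<in> ?T" using Suc.IH by simp
    then have "(p \<oplus> (\<ominus> \<one>) \<otimes> p') \<oplus> (p' \<oplus> a \<otimes> b [^] d) \<in> ?T" using p'(2) submodD(2)[OF T] by blast
    moreover have "(p \<oplus> (\<ominus> \<one>) \<otimes> p') \<oplus> (p' \<oplus> a \<otimes> b [^] d) = f"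
      unfolding f(1) using cr by (simp add: l_minus a_assoc r_neg1)
    ultimately show ?case by simp
  qed
  then have "J \<subseteq> ?T" using J(1) unfolding adjoin_def by blast
  then show "\<exists>F. finite F \<and> F \<subseteq> J \<and> J \<subseteq> aspan R (adjoin A b) F" using E by blast
qed

end

lemma noetherian_sub_adjoin_finite:
  assumes "noetherian_sub R A" "finite G" "G \<subseteq> carrier R"
  shows "\<exists>A'. noetherian_sub R A' \<and> A \<subseteq> A' \<and> G \<subseteq> A'"
  using assms(2,3)
proof (induction G rule: finite_induct)
  case empty
  then show ?case using assms(1) by blast
next
  case (insert b G)
  then obtain A' where A': "noetherian_sub R A'" "A \<subseteq> A'" "G \<subseteq> A'" by auto
  have s: "subring A' R" "b \<in> carrier R" using A' insert unfolding noetherian_sub_def by auto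
  show ?case
    using noetherian_sub_adjoin[OF s A'(1)] A_subset_adjoin[OF s] b_adjoin[OF s] A'
    by (intro exI[of _ "adjoin A' b"]) blast
qed

end

lemma (in mult_set) noetherian_localization:
  assumes "noetherian_ring R"
  shows "noetherian_ring L"
proof -
  interpret N: noetherian_ring R by fact
  interpret L: cring L by (rule L_cring)
  interpret h: ring_hom_ring R L "loc_map R M"
    by (rule ring_hom_ringI2[OF ring_axioms L.ring_axioms loc_map_hom])
  show ?thesis
  proof (rule L.noetherian_ringI)
    fix J assume J: "ideal J L"
    interpret J: ideal J L by fact
    have "ideal {r \<in> carrier R. loc_map R M r \<in> J} R" by (rule h.ideal_vimage[OF J])
    then obtain A where A: "A \<subseteq> carrier R" "finite A" "{r \<in> carrier R. loc_map R M r \<in> J} = Idl A"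
      using N.finetely_gen by blast
    let ?B = "loc_map R M ` A"
    have B: "?B \<subseteq> carrier L" using A(1) by auto
    interpret G: ideal "Idl\<^bsub>L\<^esub> ?B" L by (rule L.genideal_ideal[OF B])
    have "Idl A \<subseteq> {r \<in> carrier R. loc_map R M r \<in> Idl\<^bsub>L\<^esub> ?B}"
      by (rule genideal_minimal[OF h.ideal_vimage[OF G.is_ideal]]) (use A(1) L.genideal_self[OF B] in blast)
    moreover have "J \<subseteq> Idl\<^bsub>L\<^esub> ?B" if sub: "Idl A \<subseteq> {r \<in> carrier R. loc_map R M r \<in> Idl\<^bsub>L\<^esub> ?B}"
    proof
      fix x assume x: "x \<in> J"
      then obtain r s where r: "x = fraction R M r s" "r \<in> carrier R" "s \<in> M" using J.Icarr L_cases by metis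
      have "loc_map R M s \<otimes>\<^bsub>L\<^esub> x = loc_map R M r"
      proof -
        have "loc_map R M s \<otimes>\<^bsub>L\<^esub> x = fraction R M (s \<otimes> r) (\<one> \<otimes> s)"
          unfolding loc_map_def r(1) using r(2,3) M_one by (simp only: L_mult M_carr)
        also have "\<dots> = fraction R M r \<one>"
          by (rule fraction_eqI) (use r(2,3) M_one in \<open>simp_all add: m_ac\<close>)
        finally show ?thesis unfolding loc_map_def .
      qed
      moreover have "loc_map R M s \<otimes>\<^bsub>L\<^esub> x \<in> J" using x r(3) by (intro J.I_l_closed) auto
      ultimately have "r \<in> Idl A" using A(3) r(2) by auto
      then have "loc_map R M r \<in> Idl\<^bsub>L\<^esub> ?B" using sub by blast
      then show "x \<in> Idl\<^bsub>L\<^esub> ?B"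
        using fraction_split[OF r(2,3)] r G.I_l_closed L_closed[OF one_closed r(3)] by simp
    qed
    moreover have "?B \<subseteq> J" using genideal_self[OF A(1)] A(3) by blast
    then have "Idl\<^bsub>L\<^esub> ?B \<subseteq> J" by (rule L.genideal_minimal[OF J])
    ultimately show "\<exists>A\<subseteq>carrier L. finite A \<and> J = Idl\<^bsub>L\<^esub> A" using B A(2) by blast
  qed
qed

section \<open>Dickson's lemma\<close>

text \<open>Induction on the number of coordinates. Let \<open>F\<close> handle all coordinates but \<open>j\<close>, and let \<open>m\<close> be the largest
  \<open>j\<close>-th coordinate in \<open>F\<close>. Then \<open>F\<close> also handles the vectors with \<open>j\<close>-th coordinate at least \<open>m\<close>, and the
  finitely many smaller values of that coordinate are treated one by one.\<close>

lemma dickson: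
  fixes T :: "('i \<Rightarrow> nat) set"
  assumes "finite I"
  shows "\<exists>F. finite F \<and> F \<subseteq> T \<and> (\<forall>t\<in>T. \<exists>f\<in>F. \<forall>i\<in>I. f i \<le> t i)"
  using assms
proof (induction I arbitrary: T rule: finite_induct)
  case empty
  show ?case
  proof (cases "T = {}")
    case False
    then obtain t where "t \<in> T" by blast
    then show ?thesis by (intro exI[of _ "{t}"]) auto
  qed auto
next
  case (insert j I)
  obtain F where F: "finite F" "F \<subseteq> T" "\<forall>t\<in>T. \<exists>f\<in>F. \<forall>i\<in>I. f i \<le> t i"
    using insert.IH[of T] by blast
  define m where "m = Max (insert 0 ((\<lambda>f. f j) ` F))"
  have m: "f j \<le> m" if "f \<in> F" for f using that F(1) unfolding m_def by (intro Max_ge) auto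
  have "\<forall>c. \<exists>H. finite H \<and> H \<subseteq> {t \<in> T. t j = c} \<and> (\<forall>t\<in>{t \<in> T. t j = c}. \<exists>f\<in>H. \<forall>i\<in>I. f i \<le> t i)"
    using insert.IH by blast
  from choice[OF this] obtain H where H':
    "\<forall>c. finite (H c) \<and> H c \<subseteq> {t \<in> T. t j = c} \<and> (\<forall>t\<in>{t \<in> T. t j = c}. \<exists>f\<in>H c. \<forall>i\<in>I. f i \<le> t i)" by blast
  then have H: "\<And>c. finite (H c)" "\<And>c. H c \<subseteq> {t \<in> T. t j = c}"
    "\<And>c t. t \<in> T \<Longrightarrow> t j = c \<Longrightarrow> \<exists>f\<in>H c. \<forall>i\<in>I. f i \<le> t i" by blast+
  let ?F = "F \<union> (\<Union>c\<in>{..m}. H c)"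
  have "\<exists>f\<in>?F. \<forall>i\<in>insert j I. f i \<le> t i" if t: "t \<in> T" for t
  proof (cases "t j \<le> m")
    case True
    obtain f where f: "f \<in> H (t j)" "\<forall>i\<in>I. f i \<le> t i" using H(3)[OF t refl] by blast
    then have "f j = t j" using H(2) by blast
    then show ?thesis using f True by (intro bexI[of _ f]) auto
  next
    case False
    obtain f where "f \<in> F" "\<forall>i\<in>I. f i \<le> t i" using F(3) t by blast
    then show ?thesis using m[of f] False by (intro bexI[of _ f]) auto
  qed
  moreover have "finite ?F" using F(1) H(1) by simp
  moreover have "?F \<subseteq> T" using F(2) H(2) by blast
  ultimately show ?case by blast
qed

section \<open>The Krull dimension of the polynomial ring\<close>

lemma S_ring_simps [simp]:
  "carrier S_ring = UNIV" "x \<otimes>\<^bsub>S_ring\<^esub> y = x * y" "x \<oplus>\<^bsub>S_ring\<^esub> y = x + y" "\<one>\<^bsub>S_ring\<^esub> = 1" "\<zero>\<^bsub>S_ring\<^esub> = 0"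
  by (simp_all add: S_ring_def ring_of_type_algebra_def)

lemma S_cring: "cring S_ring"
  unfolding S_ring_def by (rule cring_from_type_algebra)

lemma ideal_S:
  assumes "ideal P S_ring"
  shows "0 \<in> P" "x \<in> P \<Longrightarrow> y \<in> P \<Longrightarrow> x + y \<in> P" "x \<in> P \<Longrightarrow> r * x \<in> P"
proof -
  interpret ideal P S_ring by fact
  show "0 \<in> P" using additive_subgroup.zero_closed[OF ideal.axioms(1)[OF assms]] by simp
  show "x \<in> P \<Longrightarrow> y \<in> P \<Longrightarrow> x + y \<in> P" using additive_subgroup.a_closed[OF ideal.axioms(1)[OF assms], of x y] by simp
  show "x \<in> P \<Longrightarrow> r * x \<in> P" using I_l_closed[of x r] by simp
qed

lemma primeideal_S:
  assumes "primeideal P S_ring"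
  shows "x * y \<in> P \<Longrightarrow> x \<in> P \<or> y \<in> P" "1 \<notin> P"
proof -
  interpret primeideal P S_ring by fact
  show "x * y \<in> P \<Longrightarrow> x \<in> P \<or> y \<in> P" using I_prime[of x y] by simp
  show "1 \<notin> P" using one_imp_carrier I_notcarr by auto
qed

interpretation CV: vector_space "\<lambda>c f. cst c * f"
  by standard (simp_all add: is_hom_simps[OF is_hom_cst] algebra_simps)

lemma linear_dependence:
  assumes "finite E" "finite B" "card B < card E" "\<And>e. e \<in> E \<Longrightarrow> m e \<in> CV.span B"
  shows "\<exists>c. (\<exists>e\<in>E. c e \<noteq> 0) \<and> (\<Sum>e\<in>E. cst (c e) * m e) = 0"
proof (cases "inj_on m E")
  case True
  have "CV.dependent (m ` E)"
  proof (rule ccontr)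
    assume "CV.independent (m ` E)"
    then have "card (m ` E) \<le> card B"
      using CV.independent_span_bound[OF assms(2)] assms(4) by blast
    then show False using assms(3) card_image[OF True] by simp
  qed
  then obtain c where "\<exists>v\<in>m ` E. c v \<noteq> 0" "(\<Sum>v\<in>m ` E. cst (c v) * v) = 0"
    using CV.dependent_finite[of "m ` E"] assms(1) by auto
  then show ?thesis by (intro exI[of _ "c \<circ> m"]) (auto simp: sum.reindex[OF True])
next
  case False
  then obtain e e' where e: "e \<in> E" "e' \<in> E" "e \<noteq> e'" "m e = m e'" unfolding inj_on_def by blast
  define c :: "_ \<Rightarrow> complex" where "c x = (if x = e then 1 else if x = e' then - 1 else 0)" for x
  have "(\<Sum>x\<in>E. cst (c x) * m x) = (\<Sum>x\<in>{e, e'}. cst (c x) * m x)"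
    using e assms(1) by (intro sum.mono_neutral_right) (auto simp: c_def is_hom_simps[OF is_hom_cst])
  also have "\<dots> = 0" using e by (simp add: c_def is_hom_simps[OF is_hom_cst])
  finally show ?thesis using e by (intro exI[of _ c]) (auto simp: c_def)
qed

definition box_monomials :: "nat \<Rightarrow> complex poly poly poly set" where
  "box_monomials k = (\<lambda>(i, j, l). varx ^ i * vary ^ j * varz ^ l) ` ({..k} \<times> {..k} \<times> {..k})"

lemma finite_box_monomials: "finite (box_monomials k)"
  by (simp add: box_monomials_def)

lemma card_box_monomials: "card (box_monomials k) \<le> (k + 1) ^ 3"
proof -
  have "card (box_monomials k) \<le> card ({..k} \<times> {..k} \<times> {..k})"
    unfolding box_monomials_def by (rule card_image_le) simp
  then show ?thesis by (simp add: card_cartesian_product power3_eq_cube mult.assoc del: mult_Suc mult_Suc_right)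
qed

lemma box_monomials_mult: "f \<in> box_monomials j \<Longrightarrow> g \<in> box_monomials k \<Longrightarrow> f * g \<in> box_monomials (j + k)"
proof -
  assume "f \<in> box_monomials j" "g \<in> box_monomials k"
  then obtain a b c a' b' c' where f: "f = varx ^ a * vary ^ b * varz ^ c" "a \<le> j" "b \<le> j" "c \<le> j"
    and g: "g = varx ^ a' * vary ^ b' * varz ^ c'" "a' \<le> k" "b' \<le> k" "c' \<le> k" unfolding box_monomials_def by auto
  have "f * g = (\<lambda>(i, j, l). varx ^ i * vary ^ j * varz ^ l) (a + a', b + b', c + c')"
    by (simp add: f g power_add ac_simps)
  then show ?thesis unfolding box_monomials_def by (rule image_eqI) (use f g in auto)
qed

definition bd :: "nat \<Rightarrow> complex poly poly poly set" where "bd k = CV.span (box_monomials k)"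

lemma bd_mult:
  assumes "f \<in> bd j" "g \<in> bd k"
  shows "f * g \<in> bd (j + k)"
proof -
  have sub: "CV.subspace {f. f * h \<in> bd i}" for h i
    unfolding CV.subspace_def bd_def
    by (auto simp: distrib_right mult.assoc CV.span_zero CV.span_add CV.span_scale)
  have sub': "CV.subspace {f. h * f \<in> bd i}" for h i
    using sub by (simp add: mult.commute[of h])
  have m: "m * g \<in> bd (j + k)" if "m \<in> box_monomials j" for m
  proof -
    have "g \<in> CV.span (box_monomials k)" using assms(2) by (simp add: bd_def)
    then show ?thesis
    proof (rule CV.span_induct[where P = "\<lambda>g. m * g \<in> bd (j + k)"])
      show "m * x \<in> bd (j + k)" if "x \<in> box_monomials k" for x
        using box_monomials_mult[OF \<open>m \<in> box_monomials j\<close> that] by (simp add: bd_def CV.span_base)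
    qed (rule sub')
  qed
  have "f \<in> CV.span (box_monomials j)" using assms(1) by (simp add: bd_def)
  then show ?thesis
    by (rule CV.span_induct[where P = "\<lambda>f. f * g \<in> bd (j + k)"]) (rule sub, fact m)
qed

lemma bd_mono: "j \<le> k \<Longrightarrow> bd j \<subseteq> bd k"
  unfolding bd_def box_monomials_def by (intro CV.span_mono image_mono) auto

lemma bd_power: "f \<in> bd k \<Longrightarrow> f ^ j \<in> bd (j * k)"
proof (induction j)
  case 0
  have "(1 :: complex poly poly poly) \<in> box_monomials 0" unfolding box_monomials_def by (rule image_eqI[of _ _ "(0, 0, 0)"]) simp_all
  then show ?case by (simp add: bd_def CV.span_base)
qed (simp add: bd_mult)

lemma ex_bd: "\<exists>k. f \<in> bd k"
proof (induction f rule: S_induct)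
  case (cst c)
  have "(1 :: complex poly poly poly) \<in> box_monomials 0" unfolding box_monomials_def by (rule image_eqI[of _ _ "(0, 0, 0)"]) simp_all
  then have "cst c * 1 \<in> bd 0" unfolding bd_def by (intro CV.span_scale CV.span_base)
  then show ?case by auto
next
  case (add f g)
  then obtain j k where "f \<in> bd j" "g \<in> bd k" by blast
  then have "f \<in> bd (max j k)" "g \<in> bd (max j k)" using bd_mono[of j "max j k"] bd_mono[of k "max j k"] by auto
  then show ?case unfolding bd_def using CV.span_add by blast
next
  case (x f)
  have "(varx :: complex poly poly poly) \<in> box_monomials 1" unfolding box_monomials_def by (rule image_eqI[of _ _ "(1, 0, 0)"]) simp_all
  then have "varx \<in> bd 1" unfolding bd_def by (rule CV.span_base)
  then show ?case using x bd_mult by blast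
next
  case (y f)
  have "(vary :: complex poly poly poly) \<in> box_monomials 1" unfolding box_monomials_def by (rule image_eqI[of _ _ "(0, 1, 0)"]) simp_all
  then have "vary \<in> bd 1" unfolding bd_def by (rule CV.span_base)
  then show ?case using y bd_mult by blast
next
  case (z f)
  have "(varz :: complex poly poly poly) \<in> box_monomials 1" unfolding box_monomials_def by (rule image_eqI[of _ _ "(0, 0, 1)"]) simp_all
  then have "varz \<in> bd 1" unfolding bd_def by (rule CV.span_base)
  then show ?case using z bd_mult by blast
qed

type_synonym exponent = "nat \<times> nat \<times> nat \<times> nat \<times> unit"

text \<open>The products of powers less than \<open>N\<close> of four polynomials are too many to be linearly
  independent, because they lie in a space whose dimension grows like \<open>N\<^sup>3\<close>.\<close>

lemma algebraic_dependence:
  "\<exists>(E :: exponent set) c. finite E \<and> E \<noteq> {} \<and> (\<forall>e\<in>E. c e \<noteq> 0) \<and>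
    (\<Sum>e\<in>E. (case e of (i0, i1, i2, i3, _) \<Rightarrow> x0 ^ i0 * (x1 ^ i1 * (x2 ^ i2 * (x3 ^ i3 * cst (c e)))))) = 0"
proof -
  obtain k0 k1 k2 k3 where "x0 \<in> bd k0" "x1 \<in> bd k1" "x2 \<in> bd k2" "x3 \<in> bd k3" using ex_bd by metis
  then obtain k where k: "x0 \<in> bd k" "x1 \<in> bd k" "x2 \<in> bd k" "x3 \<in> bd k"
    using bd_mono[of k0 "k0 + k1 + k2 + k3"] bd_mono[of k1 "k0 + k1 + k2 + k3"]
      bd_mono[of k2 "k0 + k1 + k2 + k3"] bd_mono[of k3 "k0 + k1 + k2 + k3"] by (meson subsetD trans_le_add1 le_add1 le_add2)
  \<comment> \<open>The products below lie in a space of dimension at most \<open>(4 N k + 1)\<^sup>3 \<le> N\<^sup>3 (4 k + 1)\<^sup>3 < N\<^sup>4\<close>.\<close>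
  define N where "N = (4 * k + 1) ^ 3 + 1"
  define T :: "exponent set" where "T = {..<N} \<times> {..<N} \<times> {..<N} \<times> {..<N} \<times> UNIV"
  define m :: "exponent \<Rightarrow> _" where "m = (\<lambda>(i0, i1, i2, i3, _). x0 ^ i0 * (x1 ^ i1 * (x2 ^ i2 * x3 ^ i3)))"
  have finT: "finite T" unfolding T_def by simp
  have cardT: "card T = N ^ 4" unfolding T_def by (simp add: card_cartesian_product eval_nat_numeral)
  have "card (box_monomials (4 * (N * k))) < card T"
  proof -
    have "card (box_monomials (4 * (N * k))) \<le> (4 * (N * k) + 1) ^ 3" by (rule card_box_monomials)
    also have "\<dots> \<le> (N * (4 * k + 1)) ^ 3"
      by (rule power_mono) (simp_all add: N_def algebra_simps)
    also have "\<dots> < N ^ 3 * N"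
    proof -
      have "(4 * k + 1) ^ 3 < N" by (simp add: N_def)
      moreover have "0 < N ^ 3" by (simp add: N_def)
      ultimately show ?thesis unfolding power_mult_distrib by (rule mult_strict_left_mono)
    qed
    finally show ?thesis using cardT by (simp add: eval_nat_numeral)
  qed
  moreover have "m e \<in> CV.span (box_monomials (4 * (N * k)))" if e: "e \<in> T" for e
  proof -
    obtain i0 i1 i2 i3 where i: "e = (i0, i1, i2, i3, ())" "i0 < N" "i1 < N" "i2 < N" "i3 < N"
      using e unfolding T_def by auto
    have "m e \<in> bd (i0 * k + (i1 * k + (i2 * k + i3 * k)))"
      unfolding m_def i prod.case by (intro bd_mult bd_power k)
    moreover have "i0 * k \<le> N * k" "i1 * k \<le> N * k" "i2 * k \<le> N * k" "i3 * k \<le> N * k"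
      using i by (simp_all add: mult_le_mono1)
    then have "i0 * k + (i1 * k + (i2 * k + i3 * k)) \<le> 4 * (N * k)" by linarith
    ultimately show ?thesis using bd_mono unfolding bd_def[symmetric] by blast
  qed
  ultimately obtain c where c: "\<exists>e\<in>T. c e \<noteq> 0" "(\<Sum>e\<in>T. cst (c e) * m e) = 0"
    using linear_dependence[OF finT finite_box_monomials] by blast
  define E where "E = {e \<in> T. c e \<noteq> 0}"
  have "(\<Sum>e\<in>E. (case e of (i0, i1, i2, i3, _) \<Rightarrow> x0 ^ i0 * (x1 ^ i1 * (x2 ^ i2 * (x3 ^ i3 * cst (c e))))))
    = (\<Sum>e\<in>E. cst (c e) * m e)"
    by (rule sum.cong) (auto simp: m_def ac_simps)
  also have "\<dots> = (\<Sum>e\<in>T. cst (c e) * m e)"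
    using finT by (intro sum.mono_neutral_left) (auto simp: E_def is_hom_zero[OF is_hom_cst])
  finally show ?thesis using c finT by (intro exI[of _ E] exI[of _ c]) (auto simp: E_def)
qed

text \<open>Divide by the lowest power of \<open>x\<close>, which is not in \<open>P\<close>. The remaining multiples of \<open>x\<close> lie in \<open>P'\<close>.\<close>

lemma eliminate_lowest:
  assumes P: "primeideal P S_ring" and P': "ideal P' S_ring" "P \<subseteq> P'" and x: "x \<notin> P" "x \<in> P'"
    and E: "finite E" "E \<noteq> {}" and sum: "(\<Sum>e\<in>E. x ^ fst e * g e) \<in> P"
  shows "\<exists>i. (\<exists>r. (i, r) \<in> E) \<and> (\<Sum>r\<in>{r. (i, r) \<in> E}. g (i, r)) \<in> P'"
proof -
  note idP = primeideal.axioms(1)[OF P]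
  define i where "i = Min (fst ` E)"
  have i: "i \<in> fst ` E" "\<And>e. e \<in> E \<Longrightarrow> i \<le> fst e" unfolding i_def using E by (auto intro: Min_in)
  have "(\<Sum>e\<in>E. x ^ fst e * g e) = x ^ i * (\<Sum>e\<in>E. x ^ (fst e - i) * g e)"
    unfolding sum_distrib_left by (rule sum.cong) (use i(2) in \<open>simp_all add: mult.assoc[symmetric] power_add[symmetric]\<close>)
  then have *: "x ^ i * (\<Sum>e\<in>E. x ^ (fst e - i) * g e) \<in> P" using sum by simp
  have "x ^ j \<notin> P" for j
    using x(1) primeideal_S[OF P] by (induction j) auto
  then have s: "(\<Sum>e\<in>E. x ^ (fst e - i) * g e) \<in> P'" using * primeideal_S(1)[OF P] P'(2) by blast
  define E0 E1 where "E0 = {e \<in> E. fst e = i}" and "E1 = {e \<in> E. fst e \<noteq> i}"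
  have fin: "finite E0" "finite E1" "E = E0 \<union> E1" "E0 \<inter> E1 = {}" using E(1) by (auto simp: E0_def E1_def)
  have "(\<Sum>e\<in>A. x ^ (fst e - i) * g e) \<in> P'" if "finite A" "A \<subseteq> E1" for A
    using that
  proof (induction A rule: finite_induct)
    case (insert e A)
    have "fst e - i \<noteq> 0" using insert i(2)[of e] by (auto simp: E1_def)
    then have "x ^ (fst e - i) * g e = (x ^ (fst e - i - 1) * g e) * x"
      by (cases "fst e - i") (simp_all add: ac_simps)
    then have "x ^ (fst e - i) * g e \<in> P'" using ideal_S(3)[OF P'(1) x(2)] by (simp only:)
    moreover have "(\<Sum>e\<in>A. x ^ (fst e - i) * g e) \<in> P'" using insert by blast
    ultimately show ?case
      unfolding sum.insert[OF insert.hyps(1,2)] by (rule ideal_S(2)[OF P'(1)])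
  qed (simp add: ideal_S[OF P'(1)])
  from this[OF fin(2) subset_refl] have "(\<Sum>e\<in>E1. x ^ (fst e - i) * g e) \<in> P'" .
  then have "(\<Sum>e\<in>E. x ^ (fst e - i) * g e) + (- 1) * (\<Sum>e\<in>E1. x ^ (fst e - i) * g e) \<in> P'"
    using s ideal_S[OF P'(1)] by blast
  also have "(\<Sum>e\<in>E. x ^ (fst e - i) * g e) + (- 1) * (\<Sum>e\<in>E1. x ^ (fst e - i) * g e) = (\<Sum>e\<in>E0. g e)"
    unfolding fin(3) sum.union_disjoint[OF fin(1,2,4)] by (simp add: E0_def)
  also have "(\<Sum>e\<in>E0. g e) = (\<Sum>r\<in>{r. (i, r) \<in> E}. g (i, r))"
    by (rule sum.reindex_bij_witness[of _ "\<lambda>r. (i, r)" snd]) (auto simp: E0_def)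
  finally have "(\<Sum>r\<in>{r. (i, r) \<in> E}. g (i, r)) \<in> P'" .
  moreover have "\<exists>r. (i, r) \<in> E" using i(1) by (metis imageE prod.collapse)
  ultimately show ?thesis by blast
qed

text \<open>Along a chain of primes \<open>P 0 \<subset> \<dots> \<subset> P 4\<close> with \<open>x\<^sub>i \<in> P (i + 1) - P i\<close>, an algebraic relation between
  the \<open>x\<^sub>i\<close> reduces step by step to its lexicographically lowest coefficient, which would have
  to lie in \<open>P 4\<close>.\<close>

theorem no_chain_S: "\<not> prime_chain S_ring {} 4 P"
proof
  assume "prime_chain S_ring {} 4 P"
  then have pr: "primeideal (P i) S_ring" "i < 4 \<Longrightarrow> P i \<subset> P (Suc i)" if "i \<le> 4" for i
    using that unfolding prime_chain_def by auto
  have "\<exists>x. x \<in> P (Suc i) \<and> x \<notin> P i" if "i < 4" for i using pr(2)[of i] that by auto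
  then obtain x where x: "\<And>i. i < 4 \<Longrightarrow> x i \<in> P (Suc i)" "\<And>i. i < 4 \<Longrightarrow> x i \<notin> P i" by metis
  obtain E :: "exponent set" and c where E: "finite E" "E \<noteq> {}" "\<forall>e\<in>E. c e \<noteq> 0"
    and sum: "(\<Sum>e\<in>E. (case e of (i0, i1, i2, i3, _) \<Rightarrow> x 0 ^ i0 * (x 1 ^ i1 * (x 2 ^ i2 * (x 3 ^ i3 * cst (c e)))))) = 0"
    using algebraic_dependence[of "x 0" "x 1" "x 2" "x 3"] by blast
  have elim: "\<exists>i. (\<exists>r. (i, r) \<in> E) \<and> (\<Sum>r\<in>{r. (i, r) \<in> E}. g (i, r)) \<in> P (Suc j)"
    if "j < 4" "finite E" "E \<noteq> {}" "(\<Sum>e\<in>E. x j ^ fst e * g e) \<in> P j" for j and E :: "(nat \<times> 'b) set" and g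
    using that x[of j] pr[of j] pr[of "Suc j"] primeideal.axioms(1)
    by (intro eliminate_lowest[of "P j" "P (Suc j)" "x j"]) auto
  have fin: "finite {r. (i, r) \<in> E}" if "finite E" for i and E :: "(nat \<times> 'b) set"
    using finite_vimageI[OF that, of "Pair i"] by (simp add: vimage_def inj_on_def)
  have "0 \<in> P 0" using ideal_S(1) primeideal.axioms(1) pr(1)[of 0] by blast
  then have "(\<Sum>e\<in>E. x 0 ^ fst e * (case e of (i0, i1, i2, i3, _) \<Rightarrow> x 1 ^ i1 * (x 2 ^ i2 * (x 3 ^ i3 * cst (c e))))) \<in> P 0"
    using sum by (simp add: case_prod_beta)
  from elim[OF _ E(1,2) this] obtain i0 where i0: "\<exists>r. (i0, r) \<in> E"
    and s0: "(\<Sum>r\<in>{r. (i0, r) \<in> E}. x 1 ^ fst r * (case r of (i1, i2, i3, _) \<Rightarrow> x 2 ^ i2 * (x 3 ^ i3 * cst (c (i0, r))))) \<in> P 1"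
    by (auto simp: case_prod_beta)
  define E1 where "E1 = {r. (i0, r) \<in> E}"
  have E1: "finite E1" "E1 \<noteq> {}" using fin[OF E(1)] i0 by (auto simp: E1_def)
  from elim[OF _ E1 s0[folded E1_def]] obtain i1 where i1: "\<exists>r. (i1, r) \<in> E1"
    and s1: "(\<Sum>r\<in>{r. (i1, r) \<in> E1}. x 2 ^ fst r * (case r of (i2, i3, _) \<Rightarrow> x 3 ^ i3 * cst (c (i0, i1, r)))) \<in> P 2"
    by (auto simp: case_prod_beta numeral_2_eq_2)
  define E2 where "E2 = {r. (i1, r) \<in> E1}"
  have E2: "finite E2" "E2 \<noteq> {}" using fin[OF E1(1)] i1 by (auto simp: E2_def)
  from elim[OF _ E2 s1[folded E2_def]] obtain i2 where i2: "\<exists>r. (i2, r) \<in> E2"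
    and s2: "(\<Sum>r\<in>{r. (i2, r) \<in> E2}. x 3 ^ fst r * cst (c (i0, i1, i2, r))) \<in> P 3"
    by (auto simp: case_prod_beta eval_nat_numeral)
  define E3 where "E3 = {r. (i2, r) \<in> E2}"
  have E3: "finite E3" "E3 \<noteq> {}" using fin[OF E2(1)] i2 by (auto simp: E3_def)
  from elim[OF _ E3 s2[folded E3_def]] obtain i3 where i3: "\<exists>r. (i3, r) \<in> E3"
    and s3: "(\<Sum>r\<in>{r. (i3, r) \<in> E3}. cst (c (i0, i1, i2, i3, r))) \<in> P 4"
    by (auto simp: eval_nat_numeral)
  have mem: "(i0, i1, i2, i3, ()) \<in> E" using i3 by (auto simp: E3_def E2_def E1_def)
  have "{r. (i3, r) \<in> E3} = {()}" using i3 by auto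
  then have "cst (c (i0, i1, i2, i3, ())) \<in> P 4" using s3 by simp
  then have "cst (1 / c (i0, i1, i2, i3, ())) * cst (c (i0, i1, i2, i3, ())) \<in> P 4"
    using ideal_S(3) primeideal.axioms(1) pr(1)[of 4] by blast
  moreover have "cst (1 / c (i0, i1, i2, i3, ())) * cst (c (i0, i1, i2, i3, ())) = 1"
    using E(3) mem by (simp add: cst_def one_pCons)
  ultimately show False using primeideal_S(2)[OF pr(1)[of 4]] by simp
qed

section \<open>Rees algebras of filtrations\<close>

locale ideal_filtration = cring R for R (structure) +
  fixes F :: "nat \<Rightarrow> 'a set"
  assumes F_ideal: "ideal (F k) R" and F_0: "F 0 = carrier R"
    and F_mult: "r \<in> F j \<Longrightarrow> s \<in> F k \<Longrightarrow> r \<otimes> s \<in> F (j + k)"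
begin

abbreviation "RX \<equiv> UP R"
abbreviation "cof \<equiv> up_ring.coeff RX"
abbreviation "mnm \<equiv> up_ring.monom RX"

sublocale P: UP_cring R "UP R"
  by (simp add: UP_cring_def is_cring)

definition H where "H = {f \<in> carrier RX. \<forall>k. cof f k \<in> F k}"

lemma rees_eq: "rees_of_filtration R F = RX\<lparr>carrier := H\<rparr>"
  by (simp add: rees_of_filtration_def H_def)

lemma F_carrier: "r \<in> F k \<Longrightarrow> r \<in> carrier R"
  using ideal.Icarr[OF F_ideal] .

lemma F_zero: "\<zero> \<in> F k"
  by (rule additive_subgroup.zero_closed[OF ideal.axioms(1)[OF F_ideal]])

lemma F_add: "r \<in> F k \<Longrightarrow> s \<in> F k \<Longrightarrow> r \<oplus> s \<in> F k"
  by (rule additive_subgroup.a_closed[OF ideal.axioms(1)[OF F_ideal]])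

lemma F_finsum: "finite A \<Longrightarrow> (\<And>i. i \<in> A \<Longrightarrow> f i \<in> F k) \<Longrightarrow> (\<Oplus>i\<in>A. f i) \<in> F k"
proof (induction A rule: finite_induct)
  case (insert i A)
  then have "f \<in> A \<rightarrow> carrier R" "f i \<in> carrier R" using F_carrier by blast+
  then show ?case using insert F_add by simp
qed (simp add: F_zero)

lemma mnm_H: "r \<in> F k \<Longrightarrow> mnm r k \<in> H"
  unfolding H_def using F_carrier F_zero by auto

lemma subring_H: "subring H RX"
proof (rule P.P.subringI)
  show "H \<subseteq> carrier RX" unfolding H_def by blast
  show "\<one>\<^bsub>RX\<^esub> \<in> H" unfolding H_def using F_0 F_zero by auto
  fix p q assume pq: "p \<in> H" "q \<in> H"
  then show "\<ominus>\<^bsub>RX\<^esub> p \<in> H"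
    unfolding H_def using additive_subgroup.a_inv_closed[OF ideal.axioms(1)[OF F_ideal]] by auto
  show "p \<oplus>\<^bsub>RX\<^esub> q \<in> H" using pq F_add unfolding H_def by auto
  have "cof p i \<otimes> cof q (k - i) \<in> F k" if "i \<le> k" for i k
    using F_mult[of "cof p i" i "cof q (k - i)" "k - i"] pq that unfolding H_def by auto
  then have "(\<Oplus>i\<in>{..k}. cof p i \<otimes> cof q (k - i)) \<in> F k" for k by (intro F_finsum) auto
  then show "p \<otimes>\<^bsub>RX\<^esub> q \<in> H" using pq unfolding H_def by auto
qed

lemma rees_cring: "cring (rees_of_filtration R F)"
  unfolding rees_eq using P.P.subcring_iff P.P.subcringI'[OF subring_H] subring_H
  by (metis subringE(1))

text \<open>A Rees algebra is generated as a ring by its homogeneous elements.\<close>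

lemma subring_rees_eq:
  assumes A: "subring A (rees_of_filtration R F)" and gens: "\<And>r k. r \<in> F k \<Longrightarrow> mnm r k \<in> A"
  shows "A = carrier (rees_of_filtration R F)"
proof
  show "A \<subseteq> carrier (rees_of_filtration R F)" using subringE(1)[OF A] .
  have AH: "A \<subseteq> H" using subringE(1)[OF A] unfolding rees_eq by simp
  have Ac: "A \<subseteq> carrier RX" using AH unfolding H_def by blast
  have zero: "\<zero>\<^bsub>RX\<^esub> \<in> A" using subringE(2)[OF A] unfolding rees_eq by simp
  have add: "p \<oplus>\<^bsub>RX\<^esub> q \<in> A" if "p \<in> A" "q \<in> A" for p q using subringE(7)[OF A that] unfolding rees_eq by simp
  have fs: "(\<Oplus>\<^bsub>RX\<^esub>i\<in>I. f i) \<in> A" if "finite I" "\<And>i. i \<in> I \<Longrightarrow> f i \<in> A" for I :: "nat set" and f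
    using that
  proof (induction I rule: finite_induct)
    case (insert i I)
    then have "f \<in> I \<rightarrow> carrier RX" "f i \<in> carrier RX" using Ac by blast+
    then show ?case using insert add by simp
  qed (simp add: zero)
  show "carrier (rees_of_filtration R F) \<subseteq> A"
  proof
    fix p assume "p \<in> carrier (rees_of_filtration R F)"
    then have p: "p \<in> carrier RX" "\<And>k. cof p k \<in> F k" unfolding rees_eq H_def by auto
    have "(\<Oplus>\<^bsub>RX\<^esub>i\<in>{..deg R p}. mnm (cof p i) i) \<in> A" using gens p(2) by (intro fs) auto
    then show "p \<in> A" using P.up_repr[OF p(1)] by simp
  qed
qed

lemma const_hom: "(\<lambda>r. mnm r 0) \<in> ring_hom R (rees_of_filtration R F)"
  unfolding rees_eq
proof (rule ring_hom_memI)
  show "r \<in> carrier R \<Longrightarrow> mnm r 0 \<in> carrier (RX\<lparr>carrier := H\<rparr>)" for r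
    using mnm_H[of r 0] F_0 by simp
  show "r \<in> carrier R \<Longrightarrow> s \<in> carrier R \<Longrightarrow> mnm (r \<otimes> s) 0 = mnm r 0 \<otimes>\<^bsub>RX\<lparr>carrier := H\<rparr>\<^esub> mnm s 0" for r s
    using P.monom_mult[of r s 0 0] by simp
qed simp_all

end

section \<open>The local ring at the origin\<close>

lemma ideal_S_I:
  assumes "0 \<in> K" "\<And>x y. x \<in> K \<Longrightarrow> y \<in> K \<Longrightarrow> x + y \<in> K" "\<And>r x. x \<in> K \<Longrightarrow> r * x \<in> K"
  shows "ideal K S_ring"
proof -
  interpret S: cring S_ring by (rule S_cring)
  have uminus: "\<ominus>\<^bsub>S_ring\<^esub> x = - x" for x
    using S.minus_equality[of "- x" x] by simp
  show ?thesis
  proof (rule idealI[OF S.ring_axioms], rule S.add.subgroupI)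
    show "\<ominus>\<^bsub>S_ring\<^esub> a \<in> K" if "a \<in> K" for a
      using assms(3)[OF that, of "- 1"] by (simp add: uminus)
  qed (use assms in \<open>auto simp: mult.commute\<close>)
qed

lemma primeideal_S_kernel:
  fixes h :: "complex poly poly poly \<Rightarrow> 'b::idom"
  assumes h: "is_hom h"
  shows "primeideal {f. h f = 0} S_ring"
proof (rule primeidealI[OF _ S_cring])
  show "ideal {f. h f = 0} S_ring" by (rule ideal_S_I) (simp_all add: is_hom_simps[OF h])
  have "1 \<notin> {f. h f = 0}" by (simp add: is_hom_one[OF h])
  then show "carrier S_ring \<noteq> {f. h f = 0}" by auto
qed (simp add: is_hom_mult[OF h])

lemma S_max_eq: "S_max = {f. at0 f = 0}"
proof
  interpret S: cring S_ring by (rule S_cring)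
  have id: "ideal S_max S_ring" unfolding S_max_def by (rule S.genideal_ideal) simp
  have gens: "varx \<in> S_max" "vary \<in> S_max" "varz \<in> S_max"
    unfolding S_max_def using S.genideal_self[of "{varx, vary, varz}"] by auto
  show "S_max \<subseteq> {f. at0 f = 0}"
    unfolding S_max_def
    by (rule S.genideal_minimal[OF primeideal.axioms(1)[OF primeideal_S_kernel[OF is_hom_at0]]])
       (simp add: at0_gens)
  show "{f. at0 f = 0} \<subseteq> S_max"
  proof clarify
    fix f assume "at0 f = 0"
    moreover have "ev cst 0 0 0 f = cst (at0 f)"
      by (rule hom_eqI[OF is_hom_ev[OF is_hom_cst] is_hom_comp[OF is_hom_cst is_hom_at0]])
         (simp_all add: ev_gens[OF is_hom_cst] at0_gens is_hom_zero[OF is_hom_cst])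
    moreover have "f - ev cst 0 0 0 f \<in> S_max"
      by (rule ev_cong_ideal) (simp_all add: ideal_S[OF id] gens)
    ultimately show "f \<in> S_max" by (simp add: is_hom_zero[OF is_hom_cst])
  qed
qed

lemma primeideal_S_max: "primeideal S_max S_ring"
  unfolding S_max_eq by (rule primeideal_S_kernel[OF is_hom_at0])

interpretation Sm: mult_set S_ring "carrier S_ring - S_max"
  by (rule cring.mult_set_prime[OF S_cring primeideal_S_max])

text \<open>The fraction \<open>f/s\<close> as an element of the local ring.\<close>

definition fr :: "complex poly poly poly \<Rightarrow> complex poly poly poly \<Rightarrow>
    (complex poly poly poly \<times> complex poly poly poly) set" where
  "fr f s = fraction S_ring (carrier S_ring - S_max) f s"

lemma R_ring_eq: "R_ring = Sm.L"
  by (simp add: R_ring_def loc_at_def)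

lemma mem_M: "s \<in> carrier S_ring - S_max \<longleftrightarrow> at0 s \<noteq> 0"
  by (simp add: S_max_eq)

lemma at0_nz: "at0 t \<noteq> 0 \<Longrightarrow> t \<noteq> 0"
  using at0_simps(1) by auto

lemma fr_eq_iff: "at0 s \<noteq> 0 \<Longrightarrow> at0 t \<noteq> 0 \<Longrightarrow> fr f s = fr g t \<longleftrightarrow> f * t = g * s"
proof -
  assume s: "at0 s \<noteq> 0" "at0 t \<noteq> 0"
  have "fr f s = fr g t \<longleftrightarrow> (\<exists>h\<in>carrier S_ring - S_max. h * (f * t) = h * (g * s))"
    unfolding fr_def using Sm.fraction_eq_iff[of f s g t] s by (simp add: S_max_eq)
  also have "\<dots> \<longleftrightarrow> f * t = g * s"
  proof
    show "\<exists>h\<in>carrier S_ring - S_max. h * (f * t) = h * (g * s) \<Longrightarrow> f * t = g * s"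
      using at0_nz unfolding mem_M by (metis mem_M mult_cancel_left)
    show "f * t = g * s \<Longrightarrow> \<exists>h\<in>carrier S_ring - S_max. h * (f * t) = h * (g * s)"
      using s by (intro bexI[of _ s]) (simp_all add: mem_M S_max_eq)
  qed
  finally show ?thesis .
qed

lemma R_cring: "cring R_ring"
  unfolding R_ring_eq by (rule Sm.L_cring)

interpretation R: cring R_ring by (rule R_cring)

lemma fr_closed [simp]: "at0 s \<noteq> 0 \<Longrightarrow> fr f s \<in> carrier R_ring"
  unfolding R_ring_eq fr_def by (rule Sm.L_closed) (simp_all add: S_max_eq)

lemma R_cases:
  assumes "a \<in> carrier R_ring"
  obtains f s where "a = fr f s" "at0 s \<noteq> 0"
  using assms unfolding R_ring_eq fr_def by (elim Sm.L_cases) (simp add: S_max_eq)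

lemma fr_mult: "at0 s \<noteq> 0 \<Longrightarrow> at0 t \<noteq> 0 \<Longrightarrow> fr f s \<otimes>\<^bsub>R_ring\<^esub> fr g t = fr (f * g) (s * t)"
  unfolding R_ring_eq fr_def by (subst Sm.L_mult) (simp_all add: S_max_eq)

lemma fr_add: "at0 s \<noteq> 0 \<Longrightarrow> at0 t \<noteq> 0 \<Longrightarrow> fr f s \<oplus>\<^bsub>R_ring\<^esub> fr g t = fr (f * t + g * s) (s * t)"
  unfolding R_ring_eq fr_def by (subst Sm.L_add) (simp_all add: S_max_eq)

lemma fr_one: "\<one>\<^bsub>R_ring\<^esub> = fr 1 1" and fr_zero: "\<zero>\<^bsub>R_ring\<^esub> = fr 0 1"
  unfolding R_ring_eq fr_def Sm.L_one Sm.L_zero by (simp_all only: S_ring_simps)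

lemma at0_1 [simp]: "at0 1 = 1"
  by (rule at0_simps)

lemma at0_mult [simp]: "at0 (f * g) = at0 f * at0 g"
  by (rule at0_simps)

lemma at0_power [simp]: "at0 (f ^ k) = at0 f ^ k"
  by (rule at0_simps)

lemma fr_add_same: "at0 s \<noteq> 0 \<Longrightarrow> fr f s \<oplus>\<^bsub>R_ring\<^esub> fr g s = fr (f + g) s"
  by (simp add: fr_add fr_eq_iff algebra_simps)

lemma fr_uminus: "at0 s \<noteq> 0 \<Longrightarrow> \<ominus>\<^bsub>R_ring\<^esub> fr f s = fr (- f) s"
  by (rule R.minus_equality) (simp_all add: fr_add_same fr_zero fr_eq_iff)

lemma fr_minus: "at0 s \<noteq> 0 \<Longrightarrow> at0 t \<noteq> 0 \<Longrightarrow> fr f s \<ominus>\<^bsub>R_ring\<^esub> fr g t = fr (f * t - g * s) (s * t)"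
  unfolding R.minus_eq by (simp add: fr_uminus fr_add)

lemma fr_pow: "at0 s \<noteq> 0 \<Longrightarrow> fr f s [^]\<^bsub>R_ring\<^esub> (k::nat) = fr (f ^ k) (s ^ k)"
  by (induction k) (simp_all add: fr_one fr_mult mult.commute)

text \<open>The extension to the local ring of an ideal of the polynomial ring.\<close>

definition ext_R where "ext_R K = Sm.ext K"

lemma E_eq: "ext_R K = {fr f s | f s. f \<in> K \<and> at0 s \<noteq> 0}"
  unfolding ext_R_def Sm.ext_def fr_def mem_M by blast

lemma ideal_E: "ideal K S_ring \<Longrightarrow> ideal (ext_R K) R_ring"
  unfolding R_ring_eq ext_R_def by (rule Sm.ext_ideal)

lemma fr_mem_E: "ideal K S_ring \<Longrightarrow> at0 s \<noteq> 0 \<Longrightarrow> fr f s \<in> ext_R K \<longleftrightarrow> (\<exists>t. at0 t \<noteq> 0 \<and> t * f \<in> K)"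
  unfolding fr_def ext_R_def using Sm.fraction_mem_ext[of K f s] by (auto simp: S_max_eq)

lemma extend_eq: "ideal K S_ring \<Longrightarrow> extend_loc S_ring S_max K = ext_R K"
  unfolding extend_loc_def loc_at_def ext_R_def by (rule Sm.Idl_image_eq_ext)

lemma fr_mem_E_prime:
  assumes "primeideal K S_ring" "K \<subseteq> S_max" "at0 s \<noteq> 0"
  shows "fr f s \<in> ext_R K \<longleftrightarrow> f \<in> K"
proof -
  note K = primeideal.axioms(1)[OF assms(1)]
  have "(\<exists>t. at0 t \<noteq> 0 \<and> t * f \<in> K) \<longleftrightarrow> f \<in> K"
    using primeideal_S(1)[OF assms(1)] assms(2) ideal_S(3)[OF K] unfolding S_max_eq
    by (metis (mono_tags) at0_1 mem_Collect_eq mult_1 subsetD zero_neq_one)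
  then show ?thesis using fr_mem_E[OF K assms(3)] by simp
qed

lemma primeideal_E:
  assumes P: "primeideal K S_ring" and K: "K \<subseteq> S_max"
  shows "primeideal (ext_R K) R_ring"
proof (rule primeidealI[OF ideal_E[OF primeideal.axioms(1)[OF P]] R_cring])
  have "\<one>\<^bsub>R_ring\<^esub> \<notin> ext_R K" using fr_mem_E_prime[OF P K, of 1 1] primeideal_S(2)[OF P] by (simp add: fr_one)
  then show "carrier R_ring \<noteq> ext_R K" by blast
  fix a b assume "a \<in> carrier R_ring" "b \<in> carrier R_ring" "a \<otimes>\<^bsub>R_ring\<^esub> b \<in> ext_R K"
  then show "a \<in> ext_R K \<or> b \<in> ext_R K"
    by (elim R_cases) (use primeideal_S(1)[OF P] in \<open>auto simp: fr_mult fr_mem_E_prime[OF P K]\<close>)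
qed

definition "mR = ext_R S_max"

lemma fr_mem_mR: "at0 s \<noteq> 0 \<Longrightarrow> fr f s \<in> mR \<longleftrightarrow> at0 f = 0"
  unfolding mR_def by (subst fr_mem_E_prime[OF primeideal_S_max]) (simp_all add: S_max_eq)

lemma mR_ideal: "ideal mR R_ring"
  unfolding mR_def by (rule ideal_E[OF primeideal.axioms(1)[OF primeideal_S_max]])

lemma mR_proper: "mR \<noteq> carrier R_ring"
proof -
  have "fr 1 1 \<notin> mR" "fr 1 1 \<in> carrier R_ring" by (simp_all add: fr_mem_mR)
  then show ?thesis by blast
qed

lemma R_units: "a \<in> carrier R_ring \<Longrightarrow> a \<notin> mR \<Longrightarrow> a \<in> Units R_ring"
proof -
  assume "a \<in> carrier R_ring" "a \<notin> mR"
  then obtain f s where a: "a = fr f s" "at0 s \<noteq> 0" "at0 f \<noteq> 0" by (elim R_cases) (auto simp: fr_mem_mR)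
  then have "fr s f \<in> carrier R_ring" "fr s f \<otimes>\<^bsub>R_ring\<^esub> a = \<one>\<^bsub>R_ring\<^esub>" "a \<otimes>\<^bsub>R_ring\<^esub> fr s f = \<one>\<^bsub>R_ring\<^esub>"
    by (simp_all add: fr_mult fr_one fr_eq_iff mult.commute)
  then show ?thesis unfolding Units_def using a by auto
qed

lemma R_local: "local_ring R_ring" "max_ideal R_ring = mR" "maximalideal mR R_ring"
  using local_ringI[OF R_cring mR_ideal mR_proper R_units] by blast+

lemma noetherian_S: "noetherian_ring S_ring"
proof -
  define Cr :: "complex ring" where "Cr = ring_of_type_algebra"
  have "field Cr" unfolding Cr_def by (rule field_from_type_algebra)
  then interpret Cr: field Cr .
  have nC: "noetherian_ring Cr"
  proof (rule Cr.noetherian_ringI)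
    fix I assume "ideal I Cr"
    then have "I = {\<zero>\<^bsub>Cr\<^esub>} \<or> I = carrier Cr" using Cr.all_ideals by blast
    then show "\<exists>A\<subseteq>carrier Cr. finite A \<and> I = Idl\<^bsub>Cr\<^esub> A"
      using Cr.genideal_zero Cr.genideal_one by (metis Cr.one_closed Cr.zero_closed empty_subsetI finite.emptyI finite.insertI insert_subset)
  qed
  have "cst \<in> ring_hom Cr S_ring"
    by (rule ring_hom_memI) (simp_all add: Cr_def ring_of_type_algebra_def is_hom_simps[OF is_hom_cst])
  then have "ring_hom_ring Cr S_ring cst"
    by (rule ring_hom_ringI2[OF Cr.ring_axioms Sm.ring_axioms])
  then have "noetherian_sub S_ring (cst ` carrier Cr)" by (rule Sm.noetherian_sub_image[OF nC])
  then obtain A where A: "noetherian_sub S_ring A" "cst ` carrier Cr \<subseteq> A" "{varx, vary, varz} \<subseteq> A"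
    using Sm.noetherian_sub_adjoin_finite[of "cst ` carrier Cr" "{varx, vary, varz}"] by auto
  have sub: "subring A S_ring" using A(1) unfolding noetherian_sub_def by blast
  have "f \<in> A" for f
  proof (induction f rule: S_induct)
    case (cst c)
    then show ?case using A(2) by (auto simp: Cr_def ring_of_type_algebra_def)
  qed (use A(3) subringE(6,7)[OF sub] in auto)
  then have "A = carrier S_ring" by auto
  then show ?thesis using Sm.noetherian_sub_carrier A(1) by simp
qed

lemma noetherian_R: "noetherian_ring R_ring"
  unfolding R_ring_eq by (rule Sm.noetherian_localization[OF noetherian_S])

context fermat
begin

lemma ideal_Jp: "ideal (Jp k) S_ring"
  by (rule ideal_S_I) (simp_all add: Jp_add Jp_lmult)

lemma fermat_ideal_eq: "fermat_ideal n = Jp 1"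
proof
  have g: "fermat_ideal n = Idl\<^bsub>S_ring\<^esub> {f1, f2, f3}"
    unfolding fermat_ideal_def f1_def f2_def f3_def u_def v_def w_def by simp
  show "fermat_ideal n \<subseteq> Jp 1"
    unfolding g by (rule Sm.genideal_minimal[OF ideal_Jp]) (use f_Jp in blast)
  have id: "ideal (fermat_ideal n) S_ring" unfolding g by (rule Sm.genideal_ideal) simp
  have gens: "f1 \<in> fermat_ideal n" "f2 \<in> fermat_ideal n" "f3 \<in> fermat_ideal n"
    unfolding g using Sm.genideal_self[of "{f1, f2, f3}"] by auto
  show "Jp 1 \<subseteq> fermat_ideal n"
  proof
    fix f assume "f \<in> Jp 1"
    then obtain p q r where "f = p * f1 + q * f2 + r * f3" by (auto simp: mult.commute)
    then show "f \<in> fermat_ideal n" using ideal_S[OF id] gens by simp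
  qed
qed

abbreviation "I \<equiv> local_fermat_ideal n"

lemma I_eq: "I = ext_R (Jp 1)"
  unfolding local_fermat_ideal_def fermat_ideal_eq by (rule extend_eq[OF ideal_Jp])

lemma ideal_I: "ideal I R_ring"
  unfolding I_eq by (rule ideal_E[OF ideal_Jp])

lemma ideal_power_I: "ideal_power R_ring I k = ext_R (Jp k)"
proof (induction k)
  case 0
  show ?case unfolding R.ideal_power_0 unfolding E_eq by (auto elim: R_cases)
next
  case (Suc k)
  interpret K: ideal "ext_R (Jp (Suc k))" R_ring by (rule ideal_E[OF ideal_Jp])
  interpret K': ideal "ext_R (Jp k) \<cdot>\<^bsub>R_ring\<^esub> I" R_ring
    by (rule R.ideal_prod_is_ideal[OF ideal_E[OF ideal_Jp] ideal_I])
  have "a \<in> ext_R (Jp (Suc k))" if "a \<in> ext_R (Jp k) \<cdot>\<^bsub>R_ring\<^esub> I" for a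
    using that
  proof induction
    case (prod i j)
    then obtain f s g t where f: "i = fr f s" "f \<in> Jp k" "at0 s \<noteq> 0" and g: "j = fr g t" "g \<in> Jp 1" "at0 t \<noteq> 0"
      unfolding I_eq E_eq by blast
    have "f * g \<in> Jp (k + 1)" using Jp_mult[OF f(2) g(2)] .
    then have fg: "f * g \<in> Jp (Suc k)" by (simp del: Jp.simps)
    have "i \<otimes>\<^bsub>R_ring\<^esub> j = fr (f * g) (s * t)" using f(1,3) g(1,3) by (simp add: fr_mult)
    moreover have "at0 (s * t) \<noteq> 0" using f g by simp
    ultimately show ?case unfolding E_eq using fg by blast
  next
    case (sum a b)
    then show ?case by (intro K.a_closed)
  qed
  moreover have "a \<in> ext_R (Jp k) \<cdot>\<^bsub>R_ring\<^esub> I" if a': "a \<in> ext_R (Jp (Suc k))" for a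
  proof -
    obtain p q r s where a: "a = fr (f1 * p + f2 * q + f3 * r) s" "p \<in> Jp k" "q \<in> Jp k" "r \<in> Jp k" "at0 s \<noteq> 0"
      using a' unfolding E_eq by auto
    have m: "fr (g * p) s \<in> ext_R (Jp k) \<cdot>\<^bsub>R_ring\<^esub> I" if "p \<in> Jp k" "g \<in> Jp 1" for g p
    proof -
      have "fr p s \<in> ext_R (Jp k)" "fr g 1 \<in> I"
        unfolding I_eq E_eq using that a(5) at0_1 zero_neq_one by (metis (mono_tags, lifting) mem_Collect_eq)+
      then have "fr p s \<otimes>\<^bsub>R_ring\<^esub> fr g 1 \<in> ext_R (Jp k) \<cdot>\<^bsub>R_ring\<^esub> I" by (rule ideal_prod.prod)
      also have "fr p s \<otimes>\<^bsub>R_ring\<^esub> fr g 1 = fr (g * p) s" using a(5) by (simp add: fr_mult mult.commute)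
      finally show ?thesis .
    qed
    have "a = fr (f1 * p) s \<oplus>\<^bsub>R_ring\<^esub> fr (f2 * q) s \<oplus>\<^bsub>R_ring\<^esub> fr (f3 * r) s"
      unfolding a(1) using a(5) by (simp add: fr_add_same)
    then show ?thesis using m[OF a(2) f_Jp(1)] m[OF a(3) f_Jp(2)] m[OF a(4) f_Jp(3)] K'.a_closed by simp
  qed
  ultimately show ?case unfolding R.ideal_power_Suc Suc by blast
qed

definition PR :: "complex \<times> complex \<times> complex \<Rightarrow> (complex poly poly poly \<times> complex poly poly poly) set set" where
  "PR q = ext_R {f. line q f = 0}"

lemma line_prime: "primeideal {f. line q f = 0} S_ring"
  by (rule primeideal_S_kernel[OF is_hom_line])

lemma poly_line_0: "poly (line q f) 0 = at0 f"
  by (cases q) (simp add: line_def poly_lin_0)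

lemma line_S_max: "{f. line q f = 0} \<subseteq> S_max"
  unfolding S_max_eq using poly_line_0 by (metis (mono_tags) Collect_mono poly_0)

lemma fr_mem_PR: "at0 s \<noteq> 0 \<Longrightarrow> fr f s \<in> PR q \<longleftrightarrow> line q f = 0"
  unfolding PR_def by (subst fr_mem_E_prime[OF line_prime line_S_max]) simp_all

lemma PR_prime: "primeideal (PR q) R_ring"
  unfolding PR_def by (rule primeideal_E[OF line_prime line_S_max])

text \<open>A linear form that vanishes on none of the lines: \<open>1 + \<zeta> + 3 \<eta> \<noteq> 0\<close> because \<open>1 + \<zeta>\<close> has absolute value at
  most \<open>2\<close>.\<close>

definition "ell = varx + vary + cst 3 * varz"

lemma line_ell:
  assumes "q \<in> pts"
  shows "line q ell \<noteq> 0"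
proof -
  consider "q = (0, 0, 1)" | "q = (1, 0, 0)" | "q = (0, 1, 0)" | \<zeta> \<eta> where "q = (1, \<zeta>, \<eta>)" "\<zeta> \<in> roots" "\<eta> \<in> roots"
    using assms unfolding pts_def by blast
  then show ?thesis
  proof cases
    case 4
    have norm: "norm z = 1" if "z \<in> roots" for z
    proof -
      have "norm z ^ n = 1" using that by (simp add: roots_def norm_power[symmetric])
      then show ?thesis using n_pos power_eq_imp_eq_base[of "norm z" n 1] by simp
    qed
    have "1 + \<zeta> + 3 * \<eta> \<noteq> 0"
    proof
      assume "1 + \<zeta> + 3 * \<eta> = 0"
      then have "3 * \<eta> = - (1 + \<zeta>)" by (simp only: add_eq_0_iff)
      then have "norm (3 * \<eta>) = norm (1 + \<zeta>)" by (simp only: norm_minus_cancel)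
      then have "3 = norm (1 + \<zeta>)" using norm[OF 4(3)] by (simp add: norm_mult)
      also have "\<dots> \<le> 1 + 1" using norm_triangle_ineq[of 1 \<zeta>] norm[OF 4(2)] by simp
      finally show False by simp
    qed
    then show ?thesis by (simp add: 4 ell_def line_def lin_simps lin_gens mult.commute)
  qed (simp_all add: ell_def line_def lin_simps lin_gens)
qed

sublocale curve: radical_curve R_ring mR "PR ` pts" "fr ell 1"
proof (rule radical_curve.intro[OF R_cring], rule radical_curve_axioms.intro)
  show "noetherian_ring R_ring" by (rule noetherian_R)
  show "ideal mR R_ring" "mR \<noteq> carrier R_ring" by (rule mR_ideal, rule mR_proper)
  show "a \<in> Units R_ring" if "a \<in> carrier R_ring" "a \<notin> mR" for a using R_units that by blast
  show "finite (PR ` pts)" using finite_pts by simp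
  show "PR ` pts \<noteq> {}" by (auto simp: pts_def)
  show "primeideal P R_ring" if "P \<in> PR ` pts" for P using that PR_prime by blast
  show "fr ell 1 \<in> mR" by (simp add: fr_mem_mR ell_def at0_simps at0_gens)
  show "fr ell 1 \<notin> P" if "P \<in> PR ` pts" for P using that line_ell by (auto simp: fr_mem_PR)
  fix P a b assume P: "P \<in> PR ` pts" and a: "a \<in> carrier R_ring" "a \<notin> P" and b: "b \<in> mR"
  obtain q where q: "q \<in> pts" "P = PR q" using P by blast
  obtain q1 q2 q3 where q': "q = (q1, q2, q3)" by (cases q)
  obtain f s where f: "a = fr f s" "at0 s \<noteq> 0" using a(1) by (rule R_cases)
  obtain g t where g: "b = fr g t" "at0 t \<noteq> 0" "at0 g = 0"
    using b ideal.Icarr[OF mR_ideal b] by (elim R_cases) (auto simp: fr_mem_mR)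
  obtain l where "line q l = [:0, 1:]" using pts_coord[OF q(1)] by blast
  moreover have "line q f \<noteq> 0" using a(2) f q(2) by (simp add: fr_mem_PR)
  ultimately obtain e h c where ehc: "at0 h \<noteq> 0" "line q (h * g ^ e - c * f) = 0"
    using line_valuation[of q1 q2 q3 l f g] g(3) unfolding line_def q' by auto
  have "b [^]\<^bsub>R_ring\<^esub> e \<ominus>\<^bsub>R_ring\<^esub> fr (c * s) (h * t ^ e) \<otimes>\<^bsub>R_ring\<^esub> a
    = fr (g ^ e * ((h * t ^ e) * s) - ((c * s) * f) * t ^ e) (t ^ e * ((h * t ^ e) * s))"
    using f g ehc by (simp add: fr_pow fr_mult fr_minus)
  also have "\<dots> \<in> P"
  proof -
    have "g ^ e * ((h * t ^ e) * s) - ((c * s) * f) * t ^ e = (t ^ e * s) * (h * g ^ e - c * f)"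
      by (simp add: algebra_simps)
    then have "line q (g ^ e * ((h * t ^ e) * s) - ((c * s) * f) * t ^ e) = 0"
      using ehc(2) by (simp only: is_hom_mult[OF is_hom_line] mult_zero_right)
    then show ?thesis unfolding q(2) using f g ehc by (subst fr_mem_PR) simp_all
  qed
  finally have "b [^]\<^bsub>R_ring\<^esub> e \<ominus>\<^bsub>R_ring\<^esub> fr (c * s) (h * t ^ e) \<otimes>\<^bsub>R_ring\<^esub> a \<in> P" .
  moreover have "fr (c * s) (h * t ^ e) \<in> carrier R_ring" using g ehc by simp
  ultimately show "\<exists>(e::nat). \<exists>c\<in>carrier R_ring. b [^]\<^bsub>R_ring\<^esub> e \<ominus>\<^bsub>R_ring\<^esub> c \<otimes>\<^bsub>R_ring\<^esub> a \<in> P" by blast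
qed

lemma line_at0_nz: "at0 t \<noteq> 0 \<Longrightarrow> line q t \<noteq> 0"
  using poly_line_0[of q t] by auto

lemma I_curve: "curve.I = I"
proof -
  have "fr f s \<in> \<Inter> (PR ` pts) \<longleftrightarrow> fr f s \<in> ext_R (Jp 1)" if s: "at0 s \<noteq> 0" for f s
  proof -
    have "(\<exists>t. at0 t \<noteq> 0 \<and> t * f \<in> Jp 1) \<longleftrightarrow> f \<in> Jp 1"
      unfolding Jp_1_iff using line_at0_nz at0_1
      by (metis (no_types, lifting) is_hom_mult[OF is_hom_line] mult_1 mult_eq_0_iff zero_neq_one)
    then have "fr f s \<in> ext_R (Jp 1) \<longleftrightarrow> f \<in> Jp 1" using fr_mem_E[OF ideal_Jp s] by blast
    also have "\<dots> \<longleftrightarrow> fr f s \<in> \<Inter> (PR ` pts)" unfolding Jp_1_iff using s by (simp add: fr_mem_PR)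
    finally show ?thesis by simp
  qed
  moreover have "x \<in> carrier R_ring" if "x \<in> \<Inter> (PR ` pts)" for x
    using that by (rule ideal.Icarr[OF curve.I_ideal[unfolded curve.I_def]])
  moreover have "x \<in> carrier R_ring" if "x \<in> ext_R (Jp 1)" for x
    using that by (rule ideal.Icarr[OF ideal_E[OF ideal_Jp]])
  ultimately have "x \<in> \<Inter> (PR ` pts) \<longleftrightarrow> x \<in> ext_R (Jp 1)" for x
    by (metis R_cases)
  then show ?thesis unfolding I_eq curve.I_def by blast
qed

lemma fr_mem_symbolic:
  assumes s: "at0 s \<noteq> 0"
  shows "fr f s \<in> symbolic_power R_ring I k \<longleftrightarrow> f \<in> MI k k k k"
proof -
  have "fr f s \<in> symbolic_power R_ring I k \<longleftrightarrow>
    (\<forall>q\<in>pts. \<exists>a\<in>carrier R_ring - PR q. a \<otimes>\<^bsub>R_ring\<^esub> fr f s \<in> ext_R (Jp k))"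
    using curve.symbolic_power_eq[of k] s unfolding I_curve ideal_power_I by auto
  also have "\<dots> \<longleftrightarrow> (\<forall>q\<in>pts. \<exists>g. line q g \<noteq> 0 \<and> g * f \<in> Jp k)"
  proof (intro ball_cong refl iffI)
    fix q assume "\<exists>a\<in>carrier R_ring - PR q. a \<otimes>\<^bsub>R_ring\<^esub> fr f s \<in> ext_R (Jp k)"
    then obtain a where a: "a \<in> carrier R_ring" "a \<notin> PR q" "a \<otimes>\<^bsub>R_ring\<^esub> fr f s \<in> ext_R (Jp k)" by blast
    obtain g t where g: "a = fr g t" "at0 t \<noteq> 0" using a(1) by (rule R_cases)
    have "line q g \<noteq> 0" using a(2) g by (simp add: fr_mem_PR)
    moreover obtain t' where "at0 t' \<noteq> 0" "t' * (g * f) \<in> Jp k"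
      using a(3) g s fr_mem_E[OF ideal_Jp, of "t * s" "g * f" k] by (auto simp: fr_mult)
    ultimately show "\<exists>g. line q g \<noteq> 0 \<and> g * f \<in> Jp k"
      using line_at0_nz by (intro exI[of _ "t' * g"]) (simp add: line_simps mult.assoc)
  next
    fix q assume "\<exists>g. line q g \<noteq> 0 \<and> g * f \<in> Jp k"
    then obtain g where g: "line q g \<noteq> 0" "g * f \<in> Jp k" by blast
    have "fr g 1 \<otimes>\<^bsub>R_ring\<^esub> fr f s \<in> ext_R (Jp k)"
      using g s by (simp add: fr_mult) (auto simp: E_eq)
    moreover have "fr g 1 \<in> carrier R_ring - PR q" using g by (simp add: fr_mem_PR)
    ultimately show "\<exists>a\<in>carrier R_ring - PR q. a \<otimes>\<^bsub>R_ring\<^esub> fr f s \<in> ext_R (Jp k)" by blast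
  qed
  also have "\<dots> \<longleftrightarrow> f \<in> MI k k k k" by (rule symbolic_iff)
  finally show ?thesis .
qed

theorem Cohen_Macaulay_fermat: "1 \<le> k \<Longrightarrow> Cohen_Macaulay (R_ring Quot symbolic_power R_ring I k)"
  using curve.Cohen_Macaulay_symbolic[of k] unfolding I_curve .

end

section \<open>The symbolic Rees algebra\<close>

context fermat
begin

lemma MI_0: "f \<in> MI 0 0 0 0"
  by (simp add: mem_MI_iff)

lemma MI_mult: "f \<in> MI j j j j \<Longrightarrow> g \<in> MI k k k k \<Longrightarrow> f * g \<in> MI (j + k) (j + k) (j + k) (j + k)"
  by (simp add: mem_MI_iff pw_mult)

lemma symbolic_filtration: "ideal_filtration R_ring (\<lambda>k. symbolic_power R_ring I k)"
proof (rule ideal_filtration.intro[OF R_cring], rule ideal_filtration_axioms.intro)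
  show id: "ideal (symbolic_power R_ring I k) R_ring" for k
    using curve.symbolic_power_ideal[of k] unfolding I_curve .
  have "a \<in> symbolic_power R_ring I 0" if "a \<in> carrier R_ring" for a
    using that by (elim R_cases) (simp add: fr_mem_symbolic MI_0)
  then show "symbolic_power R_ring I 0 = carrier R_ring" using ideal.Icarr[OF id[of 0]] by blast
  fix r j s k assume r: "r \<in> symbolic_power R_ring I j" and s: "s \<in> symbolic_power R_ring I k"
  obtain f t where f: "r = fr f t" "at0 t \<noteq> 0" using ideal.Icarr[OF id r] by (rule R_cases)
  obtain g t' where g: "s = fr g t'" "at0 t' \<noteq> 0" using ideal.Icarr[OF id s] by (rule R_cases)
  show "r \<otimes>\<^bsub>R_ring\<^esub> s \<in> symbolic_power R_ring I (j + k)"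
    using r s f g MI_mult by (simp add: fr_mult fr_mem_symbolic)
qed

lemma mon_add: "mon (a + a') (b + b') (c + c') (d + d') (e + e') (f + f') = mon a b c d e f * mon a' b' c' d' e' f'"
  by (simp add: mon_def power_add ac_simps)

type_synonym expo = "nat \<times> nat \<times> nat \<times> nat \<times> nat \<times> nat \<times> nat"

definition admissible :: "expo set" where
  "admissible = {(a, b, c, d, e, f, k). k \<le> d + e + f \<and> k \<le> a + b + n * d \<and> k \<le> b + c + n * e \<and> k \<le> a + c + n * f}"

text \<open>The exponents together with the slacks of the four inequalities. If one admissible vector is
  below another in all these coordinates, then their difference is admissible as well.\<close>

definition slack :: "expo \<Rightarrow> nat \<Rightarrow> nat" where
  "slack = (\<lambda>(a, b, c, d, e, f, k) i. [a, b, c, d, e, f, k, d + e + f - k, a + b + n * d - k, b + c + n * e - k, a + c + n * f - k] ! i)"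

definition weight :: "expo \<Rightarrow> nat" where
  "weight = (\<lambda>(a, b, c, d, e, f, k). a + b + c + d + e + f + k)"

lemma finite_generating_exponents:
  "\<exists>G. finite G \<and> G \<subseteq> admissible \<and> (\<forall>v\<in>G. weight v \<noteq> 0) \<and>
    (\<forall>v\<in>admissible. weight v \<noteq> 0 \<longrightarrow> (\<exists>g\<in>G. \<forall>i\<in>{..<11}. slack g i \<le> slack v i))"
proof -
  let ?V = "{v \<in> admissible. weight v \<noteq> 0}"
  obtain F where F: "finite F" "F \<subseteq> slack ` ?V" "\<forall>t\<in>slack ` ?V. \<exists>f\<in>F. \<forall>i\<in>{..<11}. f i \<le> t i"
    using dickson[of "{..<11::nat}" "slack ` ?V"] by auto
  obtain G where G: "G \<subseteq> ?V" "finite G" "F = slack ` G" using finite_subset_image[OF F(1,2)] by blast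
  show ?thesis using G F(3) by (intro exI[of _ G]) auto
qed

lemma slack_le:
  assumes "(a, b, c, d, e, f, k) \<in> admissible" "(a', b', c', d', e', f', k') \<in> admissible"
    and "\<forall>i\<in>{..<11}. slack (a', b', c', d', e', f', k') i \<le> slack (a, b, c, d, e, f, k) i"
  shows "a' \<le> a \<and> b' \<le> b \<and> c' \<le> c \<and> d' \<le> d \<and> e' \<le> e \<and> f' \<le> f \<and> k' \<le> k \<and>
    (a - a', b - b', c - c', d - d', e - e', f - f', k - k') \<in> admissible"
proof -
  have le: "slack (a', b', c', d', e', f', k') i \<le> slack (a, b, c, d, e, f, k) i" if "i < 11" for i
    using assms(3) that by blast
  have 1: "a' \<le> a" "b' \<le> b" "c' \<le> c" "d' \<le> d" "e' \<le> e" "f' \<le> f" "k' \<le> k"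
    using le[of 0] le[of 1] le[of 2] le[of 3] le[of 4] le[of 5] le[of 6] by (simp_all add: slack_def eval_nat_numeral)
  have 2: "d' + e' + f' - k' \<le> d + e + f - k" "a' + b' + n * d' - k' \<le> a + b + n * d - k"
    "b' + c' + n * e' - k' \<le> b + c + n * e - k" "a' + c' + n * f' - k' \<le> a + c + n * f - k"
    using le[of 7] le[of 8] le[of 9] le[of 10] by (simp_all add: slack_def eval_nat_numeral)
  have 3: "n * (d - d') = n * d - n * d'" "n * (e - e') = n * e - n * e'" "n * (f - f') = n * f - n * f'"
    "n * d' \<le> n * d" "n * e' \<le> n * e" "n * f' \<le> n * f"
    using 1 by (simp_all add: diff_mult_distrib2)
  have 4: "k \<le> d + e + f" "k \<le> a + b + n * d" "k \<le> b + c + n * e" "k \<le> a + c + n * f"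
    "k' \<le> d' + e' + f'" "k' \<le> a' + b' + n * d'" "k' \<le> b' + c' + n * e'" "k' \<le> a' + c' + n * f'"
    using assms(1,2) by (simp_all add: admissible_def)
  have diff: "k - k' \<le> (p - p') + (q - q') + (r - r')"
    if h: "p' \<le> p" "q' \<le> q" "r' \<le> r" "k' \<le> p' + q' + r'" "k \<le> p + q + r" "p' + q' + r' - k' \<le> p + q + r - k"
    for p q r p' q' r' :: nat
  proof -
    obtain x y z where "p = p' + x" "q = q' + y" "r = r' + z" using h(1-3) by (metis le_iff_add)
    then show ?thesis using h(4-6) by simp
  qed
  have "k - k' \<le> (d - d') + (e - e') + (f - f')" by (rule diff) (fact 1 2 4)+
  moreover have "k - k' \<le> (a - a') + (b - b') + n * (d - d')" unfolding 3(1) by (rule diff) (fact 1 2 3 4)+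
  moreover have "k - k' \<le> (b - b') + (c - c') + n * (e - e')" unfolding 3(2) by (rule diff) (fact 1 2 3 4)+
  moreover have "k - k' \<le> (a - a') + (c - c') + n * (f - f')" unfolding 3(3) by (rule diff) (fact 1 2 3 4)+
  ultimately show ?thesis
    using 1 unfolding admissible_def mem_Collect_eq prod.case by (intro conjI)
qed

text \<open>The symbolic powers are generated by products of variables and binomials with admissible exponents.
  Every admissible vector is a sum of the finitely many ones that are minimal for the order on exponents
  and slacks, so the symbolic Rees algebra is generated over the local ring by finitely many of
  these products.\<close>

theorem noetherian_symbolic_rees: "noetherian_ring (symbolic_rees_algebra R_ring I)"
proof -
  let ?F = "\<lambda>k. symbolic_power R_ring I k"
  interpret sym: ideal_filtration R_ring ?F by (rule symbolic_filtration)
  define B where "B = symbolic_rees_algebra R_ring I"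
  have B: "B = rees_of_filtration R_ring ?F" unfolding B_def symbolic_rees_algebra_def ..
  interpret B: cring B unfolding B by (rule sym.rees_cring)
  have hom: "ring_hom_ring R_ring B (\<lambda>r. sym.mnm r 0)"
    using sym.const_hom unfolding B[symmetric] by (intro ring_hom_ringI2[OF R.ring_axioms B.ring_axioms])
  have carrB: "carrier B = sym.H" unfolding B sym.rees_eq by simp
  have multB: "p \<otimes>\<^bsub>B\<^esub> q = p \<otimes>\<^bsub>UP R_ring\<^esub> q" "p \<oplus>\<^bsub>B\<^esub> q = p \<oplus>\<^bsub>UP R_ring\<^esub> q" "\<one>\<^bsub>B\<^esub> = \<one>\<^bsub>UP R_ring\<^esub>" for p q
    unfolding B sym.rees_eq by simp_all
  define mv where "mv = (\<lambda>(a, b, c, d, e, f, k). sym.mnm (fr (mon a b c d e f) 1) k)"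
  have mon_MI: "mon a b c d e f \<in> MI k k k k" if "(a, b, c, d, e, f, k) \<in> admissible" for a b c d e f k
    using MI.gen[of k d e f k a b k c k 1] that by (simp add: admissible_def)
  have mvB: "mv v \<in> carrier B" if "v \<in> admissible" for v
    using that mon_MI unfolding carrB mv_def by (cases v) (auto intro!: sym.mnm_H simp: fr_mem_symbolic)
  obtain G where G: "finite G" "G \<subseteq> admissible" "\<forall>v\<in>G. weight v \<noteq> 0"
    "\<forall>v\<in>admissible. weight v \<noteq> 0 \<longrightarrow> (\<exists>g\<in>G. \<forall>i\<in>{..<11}. slack g i \<le> slack v i)"
    using finite_generating_exponents by blast
  have "finite (mv ` G)" "mv ` G \<subseteq> carrier B" using G(1,2) mvB by auto
  from B.noetherian_sub_adjoin_finite[OF B.noetherian_sub_image[OF noetherian_R hom] this]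
  obtain A where A: "noetherian_sub B A" "(\<lambda>r. sym.mnm r 0) ` carrier R_ring \<subseteq> A" "mv ` G \<subseteq> A" by blast
  have sub: "subring A B" using A(1) unfolding noetherian_sub_def by blast
  have mv: "mv v \<in> A" if "v \<in> admissible" for v
    using that
  proof (induction "weight v" arbitrary: v rule: less_induct)
    case less
    obtain a b c d e f k where v: "v = (a, b, c, d, e, f, k)" by (metis prod.exhaust)
    show ?case
    proof (cases "weight v = 0")
      case True
      then have "mv v = sym.mnm \<one>\<^bsub>R_ring\<^esub> 0" by (simp add: v weight_def mv_def mon_def fr_one)
      moreover have "sym.mnm \<one>\<^bsub>R_ring\<^esub> 0 \<in> A"
        using A(2) imageI[OF R.one_closed, of "\<lambda>r. sym.mnm r 0"] by blast
      ultimately show ?thesis by (simp only:)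
    next
      case False
      then obtain g where g: "g \<in> G" "\<forall>i\<in>{..<11}. slack g i \<le> slack v i" using G(4) less.prems by blast
      obtain a' b' c' d' e' f' k' where g': "g = (a', b', c', d', e', f', k')" by (metis prod.exhaust)
      have gadm: "g \<in> admissible" using g G(2) by blast
      let ?w = "(a - a', b - b', c - c', d - d', e - e', f - f', k - k')"
      have le: "a' \<le> a" "b' \<le> b" "c' \<le> c" "d' \<le> d" "e' \<le> e" "f' \<le> f" "k' \<le> k" "?w \<in> admissible"
        using slack_le[of a b c d e f k a' b' c' d' e' f' k'] less.prems gadm g(2) unfolding v g' by blast+
      have "weight ?w < weight v"
        using le G(3) g(1) unfolding v g' weight_def by auto
      then have "mv ?w \<in> A" using less.hyps le(8) by blast
      moreover have "mv g \<in> A" using A(3) g by blast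
      ultimately have "mv g \<otimes>\<^bsub>B\<^esub> mv ?w \<in> A" using subringE(6)[OF sub] by blast
      also have "mv g \<otimes>\<^bsub>B\<^esub> mv ?w = sym.mnm (fr (mon a' b' c' d' e' f') 1 \<otimes>\<^bsub>R_ring\<^esub>
          fr (mon (a - a') (b - b') (c - c') (d - d') (e - e') (f - f')) 1) (k' + (k - k'))"
        unfolding g' mv_def multB prod.case by (rule sym.P.monom_mult[symmetric]) simp_all
      also have "\<dots> = mv v"
        using le mon_add[of a' "a - a'" b' "b - b'" c' "c - c'" d' "d - d'" e' "e - e'" f' "f - f'"]
        by (simp add: fr_mult v mv_def)
      finally show ?thesis .
    qed
  qed
  have all: "sym.mnm (fr f s) k \<in> A" if "f \<in> MI k k k k" "at0 s \<noteq> 0" for f s k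
    using that
  proof induction
    case (gen d e f a b c r)
    have "mv (a, b, c, d, e, f, k) \<in> A" by (rule mv) (use gen in \<open>simp add: admissible_def\<close>)
    moreover have "sym.mnm (fr r s) 0 \<in> A" using A(2) gen by auto
    ultimately have "sym.mnm (fr r s) 0 \<otimes>\<^bsub>B\<^esub> mv (a, b, c, d, e, f, k) \<in> A" using subringE(6)[OF sub] by blast
    also have "sym.mnm (fr r s) 0 \<otimes>\<^bsub>B\<^esub> mv (a, b, c, d, e, f, k)
      = sym.mnm (fr r s \<otimes>\<^bsub>R_ring\<^esub> fr (mon a b c d e f) 1) (0 + k)"
      unfolding mv_def multB prod.case by (rule sym.P.monom_mult[symmetric]) (use gen in simp_all)
    finally show ?case using gen by (simp add: fr_mult)
  next
    case (add p q)
    then have "sym.mnm (fr p s) k \<oplus>\<^bsub>B\<^esub> sym.mnm (fr q s) k \<in> A" using subringE(7)[OF sub] by blast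
    also have "sym.mnm (fr p s) k \<oplus>\<^bsub>B\<^esub> sym.mnm (fr q s) k = sym.mnm (fr p s \<oplus>\<^bsub>R_ring\<^esub> fr q s) k"
      unfolding multB by (rule sym.P.monom_add[symmetric]) (use add in simp_all)
    finally show ?case using add by (simp add: fr_add_same)
  qed
  have "A = carrier B"
    unfolding B
  proof (rule sym.subring_rees_eq)
    show "subring A (rees_of_filtration R_ring ?F)" using sub unfolding B .
    fix r k assume r: "r \<in> ?F k"
    obtain f s where f: "r = fr f s" "at0 s \<noteq> 0" using sym.F_carrier[OF r] by (rule R_cases)
    then show "sym.mnm r k \<in> A" using r all by (simp add: fr_mem_symbolic)
  qed
  then have "noetherian_ring B" using A(1) B.noetherian_sub_carrier by simp
  then show ?thesis by (simp add: B_def)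
qed

section \<open>Height and set-theoretic complete intersection\<close>

end

text \<open>Primes of the localization contract to primes of the polynomial ring.\<close>

lemma no_chain_R: "\<not> prime_chain R_ring {} 4 Q"
proof
  assume Q: "prime_chain R_ring {} 4 Q"
  have loc: "(\<lambda>f. fr f 1) \<in> ring_hom S_ring R_ring"
    by (rule ring_hom_memI) (simp_all add: fr_mult fr_add fr_one)
  have "prime_chain S_ring {} 4 (\<lambda>i. {f \<in> carrier S_ring. fr f 1 \<in> Q i})"
  proof (rule prime_chain_vimage[OF S_cring R_cring loc Q])
    fix i x assume i: "i < 4" "x \<in> Q (Suc i)" "x \<notin> Q i"
    have "primeideal (Q i) R_ring" "primeideal (Q (Suc i)) R_ring"
      using Q i(1) unfolding prime_chain_def by simp_all
    then have id: "ideal (Q i) R_ring" "ideal (Q (Suc i)) R_ring"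
      by (simp_all add: primeideal.axioms(1))
    obtain f s where f: "x = fr f s" "at0 s \<noteq> 0" using ideal.Icarr[OF id(2) i(2)] by (rule R_cases)
    have "fr s 1 \<otimes>\<^bsub>R_ring\<^esub> x \<in> Q (Suc i)" using ideal.I_l_closed[OF id(2) i(2)] by simp
    moreover have "fr s 1 \<otimes>\<^bsub>R_ring\<^esub> x = fr f 1" using f by (simp add: fr_mult fr_eq_iff)
    moreover have "fr f 1 \<notin> Q i"
    proof
      assume "fr f 1 \<in> Q i"
      then have "fr 1 s \<otimes>\<^bsub>R_ring\<^esub> fr f 1 \<in> Q i" using ideal.I_l_closed[OF id(1)] f by simp
      then show False using f i(3) by (simp add: fr_mult)
    qed
    ultimately show "\<exists>f\<in>carrier S_ring. fr f 1 \<in> Q (Suc i) \<and> fr f 1 \<notin> Q i" by auto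
  qed simp
  then show False using no_chain_S by blast
qed

context fermat
begin

text \<open>The ideal of a plane that contains the line.\<close>

lemma plane_through_line:
  assumes "q \<in> pts"
  shows "\<exists>K. primeideal K S_ring \<and> (\<exists>g\<in>K. g \<noteq> 0) \<and> K \<subset> {f. line q f = 0}"
proof -
  consider b c where "q = (1, b, c)" | b c where "q = (0, b, c)" "(b, c) = (1, 0) \<or> (b, c) = (0, 1)"
    using assms unfolding pts_def by blast
  then show ?thesis
  proof cases
    case 1
    have s: "{f. plane b f = 0} \<subseteq> {f. line q f = 0}" by (auto simp: 1 line_def lin_plane)
    have m: "varz - cst c * varx \<in> {f. line q f = 0}" "varz - cst c * varx \<notin> {f. plane b f = 0}"
      by (simp_all add: 1 line_def lin_simps lin_gens plane_simps plane_gens)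
    have k: "vary - cst b * varx \<in> {f. plane b f = 0}" by (simp add: plane_simps plane_gens)
    have "cf (vary - varx * cst b) 0 1 0 = 1"
      using cf_vary[of 1 0 1 0] cf_cst[of 1 0 0 0] by (simp add: cf_varx is_hom_one[OF is_hom_cst])
    then have "vary - cst b * varx \<noteq> 0" by (metis cf_zero mult.commute zero_neq_one)
    then show ?thesis using s m k primeideal_S_kernel[OF is_hom_plane, of b] by blast
  next
    case 2
    let ?K = "{f. ev cst 0 vary varz f = 0}"
    have "lin 0 b c f = lin 0 b c (ev cst 0 vary varz f)" for f
      by (rule hom_eqI[OF is_hom_lin is_hom_comp[OF is_hom_lin is_hom_ev[OF is_hom_cst]]])
         (simp_all add: ev_gens[OF is_hom_cst] lin_gens lin_simps)
    then have s: "?K \<subseteq> {f. line q f = 0}" by (auto simp: 2 line_def) (metis is_hom_zero[OF is_hom_lin])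
    have k: "varx \<in> ?K" "varx \<noteq> 0" by (simp_all add: ev_gens[OF is_hom_cst])
    have "vary \<notin> ?K" "varz \<notin> ?K" by (simp_all add: ev_gens[OF is_hom_cst])
    moreover have "vary \<in> {f. line q f = 0} \<or> varz \<in> {f. line q f = 0}"
      using 2 by (auto simp: line_def lin_gens)
    ultimately show ?thesis using s k primeideal_S_kernel[OF is_hom_ev[OF is_hom_cst], of 0 vary varz] by blast
  qed
qed

lemma zero_prime_S: "primeideal {0} S_ring"
  using primeideal_S_kernel[OF is_hom_id] by simp

lemma ext_R_strict:
  assumes "primeideal K S_ring" "primeideal K' S_ring" "K \<subset> K'" "K' \<subseteq> S_max"
  shows "ext_R K \<subset> ext_R K'"
proof -
  obtain g where g: "g \<in> K'" "g \<notin> K" using assms(3) by blast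
  have "K \<subseteq> S_max" using assms by blast
  then have "fr g 1 \<notin> ext_R K" "fr g 1 \<in> ext_R K'" using g assms by (simp_all add: fr_mem_E_prime)
  moreover have "ext_R K \<subseteq> ext_R K'" unfolding E_eq using assms(3) by blast
  ultimately show ?thesis by blast
qed

text \<open>A chain that ends in the prime of a line can be prolonged by the maximal ideal.\<close>

lemma prime_height_upper:
  assumes "q \<in> pts"
  shows "prime_height R_ring (PR q) \<le> 2"
proof -
  have "m \<le> 2" if P: "\<forall>i\<le>m. primeideal (P i) R_ring" "\<forall>i<m. P i \<subset> P (Suc i)" "P m = PR q" for m P
  proof (rule ccontr)
    assume "\<not> m \<le> 2"
    then have m: "4 \<le> Suc m" by simp
    have mx: "primeideal mR R_ring"
      unfolding mR_def by (rule primeideal_E[OF primeideal_S_max]) simp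
    have "PR q \<subset> mR" using curve.prime_subset_max assms by blast
    then have "prime_chain R_ring {} (Suc m) (\<lambda>i. if i \<le> m then P i else mR)"
      unfolding prime_chain_def using P mx by (auto simp: le_Suc_eq less_Suc_eq)
    then show False using prime_chain_less[OF _ m] no_chain_R by blast
  qed
  then have "enat m \<le> 2" if "\<forall>i\<le>m. primeideal (P i) R_ring" "\<forall>i<m. P i \<subset> P (Suc i)" "P m = PR q" for m P
    using that by (metis enat_ord_simps(1) numeral_eq_enat)
  then show ?thesis unfolding prime_height_def by (intro Sup_least) blast
qed

lemma prime_height_lower:
  assumes Q: "primeideal Q R_ring" "I \<subseteq> Q"
  shows "2 \<le> prime_height R_ring Q"
proof -
  obtain q where q: "q \<in> pts" "PR q \<subseteq> Q"
    using curve.prime_above_I[OF Q(1)] Q(2) unfolding I_curve by blast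
  obtain K where K: "primeideal K S_ring" "\<exists>g\<in>K. g \<noteq> 0" "K \<subset> {f. line q f = 0}"
    using plane_through_line[OF q(1)] by blast
  have Kmax: "K \<subseteq> S_max" using K(3) line_S_max by blast
  have "{0} \<subset> K" using K(2) ideal_S(1)[OF primeideal.axioms(1)[OF K(1)]] by auto
  then have c: "ext_R {0} \<subset> ext_R K" by (rule ext_R_strict[OF zero_prime_S K(1) _ Kmax])
  have c': "ext_R K \<subset> PR q" unfolding PR_def by (rule ext_R_strict[OF K(1) line_prime K(3) line_S_max])
  have pr: "primeideal (ext_R {0}) R_ring" "primeideal (ext_R K) R_ring"
    using primeideal_E[OF zero_prime_S] primeideal_E[OF K(1) Kmax] at0_simps(1) by (auto simp: S_max_eq)
  define P where "P = (\<lambda>i::nat. if i = 0 then ext_R {0} else if i = 1 then ext_R K else Q)"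
  have "(\<forall>i\<le>2. primeideal (P i) R_ring) \<and> (\<forall>i<2. P i \<subset> P (Suc i)) \<and> P 2 = Q"
    using pr Q(1) c c' q(2) by (auto simp: P_def less_2_cases_iff)
  then have "enat 2 \<le> prime_height R_ring Q"
    unfolding prime_height_def by (intro Sup_upper) blast
  then show ?thesis by (simp add: numeral_eq_enat)
qed

lemma I_subset_PR: "q \<in> pts \<Longrightarrow> I \<subseteq> PR q"
  unfolding I_curve[symmetric] curve.I_def by blast

lemma height_I: "ideal_height R_ring I = 2"
proof (rule antisym)
  have q: "(0, 0, 1) \<in> pts" by (simp add: pts_def)
  have "ideal_height R_ring I \<le> prime_height R_ring (PR (0, 0, 1))"
    unfolding ideal_height_def using PR_prime I_subset_PR[OF q] by (intro Inf_lower) blast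
  also have "\<dots> \<le> 2" by (rule prime_height_upper[OF q])
  finally show "ideal_height R_ring I \<le> 2" .
  show "2 \<le> ideal_height R_ring I"
    unfolding ideal_height_def using prime_height_lower by (intro Inf_greatest) blast
qed

theorem set_theoretic_complete_intersection_fermat: "set_theoretic_complete_intersection R_ring I"
proof -
  let ?fs = "[fr F1 1, fr F2 1]"
  have gI: "fr F1 1 \<in> I" "fr F2 1 \<in> I"
    unfolding I_eq E_eq using F_Jp at0_1 zero_neq_one by (metis (mono_tags, lifting) mem_Collect_eq)+
  have sub: "set ?fs \<subseteq> carrier R_ring" by simp
  define K where "K = Idl\<^bsub>R_ring\<^esub> (set ?fs)"
  interpret K: ideal K R_ring unfolding K_def by (rule R.genideal_ideal[OF sub])
  have gK: "fr F1 1 \<in> K" "fr F2 1 \<in> K" unfolding K_def using R.genideal_self[OF sub] by auto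
  have KI: "K \<subseteq> I" unfolding K_def using gI by (intro R.genideal_minimal[OF ideal_I]) simp
  have "radical R_ring I = radical R_ring K"
  proof
    show "radical R_ring K \<subseteq> radical R_ring I" unfolding radical_def using KI by blast
    show "radical R_ring I \<subseteq> radical R_ring K"
    proof
      fix r assume "r \<in> radical R_ring I"
      then obtain k :: nat where r: "r \<in> carrier R_ring" "r [^]\<^bsub>R_ring\<^esub> k \<in> I" unfolding radical_def by blast
      obtain f s where f: "r [^]\<^bsub>R_ring\<^esub> k = fr f s" "f \<in> Jp 1" "at0 s \<noteq> 0" using r(2) unfolding I_eq E_eq by blast
      define N where "N = 3 * (n + 5)"
      obtain p q where pq: "f ^ N = F1 * p + F2 * q" using F1_F2_power[OF f(2)] unfolding N_def pw_1_iff by blast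
      have "r [^]\<^bsub>R_ring\<^esub> (k * N) = fr f s [^]\<^bsub>R_ring\<^esub> N" using r(1) f(1) by (simp add: R.nat_pow_pow[symmetric])
      also have "\<dots> = fr (p * F1 + q * F2) (s ^ N)" using f(3) by (simp add: fr_pow pq mult.commute)
      also have "\<dots> = fr p (s ^ N) \<otimes>\<^bsub>R_ring\<^esub> fr F1 1 \<oplus>\<^bsub>R_ring\<^esub> fr q (s ^ N) \<otimes>\<^bsub>R_ring\<^esub> fr F2 1"
        using f(3) by (simp add: fr_mult fr_add_same)
      also have "\<dots> \<in> K" using f(3) by (intro K.a_closed K.I_l_closed gK) simp_all
      finally show "r \<in> radical R_ring K" unfolding radical_def using r(1) by blast
    qed
  qed
  moreover have "enat (length ?fs) = ideal_height R_ring I" unfolding height_I by (simp add: numeral_eq_enat eval_nat_numeral)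
  moreover have q: "(0, 0, 1) \<in> pts" by (simp add: pts_def)
  have "I \<subseteq> mR"
    using I_subset_PR[OF q] curve.prime_subset_max[OF imageI[OF q]] by blast
  then have "fr F1 1 \<in> mR" "fr F2 1 \<in> mR" using gI by blast+
  then have "set ?fs \<subseteq> max_ideal R_ring" unfolding R_local(2) by simp
  ultimately show ?thesis
    unfolding set_theoretic_complete_intersection_def K_def
    using R_local(1) ideal_I by (intro conjI exI[of _ ?fs])
qed

end

section \<open>The fiber cone\<close>

lemma primeideal_hom_kernel:
  fixes B (structure) and h :: "'a \<Rightarrow> 'b::idom"
  assumes "cring B" and one: "h \<one> = 1"
    and add: "\<And>a b. a \<in> carrier B \<Longrightarrow> b \<in> carrier B \<Longrightarrow> h (a \<oplus> b) = h a + h b"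
    and mult: "\<And>a b. a \<in> carrier B \<Longrightarrow> b \<in> carrier B \<Longrightarrow> h (a \<otimes> b) = h a * h b"
  shows "primeideal {b \<in> carrier B. h b = 0} B"
proof -
  interpret cring B by fact
  have "h \<zero> + h \<zero> = h \<zero> + 0" using add[of \<zero> \<zero>] by (simp only: zero_closed r_zero add_0_right)
  then have zero: "h \<zero> = 0" by (simp only: add_left_cancel)
  have neg: "h (\<ominus> a) = - h a" if "a \<in> carrier B" for a
    using add[of "\<ominus> a" a] that zero by (simp add: l_neg eq_neg_iff_add_eq_0)
  have id: "ideal {b \<in> carrier B. h b = 0} B"
  proof (rule idealI[OF ring_axioms], rule add.subgroupI)
    show "{b \<in> carrier B. h b = 0} \<noteq> {}" using zero by blast
  qed (auto simp: add mult neg)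
  show ?thesis
  proof (rule primeidealI[OF id is_cring])
    have "\<one> \<notin> {b \<in> carrier B. h b = 0}" using one by simp
    then show "carrier B \<noteq> {b \<in> carrier B. h b = 0}" by blast
  qed (auto simp: mult)
qed

lemma quot_zero: "\<zero>\<^bsub>R Quot K\<^esub> = K"
  by (simp add: FactRing_def)

lemma UP_carrier: "carrier (UP R) = up R"
  by (simp add: UP_def)

lemma UP_coeff: "p \<in> up R \<Longrightarrow> up_ring.coeff (UP R) p k = p k"
  by (simp add: UP_def)

section \<open>Lowest homogeneous components\<close>

lemma hcomp_mult_lowest:
  assumes "\<And>i. i < M \<Longrightarrow> hcomp i f = 0" "\<And>i. i < N \<Longrightarrow> hcomp i g = 0"
  shows "hcomp (M + N) (f * g) = hcomp M f * hcomp N g" "i < M + N \<Longrightarrow> hcomp i (f * g) = 0"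
proof -
  have c: "hcomp j (f * g) = (\<Sum>i\<le>j. hcomp i f * hcomp (j - i) g)" for j
    by (simp add: hcomp_def grading_simps coeff_mult)
  have "hcomp (M + N) (f * g) = (\<Sum>i\<in>{M}. hcomp i f * hcomp (M + N - i) g)"
    unfolding c
  proof (rule sum.mono_neutral_right)
    show "\<forall>i\<in>{..M + N} - {M}. hcomp i f * hcomp (M + N - i) g = 0"
    proof
      fix i assume "i \<in> {..M + N} - {M}"
      then have "i < M \<or> M + N - i < N" by auto
      then show "hcomp i f * hcomp (M + N - i) g = 0" using assms by auto
    qed
  qed auto
  then show "hcomp (M + N) (f * g) = hcomp M f * hcomp N g" by simp
  show "hcomp i (f * g) = 0" if "i < M + N"
    unfolding c
  proof (rule sum.neutral, rule ballI)
    fix j assume "j \<in> {..i}"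
    then have "j < M \<or> i - j < N" using that by auto
    then show "hcomp j f * hcomp (i - j) g = 0" using assms by auto
  qed
qed

text \<open>The relation \<open>low N r c\<close> says that \<open>r\<close> has order at least \<open>N\<close> at the origin and that \<open>c\<close> is its component of
  degree \<open>N\<close>. Denominators with value \<open>1\<close> at the origin do not change lowest components.\<close>

definition low :: "nat \<Rightarrow> (complex poly poly poly \<times> complex poly poly poly) set \<Rightarrow> complex poly poly poly \<Rightarrow> bool" where
  "low N r c \<longleftrightarrow> (\<exists>g s. r = fr g s \<and> at0 s = 1 \<and> (\<forall>i<N. hcomp i g = 0) \<and> hcomp N g = c)"

lemma hcomp_mult_unit:
  assumes "\<And>i. i < N \<Longrightarrow> hcomp i g = 0" "at0 s = 1"
  shows "hcomp N (g * s) = hcomp N g" "i < N \<Longrightarrow> hcomp i (g * s) = 0"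
proof -
  have 0: "\<And>i. i < (0::nat) \<Longrightarrow> hcomp i s = 0" by simp
  have "hcomp (N + 0) (g * s) = hcomp N g * hcomp 0 s" by (rule hcomp_mult_lowest(1)[OF assms(1) 0])
  then show "hcomp N (g * s) = hcomp N g"
    by (simp add: at0_hcomp assms(2) is_hom_one[OF is_hom_cst])
  show "i < N \<Longrightarrow> hcomp i (g * s) = 0" using hcomp_mult_lowest(2)[of N g 0 s i] assms(1) by simp
qed

lemma low_unique:
  assumes "low N r c" "low N r c'"
  shows "c = c'"
proof -
  obtain g s where g: "r = fr g s" "at0 s = 1" "\<forall>i<N. hcomp i g = 0" "hcomp N g = c" using assms(1) unfolding low_def by blast
  obtain h t where h: "r = fr h t" "at0 t = 1" "\<forall>i<N. hcomp i h = 0" "hcomp N h = c'" using assms(2) unfolding low_def by blast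
  have "g * t = h * s" using g(1,2) h(1,2) fr_eq_iff[of s t g h] by simp
  moreover have "hcomp N (g * t) = c" using hcomp_mult_unit(1)[of N g t] g h by simp
  moreover have "hcomp N (h * s) = c'" using hcomp_mult_unit(1)[of N h s] g h by simp
  ultimately show ?thesis by simp
qed

lemma low_fr: "at0 s = 1 \<Longrightarrow> (\<And>i. i < N \<Longrightarrow> hcomp i g = 0) \<Longrightarrow> low N (fr g s) (hcomp N g)"
  unfolding low_def by blast

lemma low_add:
  assumes "low N r c" "low N r' c'"
  shows "low N (r \<oplus>\<^bsub>R_ring\<^esub> r') (c + c')"
proof -
  obtain g s where g: "r = fr g s" "at0 s = 1" "\<forall>i<N. hcomp i g = 0" "hcomp N g = c" using assms(1) unfolding low_def by blast
  obtain h t where h: "r' = fr h t" "at0 t = 1" "\<forall>i<N. hcomp i h = 0" "hcomp N h = c'" using assms(2) unfolding low_def by blast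
  have "low N (fr (g * t + h * s) (s * t)) (hcomp N (g * t + h * s))"
    using g h hcomp_mult_unit(2)[of N g t] hcomp_mult_unit(2)[of N h s] by (intro low_fr) (simp_all add: hcomp_add)
  then show ?thesis
    using g h hcomp_mult_unit(1)[of N g t] hcomp_mult_unit(1)[of N h s] by (simp add: fr_add hcomp_add)
qed

lemma low_mult:
  assumes "low M r c" "low N r' c'"
  shows "low (M + N) (r \<otimes>\<^bsub>R_ring\<^esub> r') (c * c')"
proof -
  obtain g s where g: "r = fr g s" "at0 s = 1" "\<forall>i<M. hcomp i g = 0" "hcomp M g = c" using assms(1) unfolding low_def by blast
  obtain h t where h: "r' = fr h t" "at0 t = 1" "\<forall>i<N. hcomp i h = 0" "hcomp N h = c'" using assms(2) unfolding low_def by blast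
  have "low (M + N) (fr (g * h) (s * t)) (hcomp (M + N) (g * h))"
    using g h hcomp_mult_lowest(2)[of M g N h] by (intro low_fr) simp_all
  then show ?thesis using g h hcomp_mult_lowest(1)[of M g N h] by (simp add: fr_mult)
qed

lemma low_zero: "low N \<zero>\<^bsub>R_ring\<^esub> 0"
  using low_fr[of 1 N 0] by (simp add: fr_zero hcomp_zero)

lemma low_one: "low 0 \<one>\<^bsub>R_ring\<^esub> 1"
  using low_fr[of 1 0 1] by (simp add: fr_one at0_hcomp is_hom_one[OF is_hom_cst])

lemma low_carrier: "low N r c \<Longrightarrow> r \<in> carrier R_ring"
  unfolding low_def by auto

lemma low_finsum:
  assumes "finite A" "\<And>i. i \<in> A \<Longrightarrow> low N (r i) (c i)"
  shows "low N (\<Oplus>\<^bsub>R_ring\<^esub>i\<in>A. r i) (\<Sum>i\<in>A. c i)"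
  using assms
proof (induction A rule: finite_induct)
  case (insert i A)
  have rc: "r \<in> A \<rightarrow> carrier R_ring" "r i \<in> carrier R_ring" using insert.prems low_carrier by blast+
  have "low N (r i \<oplus>\<^bsub>R_ring\<^esub> (\<Oplus>\<^bsub>R_ring\<^esub>i\<in>A. r i)) (c i + (\<Sum>i\<in>A. c i))"
    by (rule low_add) (use insert in auto)
  then show ?case using insert.hyps rc by simp
qed (simp add: low_zero)

definition lc :: "nat \<Rightarrow> (complex poly poly poly \<times> complex poly poly poly) set \<Rightarrow> complex poly poly poly" where
  "lc N r = (THE c. low N r c)"

lemma lc_eq: "low N r c \<Longrightarrow> lc N r = c"
  unfolding lc_def using low_unique by blast

lemma ex_low:
  assumes "at0 s \<noteq> 0" "\<And>i. i < N \<Longrightarrow> hcomp i g = 0"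
  shows "\<exists>c. low N (fr g s) c \<and> (hcomp N g = 0 \<longrightarrow> c = 0)"
proof -
  let ?d = "cst (1 / at0 s)"
  have "fr g s = fr (?d * g) (?d * s)"
    using assms(1) by (subst fr_eq_iff) (simp_all add: at0_gens ac_simps)
  moreover have "low N (fr (?d * g) (?d * s)) (hcomp N (?d * g))"
    using assms by (intro low_fr) (simp_all add: at0_gens hcomp_homog_mult[OF homog_gens(4)])
  ultimately show ?thesis
    by (intro exI[of _ "hcomp N (?d * g)"]) (simp add: hcomp_homog_mult[OF homog_gens(4)])
qed

context fermat
begin

lemma homog_f: "homog (Suc n) f1" "homog (Suc n) f2" "homog (Suc n) f3"
  using homog_mult[OF homog_gens(1) homog_uvw(2)] homog_mult[OF homog_gens(2) homog_uvw(3)]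
    homog_mult[OF homog_gens(3) homog_uvw(1)] by (simp_all add: f1_def f2_def f3_def)

lemma Jp_low: "g \<in> Jp k \<Longrightarrow> i < Suc n * k \<Longrightarrow> hcomp i g = 0"
proof (induction k arbitrary: g i)
  case (Suc k)
  then obtain p q r where g: "g = f1 * p + f2 * q + f3 * r" "p \<in> Jp k" "q \<in> Jp k" "r \<in> Jp k" by auto
  have "Suc n \<le> i \<Longrightarrow> i - Suc n < Suc n * k" using Suc.prems(2) by auto
  then have "Suc n \<le> i \<Longrightarrow> hcomp (i - Suc n) p = 0 \<and> hcomp (i - Suc n) q = 0 \<and> hcomp (i - Suc n) r = 0"
    using Suc.IH g(2-4) by blast
  then show ?case by (simp add: g(1) hcomp_add hcomp_homog_mult[OF homog_f(1)] hcomp_homog_mult[OF homog_f(2)]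
    hcomp_homog_mult[OF homog_f(3)] del: mult_Suc)
qed simp

lemma ex_low_power: "r \<in> ideal_power R_ring I k \<Longrightarrow> \<exists>c. low (Suc n * k) r c"
proof -
  assume "r \<in> ideal_power R_ring I k"
  then obtain g s where "r = fr g s" "g \<in> Jp k" "at0 s \<noteq> 0" unfolding ideal_power_I E_eq by blast
  then show ?thesis using ex_low[of s "Suc n * k" g] Jp_low[of g k] by blast
qed

lemma power_filtration: "ideal_filtration R_ring (ideal_power R_ring I)"
  by (rule ideal_filtration.intro[OF R_cring], rule ideal_filtration_axioms.intro)
     (rule R.ideal_ideal_power[OF ideal_I] R.ideal_power_0 R.ideal_power_mult[OF ideal_I], assumption?)+

interpretation ord: ideal_filtration R_ring "ideal_power R_ring I"
  by (rule power_filtration)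

definition B where "B = rees_algebra R_ring I"

lemma B_eq: "B = rees_of_filtration R_ring (ideal_power R_ring I)"
  by (simp add: B_def rees_algebra_def)

lemma B_cring: "cring B"
  unfolding B_eq by (rule ord.rees_cring)

interpretation B: cring B by (rule B_cring)

lemma B_simps: "p \<otimes>\<^bsub>B\<^esub> q = p \<otimes>\<^bsub>UP R_ring\<^esub> q" "p \<oplus>\<^bsub>B\<^esub> q = p \<oplus>\<^bsub>UP R_ring\<^esub> q" "\<one>\<^bsub>B\<^esub> = \<one>\<^bsub>UP R_ring\<^esub>" "carrier B = ord.H"
  unfolding B_eq ord.rees_eq by simp_all

lemma B_coeff: "p \<in> carrier B \<Longrightarrow> p \<in> carrier (UP R_ring)" "p \<in> carrier B \<Longrightarrow> ord.cof p k \<in> ideal_power R_ring I k"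
  unfolding B_simps(4) ord.H_def by auto

text \<open>The homomorphism from the Rees algebra to a polynomial ring that takes the lowest possible
  homogeneous component, of degree \<open>(n + 1) k\<close>, of the coefficient of \<open>t\<^sup>k\<close>.\<close>

definition \<Theta> :: "(nat \<Rightarrow> (complex poly poly poly \<times> complex poly poly poly) set) \<Rightarrow> complex poly poly poly poly" where
  "\<Theta> p = Abs_poly (\<lambda>k. lc (Suc n * k) (ord.cof p k))"

lemma coeff_\<Theta>:
  assumes "p \<in> carrier B"
  shows "poly.coeff (\<Theta> p) k = lc (Suc n * k) (ord.cof p k)"
proof -
  have "poly.coeff (Abs_poly (\<lambda>k. lc (Suc n * k) (ord.cof p k))) = (\<lambda>k. lc (Suc n * k) (ord.cof p k))"
  proof (rule coeff_Abs_poly[of "deg R_ring p"])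
  fix i assume "deg R_ring p < i"
  then have "ord.cof p i = \<zero>\<^bsub>R_ring\<^esub>" using ord.P.deg_aboveD B_coeff(1)[OF assms] by blast
  then show "lc (Suc n * i) (ord.cof p i) = 0" using lc_eq[OF low_zero] by simp
  qed
  then show ?thesis by (simp add: \<Theta>_def)
qed

lemma low_coeff: "p \<in> carrier B \<Longrightarrow> low (Suc n * k) (ord.cof p k) (poly.coeff (\<Theta> p) k)"
  using ex_low_power[OF B_coeff(2)] lc_eq by (metis coeff_\<Theta>)

lemma \<Theta>_add: "p \<in> carrier B \<Longrightarrow> q \<in> carrier B \<Longrightarrow> \<Theta> (p \<oplus>\<^bsub>B\<^esub> q) = \<Theta> p + \<Theta> q"
proof (rule poly_eqI)
  fix k assume pq: "p \<in> carrier B" "q \<in> carrier B"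
  have "ord.cof (p \<oplus>\<^bsub>B\<^esub> q) k = ord.cof p k \<oplus>\<^bsub>R_ring\<^esub> ord.cof q k"
    unfolding B_simps using pq B_coeff(1) by simp
  then show "poly.coeff (\<Theta> (p \<oplus>\<^bsub>B\<^esub> q)) k = poly.coeff (\<Theta> p + \<Theta> q) k"
    using lc_eq[OF low_add[OF low_coeff[OF pq(1), of k] low_coeff[OF pq(2), of k]]] pq by (simp add: coeff_\<Theta>)
qed

lemma \<Theta>_mult: "p \<in> carrier B \<Longrightarrow> q \<in> carrier B \<Longrightarrow> \<Theta> (p \<otimes>\<^bsub>B\<^esub> q) = \<Theta> p * \<Theta> q"
proof (rule poly_eqI)
  fix k assume pq: "p \<in> carrier B" "q \<in> carrier B"
  have c: "ord.cof (p \<otimes>\<^bsub>B\<^esub> q) k = (\<Oplus>\<^bsub>R_ring\<^esub>i\<in>{..k}. ord.cof p i \<otimes>\<^bsub>R_ring\<^esub> ord.cof q (k - i))"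
    unfolding B_simps using pq B_coeff(1) by simp
  have "low (Suc n * k) (ord.cof p i \<otimes>\<^bsub>R_ring\<^esub> ord.cof q (k - i)) (poly.coeff (\<Theta> p) i * poly.coeff (\<Theta> q) (k - i))"
    if "i \<in> {..k}" for i
  proof -
    have "Suc n * i + Suc n * (k - i) = Suc n * k"
      using that by (simp add: distrib_left[symmetric] del: mult_Suc)
    then show ?thesis using low_mult[OF low_coeff[OF pq(1), of i] low_coeff[OF pq(2), of "k - i"]] by simp
  qed
  then have "low (Suc n * k) (ord.cof (p \<otimes>\<^bsub>B\<^esub> q) k) (\<Sum>i\<le>k. poly.coeff (\<Theta> p) i * poly.coeff (\<Theta> q) (k - i))"
    unfolding c by (intro low_finsum) auto
  then show "poly.coeff (\<Theta> (p \<otimes>\<^bsub>B\<^esub> q)) k = poly.coeff (\<Theta> p * \<Theta> q) k"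
    using pq lc_eq by (simp add: coeff_\<Theta> coeff_mult)
qed

lemma \<Theta>_mnm:
  assumes "r \<in> ideal_power R_ring I j" "low (Suc n * j) r c"
  shows "\<Theta> (ord.mnm r j) = Polynomial.monom c j"
proof (rule poly_eqI)
  fix k
  have m: "ord.mnm r j \<in> carrier B" unfolding B_simps by (rule ord.mnm_H[OF assms(1)])
  show "poly.coeff (\<Theta> (ord.mnm r j)) k = poly.coeff (Polynomial.monom c j) k"
    using lc_eq[OF assms(2)] lc_eq[OF low_zero] low_carrier[OF assms(2)]
    by (auto simp: coeff_\<Theta>[OF m] simp del: mult_Suc)
qed

lemma \<Theta>_one: "\<Theta> \<one>\<^bsub>B\<^esub> = 1"
proof -
  have "\<one>\<^bsub>B\<^esub> = ord.mnm \<one>\<^bsub>R_ring\<^esub> 0" unfolding B_simps by (rule ord.P.monom_one[symmetric])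
  moreover have "\<one>\<^bsub>R_ring\<^esub> \<in> ideal_power R_ring I 0" unfolding R.ideal_power_0 by (rule R.one_closed)
  then have "\<Theta> (ord.mnm \<one>\<^bsub>R_ring\<^esub> 0) = Polynomial.monom 1 0" using low_one by (intro \<Theta>_mnm) simp_all
  ultimately show ?thesis by (simp only: monom_eq_1)
qed

definition \<aa> where "\<aa> = Idl\<^bsub>B\<^esub> ((\<lambda>r. ord.mnm r 0) ` mR)"

lemma mR_carrier: "r \<in> mR \<Longrightarrow> r \<in> carrier R_ring"
  by (rule ideal.Icarr[OF mR_ideal])

lemma mnm_0_B: "r \<in> carrier R_ring \<Longrightarrow> ord.mnm r 0 \<in> carrier B"
  unfolding B_simps by (rule ord.mnm_H) (simp only: R.ideal_power_0)

lemma \<aa>_gens: "(\<lambda>r. ord.mnm r 0) ` mR \<subseteq> carrier B"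
  using mnm_0_B mR_carrier by blast

lemma ideal_\<aa>: "ideal \<aa> B"
  unfolding \<aa>_def by (rule B.genideal_ideal[OF \<aa>_gens])

lemma fiber_cone_eq: "fiber_cone R_ring I = B Quot \<aa>"
  unfolding fiber_cone_def \<aa>_def B_def R_local(2) ..

lemma kernel_prime:
  fixes g :: "complex poly poly poly \<Rightarrow> complex poly poly poly"
  assumes g: "is_hom g"
  shows "primeideal {b \<in> carrier B. map_poly g (\<Theta> b) = 0} B" "\<aa> \<subseteq> {b \<in> carrier B. map_poly g (\<Theta> b) = 0}"
proof -
  note m = is_hom_simps[OF is_hom_map_poly[OF g]]
  show p: "primeideal {b \<in> carrier B. map_poly g (\<Theta> b) = 0} B"
    by (rule primeideal_hom_kernel[where h = "\<lambda>b. map_poly g (\<Theta> b)", OF B_cring])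
       (simp_all only: \<Theta>_one \<Theta>_add \<Theta>_mult m)
  show "\<aa> \<subseteq> {b \<in> carrier B. map_poly g (\<Theta> b) = 0}"
    unfolding \<aa>_def
  proof (rule B.genideal_minimal[OF primeideal.axioms(1)[OF p]], clarify)
    fix r assume r: "r \<in> mR"
    obtain f s where f: "r = fr f s" "at0 s \<noteq> 0" using mR_carrier[OF r] by (rule R_cases)
    then have "hcomp 0 f = 0" using r by (simp add: fr_mem_mR at0_hcomp is_hom_zero[OF is_hom_cst])
    then have "low 0 r 0" using ex_low[of s 0 f] f by auto
    then have l: "low (Suc n * 0) r 0" by simp
    have "r \<in> ideal_power R_ring I 0" unfolding R.ideal_power_0 by (rule mR_carrier[OF r])
    then have "\<Theta> (ord.mnm r 0) = 0" using \<Theta>_mnm[OF _ l] by simp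
    then show "ord.mnm r 0 \<in> carrier B \<and> map_poly g (\<Theta> (ord.mnm r 0)) = 0"
      using mnm_0_B[OF mR_carrier[OF r]] by simp
  qed
qed

text \<open>The evaluations at \<open>(x, y, z)\<close>, \<open>(0, y, z)\<close>, \<open>(0, z, z)\<close> and \<open>(0, 0, 0)\<close> have larger and larger
  kernels; on the three generators of the Fermat ideal the differences are seen at \<open>f1\<close>,
  \<open>f2 + f3\<close> and \<open>f2\<close>.\<close>

lemma chain_fiber:
  assumes n: "2 \<le> n"
  shows "\<exists>P. prime_chain B \<aa> 3 P"
proof -
  define g where "g i = (if i = 0 then ev cst varx vary varz else if i = 1 then ev cst 0 vary varz
    else if i = 2 then ev cst 0 varz varz else ev cst 0 0 0)" for i :: nat
  have hom: "is_hom (g i)" for i by (simp add: g_def is_hom_ev[OF is_hom_cst])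
  define P where "P i = {b \<in> carrier B. map_poly (g i) (\<Theta> b) = 0}" for i
  have memP: "b \<in> P i \<longleftrightarrow> b \<in> carrier B \<and> (\<forall>k. g i (poly.coeff (\<Theta> b) k) = 0)" for b i
    by (auto simp: P_def poly_eq_iff coeff_map_poly is_hom_zero[OF hom])
  have comp: "g (Suc i) f = g (Suc i) (g i f)" for i f
  proof -
    consider "i = 0" | "i = 1" | "i = 2" | "i \<ge> 3" by linarith
    then show ?thesis
      by cases (simp_all add: g_def ev_comp[OF is_hom_ev[OF is_hom_cst] is_hom_cst] ev_gens[OF is_hom_cst]
        is_hom_zero[OF is_hom_ev[OF is_hom_cst]] del: ev_self)
  qed
  have sub: "P i \<subseteq> P (Suc i)" for i
    unfolding subset_iff memP using comp[of i] is_hom_zero[OF hom] by metis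
  have lowf: "low (Suc n * 1) (fr f 1) f" if "homog (Suc n) f" for f
    using low_fr[of 1 "Suc n" f] that by (simp add: hcomp_homog)
  have wit: "ord.mnm (fr f 1) 1 \<in> P i \<longleftrightarrow> g i f = 0" if f: "f \<in> Jp 1" "homog (Suc n) f" for f i
  proof -
    have r: "fr f 1 \<in> ideal_power R_ring I 1"
      unfolding ideal_power_I E_eq using f(1) at0_1 zero_neq_one by (metis (mono_tags, lifting) mem_Collect_eq)
    have "ord.mnm (fr f 1) 1 \<in> carrier B" unfolding B_simps by (rule ord.mnm_H[OF r])
    then show ?thesis
      unfolding memP \<Theta>_mnm[OF r lowf[OF f(2)]] by (auto simp: is_hom_zero[OF hom])
  qed
  have f23: "f2 + f3 \<in> Jp 1" "homog (Suc n) (f2 + f3)" using Jp_add f_Jp homog_add homog_f by blast+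
  have v0: "v \<noteq> 0" using degree_v n_pos by auto
  have "g 0 f1 \<noteq> 0" using v0 by (simp add: g_def f1_def)
  moreover have "g 1 f1 = 0" by (simp add: g_def f1_def ev_cst_simps)
  ultimately have s0: "P 0 \<noteq> P (Suc 0)" using wit[OF f_Jp(1) homog_f(1)] by auto
  have "cf (vary * varz ^ n - varz * vary ^ n) 0 1 n = 1"
    using n cf_vary[of "varz ^ n * 1" 0 1 n] cf_varz[of "vary ^ n * 1" 0 1 n] cf_cst[of 1]
    by (simp only: cf_diff mult_1_right cf_varz_power[of n 1] cf_vary_power[of n 1] is_hom_one[OF is_hom_cst, symmetric])
       (simp add: cf_varz_power[where f = 1, simplified] cf_vary_power[where f = 1, simplified] is_hom_one[OF is_hom_cst])
  then have "vary * varz ^ n - varz * vary ^ n \<noteq> 0" by auto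
  then have "g 1 (f2 + f3) \<noteq> 0" using n_pos by (simp add: g_def f2_def f3_def w_def u_def ev_cst_simps power_0_left)
  moreover have "g 2 (f2 + f3) = 0" using n_pos by (simp add: g_def f2_def f3_def w_def u_def ev_cst_simps power_0_left)
  ultimately have s1: "P 1 \<noteq> P (Suc 1)" using wit[OF f23] by (auto simp: numeral_2_eq_2)
  have "g 2 f2 \<noteq> 0" using n_pos by (simp add: g_def f2_def w_def ev_cst_simps power_0_left)
  moreover have "g 3 f2 = 0" by (simp add: g_def f2_def ev_cst_simps)
  ultimately have s2: "P 2 \<noteq> P (Suc 2)" using wit[OF f_Jp(2) homog_f(2)] by (auto simp: eval_nat_numeral)
  have "P i \<subset> P (Suc i)" if "i < 3" for i
  proof -
    have "i = 0 \<or> i = 1 \<or> i = 2" using that by auto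
    then have "P i \<noteq> P (Suc i)" using s0 s1 s2 by blast
    then show ?thesis using sub[of i] by blast
  qed
  then have "prime_chain B \<aa> 3 P"
    unfolding prime_chain_def P_def using kernel_prime[OF hom] by blast
  then show ?thesis by blast
qed

text \<open>The forms of degree \<open>k\<close> in three variables, evaluated at \<open>f1, f2, f3\<close>, become the coefficient of \<open>t\<^sup>k\<close>.\<close>

definition \<Gamma> :: "complex poly poly poly \<Rightarrow> complex poly poly poly poly" where
  "\<Gamma> = ev (\<lambda>c. [:cst c:]) [:0, f1:] [:0, f2:] [:0, f3:]"

lemma is_hom_\<Gamma>: "is_hom \<Gamma>"
  unfolding \<Gamma>_def by (rule is_hom_ev[OF is_hom_const_cst])

lemmas \<Gamma>_gens = ev_gens[OF is_hom_const_cst, of "[:0, f1:]" "[:0, f2:]" "[:0, f3:]", folded \<Gamma>_def]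

lemma coeff_\<Gamma>: "poly.coeff (\<Gamma> f) k \<in> Jp k"
proof -
  have step: "poly.coeff ([:0, g:] * p) k \<in> Jp k" if "g \<in> Jp 1" "\<And>k. poly.coeff p k \<in> Jp k" for g p k
  proof (cases k)
    case (Suc j)
    have "g * poly.coeff p j \<in> Jp (1 + j)" by (rule Jp_mult[OF that])
    then show ?thesis by (simp add: Suc del: Jp.simps)
  qed simp
  show ?thesis
  proof (induction f arbitrary: k rule: S_induct)
    case (cst c)
    then show ?case by (cases k) (simp_all add: \<Gamma>_gens del: Jp.simps(2))
  next
    case (add f g)
    then show ?case by (simp add: is_hom_add[OF is_hom_\<Gamma>] Jp_add)
  qed (simp_all only: is_hom_mult[OF is_hom_\<Gamma>] \<Gamma>_gens step f_Jp)
qed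

definition \<Psi> :: "complex poly poly poly \<Rightarrow> nat \<Rightarrow> (complex poly poly poly \<times> complex poly poly poly) set" where
  "\<Psi> f = (\<lambda>k. fr (poly.coeff (\<Gamma> f) k) 1)"

lemma \<Psi>_UP: "\<Psi> f \<in> carrier (UP R_ring)" "ord.cof (\<Psi> f) k = fr (poly.coeff (\<Gamma> f) k) 1"
proof -
  have "bound \<zero>\<^bsub>R_ring\<^esub> (Polynomial.degree (\<Gamma> f)) (\<Psi> f)"
    by (rule bound.intro) (simp add: \<Psi>_def fr_zero coeff_eq_0)
  then have u: "\<Psi> f \<in> up R_ring" by (intro mem_upI) (auto simp: \<Psi>_def)
  show "\<Psi> f \<in> carrier (UP R_ring)" unfolding UP_carrier by (rule u)
  show "ord.cof (\<Psi> f) k = fr (poly.coeff (\<Gamma> f) k) 1" unfolding UP_coeff[OF u] by (simp only: \<Psi>_def)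
qed

lemma \<Psi>_B: "\<Psi> f \<in> carrier B"
  unfolding B_simps ord.H_def
proof (intro CollectI conjI allI \<Psi>_UP(1))
  show "ord.cof (\<Psi> f) k \<in> ideal_power R_ring I k" for k
    unfolding \<Psi>_UP(2) ideal_power_I E_eq using coeff_\<Gamma>[of f k] at0_1 zero_neq_one
    by (metis (mono_tags, lifting) mem_Collect_eq)
qed

lemma fr_sum: "finite A \<Longrightarrow> fr (\<Sum>i\<in>A. g i) 1 = (\<Oplus>\<^bsub>R_ring\<^esub>i\<in>A. fr (g i) 1)"
proof (induction A rule: finite_induct)
  case (insert i A)
  have "fr (\<Sum>i\<in>insert i A. g i) 1 = fr (g i) 1 \<oplus>\<^bsub>R_ring\<^esub> fr (\<Sum>i\<in>A. g i) 1"
    using insert.hyps by (simp add: fr_add)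
  then show ?case using insert by (simp add: Pi_def)
qed (simp add: fr_zero)

lemma \<Psi>_hom: "\<Psi> \<in> ring_hom S_ring B"
proof (rule ring_hom_memI)
  fix f g
  show "\<Psi> f \<in> carrier B" by (rule \<Psi>_B)
  show "\<Psi> (f \<otimes>\<^bsub>S_ring\<^esub> g) = \<Psi> f \<otimes>\<^bsub>B\<^esub> \<Psi> g"
    unfolding B_simps
  proof (rule ord.P.up_eqI)
    fix k
    show "ord.cof (\<Psi> (f \<otimes>\<^bsub>S_ring\<^esub> g)) k = ord.cof (\<Psi> f \<otimes>\<^bsub>UP R_ring\<^esub> \<Psi> g) k"
      by (simp add: \<Psi>_UP is_hom_mult[OF is_hom_\<Gamma>] coeff_mult fr_sum fr_mult)
  qed (simp_all add: \<Psi>_UP)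
  show "\<Psi> (f \<oplus>\<^bsub>S_ring\<^esub> g) = \<Psi> f \<oplus>\<^bsub>B\<^esub> \<Psi> g"
    unfolding B_simps
    by (rule ord.P.up_eqI) (simp_all add: \<Psi>_UP is_hom_add[OF is_hom_\<Gamma>] fr_add)
  show "\<Psi> \<one>\<^bsub>S_ring\<^esub> = \<one>\<^bsub>B\<^esub>"
    unfolding B_simps
    by (rule ord.P.up_eqI) (simp_all add: \<Psi>_UP is_hom_one[OF is_hom_\<Gamma>] fr_one fr_zero)
qed

lemma \<Psi>_cst: "\<Psi> (cst c) = ord.mnm (fr (cst c) 1) 0"
proof (rule ord.P.up_eqI)
  fix k show "ord.cof (\<Psi> (cst c)) k = ord.cof (ord.mnm (fr (cst c) 1) 0) k"
    by (cases k) (simp_all add: \<Psi>_UP \<Gamma>_gens fr_zero)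
qed (simp_all add: \<Psi>_UP)

lemma \<Psi>_var: "\<Psi> varx = ord.mnm (fr f1 1) 1" "\<Psi> vary = ord.mnm (fr f2 1) 1" "\<Psi> varz = ord.mnm (fr f3 1) 1"
proof -
  have *: "\<Psi> h = ord.mnm (fr g 1) 1" if "\<Gamma> h = [:0, g:]" for h g
  proof (rule ord.P.up_eqI)
    show "ord.cof (\<Psi> h) k = ord.cof (ord.mnm (fr g 1) 1) k" for k
      by (simp add: \<Psi>_UP that fr_zero coeff_pCons split: nat.splits)
  qed (simp_all add: \<Psi>_UP)
  show "\<Psi> varx = ord.mnm (fr f1 1) 1" "\<Psi> vary = ord.mnm (fr f2 1) 1" "\<Psi> varz = ord.mnm (fr f3 1) 1"
    by (rule *[OF \<Gamma>_gens(1)] *[OF \<Gamma>_gens(2)] *[OF \<Gamma>_gens(3)])+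
qed

text \<open>Modulo the maximal ideal every element of \<open>I\<^sup>k\<close> is a form of degree \<open>k\<close> in \<open>f1, f2, f3\<close> with
  complex coefficients, so the fiber cone is a quotient of the polynomial ring in three variables.\<close>

lemma \<Psi>_surj:
  assumes "b \<in> carrier B"
  shows "\<exists>f. \<aa> +>\<^bsub>B\<^esub> b = \<aa> +>\<^bsub>B\<^esub> \<Psi> f"
proof -
  interpret a: ideal \<aa> B by (rule ideal_\<aa>)
  interpret Qt: ring "B Quot \<aa>" by (rule a.quotient_is_ring)
  interpret pi: ring_hom_ring B "B Quot \<aa>" "(+>\<^bsub>B\<^esub>) \<aa>" by (rule a.rcos_ring_hom_ring)
  interpret psi: ring_hom_ring S_ring B \<Psi>
    by (rule ring_hom_ringI2[OF Sm.ring_axioms B.ring_axioms \<Psi>_hom])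
  define A where "A = {b \<in> carrier B. \<exists>f. \<aa> +>\<^bsub>B\<^esub> b = \<aa> +>\<^bsub>B\<^esub> \<Psi> f}"
  have psiA: "\<Psi> f \<in> A" for f unfolding A_def using \<Psi>_B by blast
  have sub: "subring A B"
  proof (rule B.subringI)
    show "A \<subseteq> carrier B" unfolding A_def by blast
    show "\<one>\<^bsub>B\<^esub> \<in> A" using psiA[of 1] psi.hom_one by simp
    fix p assume p: "p \<in> A"
    then obtain f where f: "p \<in> carrier B" "\<aa> +>\<^bsub>B\<^esub> p = \<aa> +>\<^bsub>B\<^esub> \<Psi> f" unfolding A_def by blast
    have "\<aa> +>\<^bsub>B\<^esub> (\<ominus>\<^bsub>B\<^esub> p) = \<aa> +>\<^bsub>B\<^esub> (\<ominus>\<^bsub>B\<^esub> \<Psi> f)"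
      using f \<Psi>_B by (simp only: pi.hom_a_inv)
    also have "\<ominus>\<^bsub>B\<^esub> \<Psi> f = \<Psi> (\<ominus>\<^bsub>S_ring\<^esub> f)" by (rule psi.hom_a_inv[symmetric]) simp
    finally show "\<ominus>\<^bsub>B\<^esub> p \<in> A" unfolding A_def using f(1) by blast
    fix q assume q: "q \<in> A"
    then obtain g where g: "q \<in> carrier B" "\<aa> +>\<^bsub>B\<^esub> q = \<aa> +>\<^bsub>B\<^esub> \<Psi> g" unfolding A_def by blast
    have "\<aa> +>\<^bsub>B\<^esub> (p \<otimes>\<^bsub>B\<^esub> q) = \<aa> +>\<^bsub>B\<^esub> (\<Psi> f \<otimes>\<^bsub>B\<^esub> \<Psi> g)" using f g \<Psi>_B by (simp only: pi.hom_mult)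
    also have "\<Psi> f \<otimes>\<^bsub>B\<^esub> \<Psi> g = \<Psi> (f * g)" using psi.hom_mult[of f g] by simp
    finally show "p \<otimes>\<^bsub>B\<^esub> q \<in> A" unfolding A_def using f g by blast
    have "\<aa> +>\<^bsub>B\<^esub> (p \<oplus>\<^bsub>B\<^esub> q) = \<aa> +>\<^bsub>B\<^esub> (\<Psi> f \<oplus>\<^bsub>B\<^esub> \<Psi> g)" using f g \<Psi>_B by (simp only: pi.hom_add)
    also have "\<Psi> f \<oplus>\<^bsub>B\<^esub> \<Psi> g = \<Psi> (f + g)" using psi.hom_add[of f g] by simp
    finally show "p \<oplus>\<^bsub>B\<^esub> q \<in> A" unfolding A_def using f g by blast
  qed
  have mem: "ord.mnm (fr g s) k \<in> A" if "g \<in> Jp k" "at0 s \<noteq> 0" for g s k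
    using that(1)
  proof (induction k arbitrary: g)
    case 0
    define c where "c = at0 g / at0 s"
    define m where "m = fr (g - cst c * s) s"
    have m: "m \<in> mR" unfolding m_def using that(2) by (simp add: fr_mem_mR at0_simps at0_gens c_def)
    have "fr g s = fr (cst c) 1 \<oplus>\<^bsub>R_ring\<^esub> m" unfolding m_def using that(2) by (simp add: fr_add fr_eq_iff algebra_simps)
    then have eq: "ord.mnm (fr g s) 0 = \<Psi> (cst c) \<oplus>\<^bsub>B\<^esub> ord.mnm m 0"
      unfolding \<Psi>_cst B_simps using mR_carrier[OF m] by simp
    have ma: "ord.mnm m 0 \<in> \<aa>" unfolding \<aa>_def using B.genideal_self[OF \<aa>_gens] m by blast
    have cos: "\<aa> +>\<^bsub>B\<^esub> (\<Psi> (cst c) \<oplus>\<^bsub>B\<^esub> ord.mnm m 0) = \<aa> +>\<^bsub>B\<^esub> \<Psi> (cst c)"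
      if m: "ord.mnm m 0 \<in> \<aa>"
    proof -
      have "\<aa> +>\<^bsub>B\<^esub> ord.mnm m 0 = \<zero>\<^bsub>B Quot \<aa>\<^esub>" unfolding quot_zero by (rule a.a_rcos_const[OF m])
      then have "\<aa> +>\<^bsub>B\<^esub> (\<Psi> (cst c) \<oplus>\<^bsub>B\<^esub> ord.mnm m 0) = (\<aa> +>\<^bsub>B\<^esub> \<Psi> (cst c)) \<oplus>\<^bsub>B Quot \<aa>\<^esub> \<zero>\<^bsub>B Quot \<aa>\<^esub>"
        using pi.hom_add[OF \<Psi>_B a.Icarr[OF m], of "cst c"] by (simp only:)
      then show ?thesis using Qt.r_zero[OF pi.hom_closed[OF \<Psi>_B]] by (simp only:)
    qed
    have "ord.mnm (fr g s) 0 \<in> carrier B" using that(2) by (intro mnm_0_B fr_closed)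
    moreover have "\<aa> +>\<^bsub>B\<^esub> ord.mnm (fr g s) 0 = \<aa> +>\<^bsub>B\<^esub> \<Psi> (cst c)" unfolding eq by (rule cos[OF ma])
    ultimately show ?case unfolding A_def by (intro CollectI conjI exI)
  next
    case (Suc k)
    then obtain p q r where g: "g = f1 * p + f2 * q + f3 * r" "p \<in> Jp k" "q \<in> Jp k" "r \<in> Jp k" by auto
    have step: "ord.mnm (fr (h * p) s) (Suc k) \<in> A" if "ord.mnm (fr h 1) 1 \<in> A" "p \<in> Jp k" for h p
    proof -
      have "ord.mnm (fr h 1) 1 \<otimes>\<^bsub>B\<^esub> ord.mnm (fr p s) k \<in> A" using subringE(6)[OF sub that(1) Suc.IH[OF that(2)]] .
      also have "ord.mnm (fr h 1) 1 \<otimes>\<^bsub>B\<^esub> ord.mnm (fr p s) k = ord.mnm (fr h 1 \<otimes>\<^bsub>R_ring\<^esub> fr p s) (1 + k)"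
        unfolding B_simps by (rule ord.P.monom_mult[symmetric]) (use \<open>at0 s \<noteq> 0\<close> in simp_all)
      finally show ?thesis using \<open>at0 s \<noteq> 0\<close> by (simp add: fr_mult)
    qed
    have "ord.mnm (fr g s) (Suc k) = (ord.mnm (fr (f1 * p) s) (Suc k) \<oplus>\<^bsub>B\<^esub> ord.mnm (fr (f2 * q) s) (Suc k))
      \<oplus>\<^bsub>B\<^esub> ord.mnm (fr (f3 * r) s) (Suc k)"
      unfolding B_simps g(1) using that(2) by (simp add: ord.P.monom_add[symmetric] fr_add_same del: ord.P.monom_add)
    moreover have "ord.mnm (fr f1 1) 1 \<in> A" "ord.mnm (fr f2 1) 1 \<in> A" "ord.mnm (fr f3 1) 1 \<in> A"
      using psiA[of varx] psiA[of vary] psiA[of varz] by (simp_all only: \<Psi>_var)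
    ultimately show ?case using step g(2-4) subringE(7)[OF sub] by (simp only:)
  qed
  have "A = carrier B"
    unfolding B_eq
  proof (rule ord.subring_rees_eq)
    show "subring A (rees_of_filtration R_ring (ideal_power R_ring I))" using sub unfolding B_eq .
    show "ord.mnm r k \<in> A" if "r \<in> ideal_power R_ring I k" for r k
      using that mem unfolding ideal_power_I E_eq by auto
  qed
  then show ?thesis using assms unfolding A_def by blast
qed

lemma no_chain_fiber: "\<not> prime_chain B \<aa> 4 Q"
proof
  assume Q: "prime_chain B \<aa> 4 Q"
  have "prime_chain S_ring {} 4 (\<lambda>i. {f \<in> carrier S_ring. \<Psi> f \<in> Q i})"
  proof (rule prime_chain_vimage[OF S_cring B_cring \<Psi>_hom Q])
    fix i x assume i: "i < 4" "x \<in> Q (Suc i)" "x \<notin> Q i"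
    have pr: "primeideal (Q i) B" "primeideal (Q (Suc i)) B" and sub: "\<aa> \<subseteq> Q i" "\<aa> \<subseteq> Q (Suc i)"
      using Q i(1) unfolding prime_chain_def by simp_all
    note id = primeideal.axioms(1)[OF pr(1)] primeideal.axioms(1)[OF pr(2)]
    have xc: "x \<in> carrier B" using ideal.Icarr[OF id(2) i(2)] .
    obtain f where f: "\<aa> +>\<^bsub>B\<^esub> x = \<aa> +>\<^bsub>B\<^esub> \<Psi> f" using \<Psi>_surj[OF xc] by blast
    have "\<Psi> f \<in> Q (Suc i)"
      using B.quot_mem_iff[OF ideal_\<aa> id(2) sub(2) \<Psi>_B[of f]] i(2) f by (metis imageI)
    moreover have "\<Psi> f \<notin> Q i"
      using B.quot_mem_iff[OF ideal_\<aa> id(1) sub(1) xc] i(3) f by (metis imageI)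
    ultimately show "\<exists>f\<in>carrier S_ring. \<Psi> f \<in> Q (Suc i) \<and> \<Psi> f \<notin> Q i" by auto
  qed simp
  then show False using no_chain_S by blast
qed

theorem analytic_spread_fermat:
  assumes "2 \<le> n"
  shows "analytic_spread R_ring I = 3"
proof -
  have "krull_dim (B Quot \<aa>) = enat 3"
  proof (rule krull_dim_eqI)
    show "\<exists>P. prime_chain (B Quot \<aa>) {} 3 P"
      unfolding B.prime_chain_quot[OF ideal_\<aa>] by (rule chain_fiber[OF assms])
    show "\<nexists>P. prime_chain (B Quot \<aa>) {} (Suc 3) P"
      unfolding B.prime_chain_quot[OF ideal_\<aa>] using no_chain_fiber by simp
  qed
  then show ?thesis unfolding analytic_spread_def fiber_cone_eq by (simp add: numeral_eq_enat)
qed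

end

theorem mainTheorem5:
  fixes n :: nat
  assumes "n \<ge> 3"
  shows "analytic_spread R_ring (local_fermat_ideal n) = 3 \<and>
    (\<forall>k\<ge>(1::nat). Cohen_Macaulay (R_ring Quot symbolic_power R_ring (local_fermat_ideal n) k)) \<and>
    noetherian_ring (symbolic_rees_algebra R_ring (local_fermat_ideal n)) \<and>
    set_theoretic_complete_intersection R_ring (local_fermat_ideal n)"
proof -
  interpret fermat n by unfold_locales (use assms in simp)
  show ?thesis
    using analytic_spread_fermat Cohen_Macaulay_fermat noetherian_symbolic_rees set_theoretic_complete_intersection_fermat assms by simp
qed

end
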